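(* Let $G$ be a generator signature of arity $n$ on domain size $2$ of full rank, with $\mathrm{rank}\,G(t)=2$ for some $1\leq t\leq n$, and let $M$ be a $2^{\ell}\times 2$ complex matrix of rank $2$ such that $\underline{G}=M^{\otimes n}G$ is the standard signature of a generator matchgate of arity $n\ell$. Let $\sigma,\tau\in\{0,1\}^{\ell}$, $\sigma\neq\tau$, be such that the rows $\underline{G}(t)^{\sigma}$ and $\underline{G}(t)^{\tau}$ are linearly independent and $\mathrm{wt}(\sigma\oplus\tau)$ is minimal among all pairs $u\neq v$ with $\underline{G}(t)^{u},\underline{G}(t)^{v}$ linearly independent. Let $M^{\sigma,\tau}$ be the $2\times 2$ submatrix of $M$ formed by the rows indexed by $\sigma$ and $\tau$ (in this order). Then $(M^{\sigma,\tau})^{\otimes n}G$ is the standard signature of a generator matchgate of arity $n$, and some matrix form $((M^{\sigma,\tau})^{\otimes n}G)(s)$ has rank $2$.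
   Context: A matchgate is a planar graph $H$ with complex edge weights together with designated output nodes on the outer face (labelled in counterclockwise order); a generator matchgate has only output nodes. Its standard signature is the vector in $\mathbb{C}^{2^{m}}$ ($m$ the number of output nodes) whose entry indexed by $i_{1}\cdots i_{m}\in\{0,1\}^{m}$ (lexicographic order) is the sum over perfect matchings of $H-Z$ of the product of edge weights, $Z$ being the set of output nodes $j$ with $i_{j}=1$. Rows of $M$ are indexed by $\{0,1\}^{\ell}$ lexicographically. A generator signature of arity $n$ on domain size $k$ is $G=(G^{j_{1}\cdots j_{n}})\in\mathbb{C}^{k^{n}}$; $G(t)$ is the $k\times k^{n-1}$ matrix with rows indexed by $j_{t}$ and columns by the remaining indices in lexicographic order. $G$ is degenerate if $G=\gamma_{1}\otimes\cdots\otimes\gamma_{n}$ with $\gamma_{i}\in\mathbb{C}^{k}$, and of full rank if not degenerate and $\mathrm{rank}\,G(t)=k$ for some $t$. A vector in $\mathbb{C}^{2^{nb}}$ is indexed by $\alpha_{1}\cdots\alpha_{n}$ with blocks $\alpha_{i}\in\{0,1\}^{b}$; its $s$-th matrix form is the $2^{b}\times 2^{(n-1)b}$ matrix with rows indexed by $\alpha_{s}$ and columns by the other blocks lexicographically, and $\underline{G}(t)^{\alpha}$ is the row of $\underline{G}(t)$ indexed by $\alpha$ (blocks of size $\ell$ for $\underline{G}$, size $1$ for $(M^{\sigma,\tau})^{\otimes n}G$). $\mathrm{wt}$ is Hamming weight and $\oplus$ bitwise XOR. *)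

theory Defs
  imports "HOL-Analysis.Analysis" "Jordan_Normal_Form.DL_Rank"
begin

unbundle no vec_syntax

hide_const (open) Finite_Cartesian_Product.vec Finite_Cartesian_Product.row
  Finite_Cartesian_Product.mat
hide_type (open) Finite_Cartesian_Product.vec

section \<open>Words, tensors and matrix forms\<close>

text \<open>A word \<open>i\<^sub>1 \<dots> i\<^sub>n\<close> over the alphabet \<open>{0, \<dots>, b - 1}\<close> is identified with its position in the
  lexicographic order, that is with the number \<open>\<Sum>s. i\<^sub>s * b ^ (n - s)\<close>. Positions are counted
  from 1, and letter 1 is the most significant one. In particular a bit string
  of length \<open>l\<close> is a number below \<open>2 ^ l\<close>, and concatenating \<open>n\<close> blocks of \<open>l\<close> bits gives the
  word of length \<open>n\<close> over the alphabet of size \<open>2 ^ l\<close> with the same number.\<close>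

definition digit :: "nat \<Rightarrow> nat \<Rightarrow> nat \<Rightarrow> nat \<Rightarrow> nat" where
  "digit b n s x = (x div b ^ (n - s)) mod b"

definition hamming_weight :: "nat \<Rightarrow> nat" where
  "hamming_weight x = card {i. bit x i}"

definition tensor_vecs :: "nat \<Rightarrow> nat \<Rightarrow> (nat \<Rightarrow> complex Matrix.vec) \<Rightarrow> complex Matrix.vec" where
  "tensor_vecs k n \<gamma> = Matrix.vec (k ^ n) (\<lambda>x. \<Prod>s = 1..n. \<gamma> s $ digit k n s x)"

definition tensor_power :: "nat \<Rightarrow> complex Matrix.mat \<Rightarrow> complex Matrix.mat" where
  "tensor_power n A = Matrix.mat (dim_row A ^ n) (dim_col A ^ n)
     (\<lambda>(x, y). \<Prod>s = 1..n. A $$ (digit (dim_row A) n s x, digit (dim_col A) n s y))"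

text \<open>For \<open>v\<close> of dimension \<open>b ^ n\<close>: in row \<open>a\<close> and column \<open>c\<close>, a word with \<open>n - 1\<close> letters, stands the
  entry of \<open>v\<close> at the word obtained from \<open>c\<close> by inserting \<open>a\<close> as the \<open>s\<close>-th letter.\<close>

definition matrix_form :: "nat \<Rightarrow> nat \<Rightarrow> nat \<Rightarrow> complex Matrix.vec \<Rightarrow> complex Matrix.mat" where
  "matrix_form b n s v = Matrix.mat b (b ^ (n - 1))
     (\<lambda>(a, c). v $ ((c div b ^ (n - s)) * b ^ (n - s + 1) + a * b ^ (n - s) + c mod b ^ (n - s)))"

abbreviation mat_rank :: "complex Matrix.mat \<Rightarrow> nat" where
  "mat_rank A \<equiv> vec_space.rank (dim_row A) A"

text \<open>Independence of the pair as a family: unlike independence of the set \<open>{u, v}\<close>, it fails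
  for \<open>u = v\<close>.\<close>

definition lin_indpt_pair :: "complex Matrix.vec \<Rightarrow> complex Matrix.vec \<Rightarrow> bool" where
  "lin_indpt_pair u v \<longleftrightarrow>
     (\<forall>a b. a \<cdot>\<^sub>v u + b \<cdot>\<^sub>v v = 0\<^sub>v (dim_vec u) \<longrightarrow> a = 0 \<and> b = 0)"

section \<open>Signatures of arity \<open>n\<close> on domain size \<open>k\<close>\<close>

definition degenerate :: "nat \<Rightarrow> nat \<Rightarrow> complex Matrix.vec \<Rightarrow> bool" where
  "degenerate k n G \<longleftrightarrow>
     (\<exists>\<gamma>. (\<forall>s\<in>{1..n}. \<gamma> s \<in> carrier_vec k) \<and> G = tensor_vecs k n \<gamma>)"

definition full_rank :: "nat \<Rightarrow> nat \<Rightarrow> complex Matrix.vec \<Rightarrow> bool" where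
  "full_rank k n G \<longleftrightarrow>
     \<not> degenerate k n G \<and> (\<exists>t\<in>{1..n}. mat_rank (matrix_form k n t G) = k)"

section \<open>Generator matchgates\<close>

text \<open>A finite simple graph drawn in the plane: vertices are points, an edge is
  the set of its two ends, and \<open>curve\<close> gives the arc that draws an edge.\<close>

record matchgate =
  verts :: "complex set"
  edges :: "complex set set"
  weight :: "complex set \<Rightarrow> complex"
  curve :: "complex set \<Rightarrow> real \<Rightarrow> complex"
  outputs :: "complex list"

definition plane_graph :: "matchgate \<Rightarrow> bool" where
  "plane_graph H \<longleftrightarrow>
     finite (verts H) \<and>
     (\<forall>e\<in>edges H. e \<subseteq> verts H \<and> card e = 2 \<and>
        arc (curve H e) \<and> {pathstart (curve H e), pathfinish (curve H e)} = e \<and>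
        path_image (curve H e) \<inter> verts H = e) \<and>
     (\<forall>e\<in>edges H. \<forall>f\<in>edges H. e \<noteq> f \<longrightarrow>
        path_image (curve H e) \<inter> path_image (curve H f) \<subseteq> e \<inter> f)"

definition drawing :: "matchgate \<Rightarrow> complex set" where
  "drawing H = verts H \<union> (\<Union>e\<in>edges H. path_image (curve H e))"

abbreviation outer_face :: "matchgate \<Rightarrow> complex set" where
  "outer_face H \<equiv> outside (drawing H)"

text \<open>The counterclockwise order around the outer face is the one in which
  disjoint arcs drawn from the nodes through the outer face arrive at a circle enclosing the
  drawing; the first node may be any of them. A cut vertex met several times on
  the boundary of the outer face may be used at any one of its occurrences.
  Such arcs exist only for vertices on the boundary of the outer face; see
  \<open>outputs_on_outer_face\<close> below.\<close>

definition ccw_on_outer_face :: "matchgate \<Rightarrow> complex list \<Rightarrow> bool" where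
  "ccw_on_outer_face H ps \<longleftrightarrow>
     (\<exists>R \<theta> h.
        drawing H \<subseteq> ball 0 R \<and>
        (\<forall>i j. i < j \<and> j < length ps \<longrightarrow> \<theta> i < \<theta> j \<and> \<theta> j < \<theta> i + 2 * pi) \<and>
        (\<forall>j<length ps. arc (h j) \<and>
           pathstart (h j) = ps ! j \<and> pathfinish (h j) = of_real R * cis (\<theta> j) \<and>
           path_image (h j) - {ps ! j} \<subseteq> outer_face H \<and>
           path_image (h j) - {pathfinish (h j)} \<subseteq> ball 0 R) \<and>
        (\<forall>i<length ps. \<forall>j<length ps. i \<noteq> j \<longrightarrow> path_image (h i) \<inter> path_image (h j) = {}))"

definition generator_matchgate :: "matchgate \<Rightarrow> bool" where
  "generator_matchgate H \<longleftrightarrow>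
     plane_graph H \<and> distinct (outputs H) \<and> set (outputs H) \<subseteq> verts H \<and>
     ccw_on_outer_face H (outputs H)"

lemma outputs_on_outer_face:
  assumes "generator_matchgate H" and "p \<in> set (outputs H)"
  shows "p \<in> frontier (outer_face H)"
proof -
  obtain j where j: "j < length (outputs H)" "p = outputs H ! j"
    using assms(2) by (metis in_set_conv_nth)
  obtain g where g: "arc g" "pathstart g = p" "path_image g - {p} \<subseteq> outer_face H"
    using assms(1) j unfolding generator_matchgate_def ccw_on_outer_face_def by blast
  have "p \<in> drawing H"
    using assms unfolding generator_matchgate_def drawing_def by blast
  hence notin: "p \<notin> outer_face H"
    by (simp add: outside_def)
  have "p \<in> path_image g" using g(2) pathstart_in_path_image by blast
  moreover have "connected (path_image g)"
    using g(1) arc_imp_path connected_path_image by blast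
  moreover have "pathfinish g \<in> path_image g - {p}"
    using g(1,2) arc_distinct_ends by (auto simp: pathfinish_in_path_image)
  ultimately have "p islimpt path_image g"
    by (metis DiffD1 DiffD2 connected_imp_perfect insertI1 singletonD)
  hence "p islimpt path_image g - {p}"
    by (simp add: islimpt_punctured[of p "path_image g"])
  hence "p islimpt outer_face H"
    using g(3) islimpt_subset by blast
  hence "p \<in> closure (outer_face H)"
    by (simp add: closure_def)
  moreover have "p \<notin> interior (outer_face H)"
    using notin interior_subset by blast
  ultimately show ?thesis by (simp add: frontier_def)
qed

text \<open>The perfect matchings of the graph minus the set \<open>Z\<close> of vertices.\<close>

definition perfect_matchings :: "matchgate \<Rightarrow> complex set \<Rightarrow> complex set set set" where
  "perfect_matchings H Z =
     {P. P \<subseteq> edges H \<and> (\<forall>e\<in>P. e \<subseteq> verts H - Z) \<and> (\<forall>v\<in>verts H - Z. \<exists>!e. e \<in> P \<and> v \<in> e)}"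

text \<open>The outputs are numbered from 1, hence the shift in the list index.\<close>

definition removed_outputs :: "matchgate \<Rightarrow> nat \<Rightarrow> complex set" where
  "removed_outputs H x =
     {outputs H ! (j - 1) | j. j \<in> {1..length (outputs H)} \<and>
        digit 2 (length (outputs H)) j x = 1}"

definition standard_signature :: "matchgate \<Rightarrow> complex Matrix.vec" where
  "standard_signature H = Matrix.vec (2 ^ length (outputs H))
     (\<lambda>x. \<Sum>P\<in>perfect_matchings H (removed_outputs H x). \<Prod>e\<in>P. weight H e)"

definition is_matchgate_signature :: "nat \<Rightarrow> complex Matrix.vec \<Rightarrow> bool" where
  "is_matchgate_signature m v \<longleftrightarrow>
     (\<exists>H. generator_matchgate H \<and> length (outputs H) = m \<and> v = standard_signature H)"

definition two_rows :: "complex Matrix.mat \<Rightarrow> nat \<Rightarrow> nat \<Rightarrow> complex Matrix.mat" where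
  "two_rows M \<sigma> \<tau> = mat_of_rows (dim_col M) [Matrix.row M \<sigma>, Matrix.row M \<tau>]"

end

theory Submission
  imports Defs
begin

text \<open>If two rows of \<open>M\<close> are as close as possible among the independent ones, then every row
  indexed by a word strictly between \<open>\<sigma>\<close> and \<open>\<tau>\<close> vanishes, since it is parallel to both. Suppose that \<open>\<sigma>\<close>
  and \<open>\<tau>\<close> differ in at least two bits. In the matchgate identities
  \<open>\<Sum>\<^sub>i \<plusminus> f(A \<oplus> i) f(B \<oplus> i) = 0\<close>, with \<open>A\<close> and \<open>B\<close> the positions of the ones in two words made of
  blocks \<open>\<sigma>\<close> and \<open>\<tau>\<close>, altered at one position of a block, almost all terms then vanish, and what is left says
  that this block can be exchanged between the two words without changing the product of their
  values. Hence the transformed tensor is of rank one, so \<open>G\<close> is degenerate. Therefore \<open>\<sigma>\<close> and \<open>\<tau>\<close>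
  differ in exactly one bit, and a matchgate for the transformed tensor arises by deleting the
  outputs at which both have a one, keeping one output per block, and, if at this output \<open>\<sigma>\<close> has the
  one, hanging a pendant edge on each kept output, which complements the signature.

  The matchgate identities come from a sign-reversing involution: superposing two matchings yields
  paths that join the outputs in pairs, and switching the path through \<open>i\<close> moves \<open>i\<close> to the other end of
  this path. Planarity enters only through the fact that these paths do not cross.\<close>

section \<open>Orbits of two involutions\<close>

text \<open>Why so few terms survive: the altered block lies strictly between \<sigma> and \<tau>
  until the summation index repairs it, either at the altered position itself or, if the pair
  differs in just two bits, at the other one, which completes the passage to the other word. With
  two differing bits the two surviving terms have consecutive ranks among the positions where the
  words differ, hence opposite signs, and equate the two products; with three or more only one term
  survives, and both products are zero. Independence is assumed for rows of a matrix form of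
  \<open>uG\<close>, while vanishing is needed for rows of \<open>M\<close>. Expanding every row of
  \<open>M\<close> in its rows \<sigma> and \<tau>, a basis of the plane, passes from one to the
  other. The same expansion gives the rank claim: a relation between the two rows of the new matrix
  form would extend by multilinearity to the rows \<sigma> and \<tau> of \<open>uG\<close>.
  Matchgates are drawings, so both the noncrossing of paths and the new pendant edges need actual
  curves. The arcs that fix the counterclockwise order supply them in both cases.\<close>

inductive_set orbit2 :: "('a \<Rightarrow> 'a) \<Rightarrow> ('a \<Rightarrow> 'a) \<Rightarrow> 'a \<Rightarrow> 'a set" for p q i where
  base: "i \<in> orbit2 p q i"
| left: "v \<in> orbit2 p q i \<Longrightarrow> p v \<in> orbit2 p q i"
| right: "v \<in> orbit2 p q i \<Longrightarrow> q v \<in> orbit2 p q i"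

lemma orbit2_trans: "j \<in> orbit2 p q i \<Longrightarrow> k \<in> orbit2 p q j \<Longrightarrow> k \<in> orbit2 p q i"
  by (rotate_tac, induction rule: orbit2.induct) (auto intro: orbit2.intros)

lemma orbit2_sym:
  assumes "\<And>v. p (p v) = v" "\<And>v. q (q v) = v" "j \<in> orbit2 p q i"
  shows "i \<in> orbit2 p q j"
  using assms(3)
proof induction
  case base show ?case by (rule orbit2.base)
next
  case (left v)
  have "v \<in> orbit2 p q (p v)"
    by (metis orbit2.left orbit2.base assms(1))
  then show ?case using left.IH orbit2_trans by metis
next
  case (right v)
  have "v \<in> orbit2 p q (q v)"
    by (metis orbit2.right orbit2.base assms(2))
  then show ?case using right.IH orbit2_trans by metis
qed

lemma orbit2_eq:
  assumes "\<And>v. p (p v) = v" "\<And>v. q (q v) = v" "j \<in> orbit2 p q i"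
  shows "orbit2 p q j = orbit2 p q i"
  using orbit2_sym[of p q, OF assms(1,2,3)] orbit2_trans assms(3) by (metis subsetI subset_antisym)

lemma orbit2_swap: "orbit2 p q i = orbit2 q p i"
proof -
  have "orbit2 p q i \<subseteq> orbit2 q p i" for p q :: "'a \<Rightarrow> 'a"
  proof
    fix x assume "x \<in> orbit2 p q i"
    then show "x \<in> orbit2 q p i" by induction (auto intro: orbit2.intros)
  qed
  then show ?thesis by blast
qed

lemma orbit2_subset:
  assumes "i \<in> V" "\<And>v. v \<in> V \<Longrightarrow> p v \<in> V" "\<And>v. v \<in> V \<Longrightarrow> q v \<in> V"
  shows "orbit2 p q i \<subseteq> V"
proof
  fix x assume "x \<in> orbit2 p q i"
  then show "x \<in> V" by induction (auto simp: assms)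
qed

text \<open>With \<open>p\<close> and \<open>q\<close> the partner maps of two matchings, which fix
  uncovered vertices, these are the ends of the path components of the superposition: exactly one of
  the two matchings covers them.\<close>

definition terminal :: "('a \<Rightarrow> 'a) \<Rightarrow> ('a \<Rightarrow> 'a) \<Rightarrow> 'a \<Rightarrow> bool" where
  "terminal p q v \<longleftrightarrow> (p v = v) \<noteq> (q v = v)"

lemma terminal_swap: "terminal p q v \<longleftrightarrow> terminal q p v"
  unfolding terminal_def by blast

text \<open>Walking from the end \<open>i\<close> by \<open>q\<close> after \<open>p\<close>
  enumerates the orbit as \<open>a 0\<close>, ..., \<open>a (N - 1)\<close>, on which the group acts
  like a dihedral group: \<open>q\<close> sends the index \<open>k\<close> to \<open>- k\<close> and
  \<open>p\<close> sends it to \<open>- 1 - k\<close>, modulo \<open>N\<close>. A fixed index other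
  than 0 satisfies \<open>2 * k = N\<close> for \<open>q\<close> and \<open>2 * k + 1 = N\<close>
  for \<open>p\<close>. According to the parity of \<open>N\<close> exactly one of these has a
  solution, namely \<open>N div 2\<close>.\<close>

lemma other_terminal_aux:
  assumes p: "\<And>v. p (p v) = v" and q: "\<And>v. q (q v) = v"
    and fin: "finite (orbit2 p q i)" and qi: "q i = i" and pi: "p i \<noteq> i"
  shows "\<exists>!j. j \<in> orbit2 p q i \<and> j \<noteq> i \<and> terminal p q j"
proof -
  define r where "r = (\<lambda>v. q (p v))"
  define a where "a k = (r ^^ k) i" for k
  have a0: "a 0 = i" and aS: "a (Suc k) = q (p (a k))" for k
    by (simp_all add: a_def r_def)
  have a_mem: "a k \<in> orbit2 p q i" for k
    by (induction k) (auto simp: a0 aS intro: orbit2.intros)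
  have r_inj: "a (Suc x) = a (Suc y) \<Longrightarrow> a x = a y" for x y
    unfolding aS using p q by metis
  have shift: "a (x + d) = a (y + d) \<Longrightarrow> a x = a y" for x y d
    by (induction d) (simp, metis add_Suc_right r_inj)
  \<comment> \<open>A sequence in a finite orbit repeats a value, and since its step is injective
    the repetition can be shifted back to the start \<open>i\<close>.\<close>
  have "\<not> inj a"
    using fin a_mem by (meson finite_subset image_subsetI infinite_UNIV_nat finite_imageD)
  then obtain x y where "x < y" "a x = a y"
    unfolding inj_def by (metis linorder_neqE_nat)
  then have ex: "0 < y - x \<and> a (y - x) = i"
    using shift[of 0 x "y - x"] a0 by auto
  define N where "N = (LEAST n. 0 < n \<and> a n = i)"
  have N: "0 < N" "a N = i" using LeastI[of "\<lambda>n. 0 < n \<and> a n = i", OF ex] by (auto simp: N_def)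
  have Nle: "0 < n \<Longrightarrow> a n = i \<Longrightarrow> N \<le> n" for n unfolding N_def by (rule Least_le) simp
  have inj: "x = y" if "x < N" "y < N" "a x = a y" for x y
  proof -
    have "y = x" if "x \<le> y" "y < N" "a x = a y" for x y
      using shift[of 0 x "y - x"] that Nle[of "y - x"] a0 by (cases "x = y") auto
    then show ?thesis using that by (metis nle_le)
  qed
  have qp: "k \<le> N \<Longrightarrow> q (a k) = a (N - k)" for k
  proof (induction k)
    case (Suc k)
    then have "a (N - k) = q (p (a (N - Suc k)))" using aS[of "N - Suc k"]
      by (metis Suc_diff_Suc Suc_le_lessD)
    then have "a k = p (a (N - Suc k))" using Suc q by (metis Suc_leD)
    then show ?case using aS[of k] p q by metis
  qed (use a0 qi N in auto)
  have pa: "p (a k) = a (N - 1 - k)" if "k < N" for k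
    using qp[of "Suc k"] that aS[of k] q by auto
  have orb: "orbit2 p q i = a ` {..<N}"
  proof
    show "orbit2 p q i \<subseteq> a ` {..<N}"
    proof (rule orbit2_subset)
      show "i \<in> a ` {..<N}" using a0 N by force
      fix v assume "v \<in> a ` {..<N}"
      then obtain k where k: "k < N" "v = a k" by auto
      show "p v \<in> a ` {..<N}" using pa k by auto
      show "q v \<in> a ` {..<N}" using qp[of k] k a0 N
        by (cases "k = 0") (auto intro!: image_eqI[of _ a 0])
    qed
  qed (use a_mem in auto)
  have pfix: "p (a k) = a k \<longleftrightarrow> Suc (2 * k) = N" if "k < N" for k
  proof -
    have "p (a k) = a k \<longleftrightarrow> N - 1 - k = k" using pa[OF that] inj[of "N - 1 - k" k] that by auto
    then show ?thesis using that by linarith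
  qed
  have qfix: "q (a k) = a k \<longleftrightarrow> k = 0 \<or> 2 * k = N" if "k < N" for k
  proof (cases "k = 0")
    case False
    then have "q (a k) = a k \<longleftrightarrow> N - k = k" using qp[of k] inj[of "N - k" k] that by auto
    then show ?thesis using that False by linarith
  qed (use a0 qi in auto)
  have "N \<noteq> 1" using pfix[of 0] pi a0 N by auto
  with N have "N > 1" by simp
  define m where "m = N div 2"
  have m: "m < N" "m \<noteq> 0" using \<open>N > 1\<close> by (auto simp: m_def)
  have term_iff: "terminal p q (a k) \<longleftrightarrow> k = 0 \<or> k = m" if "k < N" for k
    unfolding terminal_def pfix[OF that] qfix[OF that] m_def using \<open>N > 1\<close> by presburger
  show ?thesis
  proof (rule ex1I[of _ "a m"])
    show "a m \<in> orbit2 p q i \<and> a m \<noteq> i \<and> terminal p q (a m)"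
      using orb m term_iff[of m] inj[of m 0] a0 by auto
    fix j assume j: "j \<in> orbit2 p q i \<and> j \<noteq> i \<and> terminal p q j"
    then obtain k where "k < N" "j = a k" using orb by auto
    then show "j = a m" using j term_iff[of k] a0 by auto
  qed
qed

lemma other_terminal:
  assumes "\<And>v. p (p v) = v" "\<And>v. q (q v) = v"
    and "finite (orbit2 p q i)" and "terminal p q i"
  shows "\<exists>!j. j \<in> orbit2 p q i \<and> j \<noteq> i \<and> terminal p q j"
proof (cases "q i = i")
  case True
  then show ?thesis using assms other_terminal_aux[of p q i] unfolding terminal_def by blast
next
  case False
  then have "p i = i" using assms(4) unfolding terminal_def by blast
  then show ?thesis
    using False assms other_terminal_aux[of q p i]
    unfolding orbit2_swap[of q p] terminal_swap[of q p] by blast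
qed

section \<open>Crossing paths in a disc\<close>

text \<open>The Cayley map \<open>z \<mapsto> \<i> (w + z) / (w - z)\<close> with \<open>\<bar>w\<bar> = R\<close> sends the disc of radius \<open>R\<close> to the upper half
  plane and the circle without \<open>w\<close> increasingly to the real line, where \<open>fashoda_interlace\<close> applies.\<close>

lemma cayley_Im_nonneg:
  fixes w z :: complex
  assumes "norm z \<le> norm w"
  shows "0 \<le> Im (\<i> * (w + z) / (w - z))"
proof -
  have "Im (\<i> * (w + z) / (w - z)) = ((norm w)\<^sup>2 - (norm z)\<^sup>2) / (norm (w - z))\<^sup>2"
    unfolding cmod_power2 by (simp add: Im_divide) (simp add: power2_eq_square algebra_simps)
  moreover have "(norm z)\<^sup>2 \<le> (norm w)\<^sup>2" using assms by (simp add: power_mono)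
  ultimately show ?thesis by simp
qed

text \<open>In terms of the half angle \<open>(\<theta> - \<phi>) / 2\<close>, which lies between 0
  and pi, the value is minus its cotangent. It is written as a tangent on the interval from
  \<open>- pi / 2\<close> to \<open>pi / 2\<close>, so that monotonicity of \<open>tan\<close> turns
  the order of angles into the order of real numbers.\<close>

lemma cayley_cis:
  fixes R \<phi> \<theta> :: real
  assumes "0 < R" "\<phi> < \<theta>" "\<theta> < \<phi> + 2 * pi"
  shows "\<i> * (R * cis \<phi> + R * cis \<theta>) / (R * cis \<phi> - R * cis \<theta>)
    = of_real (tan ((\<theta> - \<phi>) / 2 - pi / 2))"
proof -
  define \<alpha> where "\<alpha> = (\<theta> - \<phi>) / 2"
  have s: "sin \<alpha> > 0" using assms by (intro sin_gt_zero) (auto simp: \<alpha>_def)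
  have t: "tan (\<alpha> - pi / 2) = - (cos \<alpha> / sin \<alpha>)"
    by (simp add: tan_def sin_diff cos_diff)
  have \<theta>: "cis \<theta> = cis \<phi> * (cis \<alpha> * cis \<alpha>)"
    by (simp add: cis_mult \<alpha>_def)
  have sq: "sin \<alpha> * sin \<alpha> = 1 - cos \<alpha> * cos \<alpha>"
    using sin_squared_eq[of \<alpha>] unfolding power2_eq_square .
  have plus: "1 + cis \<alpha> * cis \<alpha> = 2 * cos \<alpha> * cis \<alpha>"
    and minus: "1 - cis \<alpha> * cis \<alpha> = - 2 * \<i> * sin \<alpha> * cis \<alpha>"
    by (simp_all add: complex_eq_iff sq mult.assoc)
  have "R * cis \<phi> + R * cis \<theta> = (R * cis \<phi>) * (1 + cis \<alpha> * cis \<alpha>)"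
    "R * cis \<phi> - R * cis \<theta> = (R * cis \<phi>) * (1 - cis \<alpha> * cis \<alpha>)"
    by (simp_all add: \<theta> algebra_simps)
  then have "\<i> * (R * cis \<phi> + R * cis \<theta>) / (R * cis \<phi> - R * cis \<theta>)
      = \<i> * (1 + cis \<alpha> * cis \<alpha>) / (1 - cis \<alpha> * cis \<alpha>)"
    using assms(1) by simp
  also have "\<dots> = of_real (tan (\<alpha> - pi / 2))"
    unfolding plus minus t using s by (simp add: field_simps)
  finally show ?thesis by (simp add: \<alpha>_def)
qed

lemma paths_cross_in_disc:
  fixes R :: real and \<theta>1 \<theta>2 \<theta>3 \<theta>4 :: real and f g :: "real \<Rightarrow> complex"
  assumes \<theta>: "\<theta>1 < \<theta>2" "\<theta>2 < \<theta>3" "\<theta>3 < \<theta>4" "\<theta>4 < \<theta>1 + 2 * pi" and R: "0 < R"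
    and f: "path f" "pathstart f = R * cis \<theta>1" "pathfinish f = R * cis \<theta>3"
      "path_image f \<subseteq> ball 0 R \<union> {R * cis \<theta>1, R * cis \<theta>3}"
    and g: "path g" "pathstart g = R * cis \<theta>2" "pathfinish g = R * cis \<theta>4"
      "path_image g \<subseteq> ball 0 R \<union> {R * cis \<theta>2, R * cis \<theta>4}"
  shows "path_image f \<inter> path_image g \<noteq> {}"
proof
  assume disj: "path_image f \<inter> path_image g = {}"
  \<comment> \<open>The point \<open>w\<close> that goes to infinity is the midpoint of the boundary
    arc from \<theta>4 to \<open>\<theta>1 + 2 * pi\<close>. It avoids both paths, and cutting the
    circle there keeps the four ends in the order of their angles.\<close>
  define \<phi> where "\<phi> = (\<theta>1 + \<theta>4) / 2 - pi"
  have \<phi>: "\<phi> < \<theta>1" "\<theta>4 < \<phi> + 2 * pi" using \<theta> by (simp_all add: \<phi>_def field_simps)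
  define w where "w = R * cis \<phi>"
  define C where "C z = \<i> * (w + z) / (w - z)" for z
  define F :: "complex \<Rightarrow> real^2" where "F z = vector [Re (C z), Im (C z)]" for z
  have F1: "vec_nth (F z) 1 = Re (C z)" and F2: "vec_nth (F z) 2 = Im (C z)" for z
    by (simp_all add: F_def)
  have nw: "norm w = R" using R by (simp add: w_def norm_mult)
  have C_cis: "C (R * cis \<theta>) = of_real (tan ((\<theta> - \<phi>) / 2 - pi / 2))"
    if "\<phi> < \<theta>" "\<theta> < \<phi> + 2 * pi" for \<theta>
    using cayley_cis[OF R that] by (simp add: C_def w_def)
  have cis_ne: "R * cis \<theta> \<noteq> w" if "\<phi> < \<theta>" "\<theta> < \<phi> + 2 * pi" for \<theta>
  proof
    assume "R * cis \<theta> = w"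
    then have "cis (\<theta> - \<phi>) = 1" using R by (simp add: w_def cis_divide[symmetric])
    then have "cos (\<theta> - \<phi>) = 1" by (simp add: complex_eq_iff)
    then obtain n where n: "\<theta> - \<phi> = real_of_int n * 2 * pi"
      using cos_one_2pi_int by metis
    have "0 < real_of_int n * 2 * pi" "real_of_int n * 2 * pi < 1 * 2 * pi" using that n by linarith+
    then have "0 < real_of_int n" "real_of_int n < 1"
      using pi_gt_zero by (simp_all only: zero_less_mult_iff mult_less_cancel_right) auto
    then have "0 < n" "n < 1" by (simp_all only: of_int_0_less_iff of_int_less_1_iff)
    then show False by linarith
  qed
  define S where "S = cball 0 R - {w}"
  have w_ball: "w \<notin> ball 0 R" using nw by simp
  have fS: "path_image f \<subseteq> S"
    using f(4) cis_ne[of \<theta>1] cis_ne[of \<theta>3] \<phi> \<theta> w_ball R by (auto simp: S_def norm_mult)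
  have gS: "path_image g \<subseteq> S"
    using g(4) cis_ne[of \<theta>2] cis_ne[of \<theta>4] \<phi> \<theta> w_ball R by (auto simp: S_def norm_mult)
  have contC: "continuous_on S C" unfolding C_def S_def by (auto intro!: continuous_intros)
  have contF: "continuous_on S F"
    unfolding continuous_on_componentwise[of S F]
  proof
    have "continuous_on S (\<lambda>x. F x \<bullet> axis i 1)" for i :: 2
    proof -
      have "i = 1 \<or> i = 2" by (rule exhaust_2)
      then show ?thesis
      proof
        assume i: "i = 1"
        show ?thesis unfolding i inner_axis F1 by (intro continuous_intros contC)
      next
        assume i: "i = 2"
        show ?thesis unfolding i inner_axis F2 by (intro continuous_intros contC)
      qed
    qed
    then show "continuous_on S (\<lambda>x. F x \<bullet> b)" if "b \<in> Basis" for b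
      using that by (auto simp: Basis_vec_def)
  qed
  have injC: "z = z'" if "C z = C z'" "z \<in> S" "z' \<in> S" for z z'
  proof -
    have "w - z \<noteq> 0" "w - z' \<noteq> 0" using that by (auto simp: S_def)
    then have "\<i> * (w + z) * (w - z') = \<i> * (w + z') * (w - z)"
      using that(1) unfolding C_def by (simp add: frac_eq_eq)
    then have "2 * w * z = 2 * w * z'" by (simp add: algebra_simps)
    then show ?thesis using nw R by auto
  qed
  have injF: "z = z'" if "F z = F z'" "z \<in> S" "z' \<in> S" for z z'
    using injC[OF _ that(2,3)] that(1) F1 F2 by (metis complex_eq_iff)
  have pf: "path (F \<circ> f)" and pg: "path (F \<circ> g)"
    using f(1) g(1) contF fS gS by (auto intro!: path_continuous_image intro: continuous_on_subset)
  define K where "K = path_image (F \<circ> f) \<union> path_image (F \<circ> g)"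
  have "compact K"
    unfolding K_def using compact_path_image[OF pf] compact_path_image[OF pg] by (rule compact_Un)
  then obtain B where B: "\<And>x. x \<in> K \<Longrightarrow> norm x \<le> B"
    using compact_imp_bounded bounded_iff by metis
  have Im0: "0 \<le> Im (C z)" if "z \<in> S" for z
    unfolding C_def using that nw by (intro cayley_Im_nonneg) (simp add: S_def)
  \<comment> \<open>The lower side of the box lies on the real axis, where the images of the four
    ends stand in increasing order, alternating between the two paths, as
    \<open>fashoda_interlace\<close> requires.\<close>
  define a b :: "real^2" where "a = vector [- B, 0]" and "b = vector [B, B]"
  have KS: "K = F ` (path_image f \<union> path_image g)"
    by (simp add: K_def path_image_compose image_Un)
  have box: "K \<subseteq> cbox a b"
  proof
    fix x assume x: "x \<in> K"
    then have "0 \<le> vec_nth x 2" using KS fS gS Im0 F2 by auto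
    moreover have "\<bar>vec_nth x 1\<bar> \<le> B" "\<bar>vec_nth x 2\<bar> \<le> B"
      using B[OF x] component_le_norm_cart[of x] by (meson order_trans)+
    ultimately show "x \<in> cbox a b"
      by (auto simp: mem_box_cart forall_2 a_def b_def abs_le_iff)
  qed
  have tan_less: "tan ((x - \<phi>) / 2 - pi / 2) < tan ((y - \<phi>) / 2 - pi / 2)"
    if "\<phi> < x" "x < y" "y < \<phi> + 2 * pi" for x y
    using that by (intro tan_monotone) (auto simp: field_simps)
  have "\<exists>z. z \<in> path_image (F \<circ> f) \<and> z \<in> path_image (F \<circ> g)"
  proof (rule fashoda_interlace[of "F \<circ> f" "F \<circ> g" a b, OF pf pg])
    show "path_image (F \<circ> f) \<subseteq> cbox a b" "path_image (F \<circ> g) \<subseteq> cbox a b"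
      using box by (auto simp: K_def)
  qed (use \<theta> \<phi> in \<open>auto simp: pathstart_compose pathfinish_compose f g F1 F2 C_cis a_def
        intro!: tan_less\<close>)
  then obtain x y where "x \<in> path_image f" "y \<in> path_image g" "F x = F y"
    by (auto simp: path_image_compose)
  then show False using injF disj fS gS by blast
qed

section \<open>Superposed matchings\<close>

definition perfect_matching_on :: "'a set \<Rightarrow> 'a set set \<Rightarrow> bool" where
  "perfect_matching_on U P \<longleftrightarrow>
     (\<forall>e\<in>P. card e = 2 \<and> e \<subseteq> U) \<and> (\<forall>v\<in>U. \<exists>!e. e \<in> P \<and> v \<in> e)"

text \<open>Uncovered vertices are fixed, so that the map is a total involution and its fixed points
  are exactly the vertices that the matching leaves out.\<close>

definition mate :: "'a set set \<Rightarrow> 'a \<Rightarrow> 'a" where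
  "mate P v = (if \<exists>u. u \<noteq> v \<and> {v, u} \<in> P then THE u. u \<noteq> v \<and> {v, u} \<in> P else v)"

context
  fixes U :: "'a set" and P :: "'a set set"
  assumes pm: "perfect_matching_on U P"
begin

lemma mate_eqI:
  assumes "{v, u} \<in> P" "u \<noteq> v"
  shows "mate P v = u"
proof -
  have "v \<in> U" using pm assms(1) by (auto simp: perfect_matching_on_def)
  then have "\<exists>!e. e \<in> P \<and> v \<in> e" using pm by (auto simp: perfect_matching_on_def)
  then have "u' = u" if "u' \<noteq> v" "{v, u'} \<in> P" for u'
    using that assms by (metis doubleton_eq_iff insertI1)
  then have "(THE u. u \<noteq> v \<and> {v, u} \<in> P) = u" using assms by blast
  then show ?thesis using assms by (auto simp: mate_def)
qed

lemma mate_edge: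
  assumes "v \<in> U"
  shows "{v, mate P v} \<in> P" "mate P v \<noteq> v"
proof -
  obtain e where e: "e \<in> P" "v \<in> e" using pm assms by (auto simp: perfect_matching_on_def)
  then have "card e = 2" using pm by (auto simp: perfect_matching_on_def)
  then obtain u where "e = {v, u}" "u \<noteq> v" using e(2) by (auto simp: card_2_iff)
  then show "{v, mate P v} \<in> P" "mate P v \<noteq> v" using mate_eqI[of v u] e by auto
qed

lemma mate_outside: "v \<notin> U \<Longrightarrow> mate P v = v"
  using pm by (auto simp: mate_def perfect_matching_on_def)

lemma mate_fixed_iff: "mate P v = v \<longleftrightarrow> v \<notin> U"
  using mate_outside mate_edge(2) by blast

lemma mate_mate: "mate P (mate P v) = v"
proof (cases "v \<in> U")
  case True
  then show ?thesis using mate_edge mate_eqI[of "mate P v" v] by (metis insert_commute)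
qed (simp add: mate_outside)

lemma edge_eq_mate:
  assumes "e \<in> P" "v \<in> e"
  shows "e = {v, mate P v}"
proof -
  have "card e = 2" using pm assms by (auto simp: perfect_matching_on_def)
  then obtain u where "e = {v, u}" "u \<noteq> v" using assms(2) by (auto simp: card_2_iff)
  then show ?thesis using mate_eqI[of v u] assms by auto
qed

lemma mate_in: "v \<in> U \<Longrightarrow> mate P v \<in> U"
  using mate_edge[of v] pm unfolding perfect_matching_on_def by blast

lemma edge_inside_or_outside:
  assumes "\<And>v. v \<in> C \<Longrightarrow> mate P v \<in> C" "e \<in> P"
  shows "e \<subseteq> C \<or> e \<inter> C = {}"
  using assms edge_eq_mate by blast

lemma edge_nonempty: "e \<in> P \<Longrightarrow> e \<noteq> {}"
  using pm by (auto simp: perfect_matching_on_def)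

end

text \<open>Meant for sets \<open>C\<close> closed under both partner maps, such as a component of
  the superposition. Every edge then lies in \<open>C\<close> or misses it, so that
  \<open>switch C P Q\<close> and \<open>switch C Q P\<close> together use the same edges, with
  multiplicity, as \<open>P\<close> and \<open>Q\<close>.\<close>

definition switch :: "'a set \<Rightarrow> 'a set set \<Rightarrow> 'a set set \<Rightarrow> 'a set set" where
  "switch C P Q = {e \<in> P. e \<inter> C = {}} \<union> {e \<in> Q. e \<subseteq> C}"

context
  fixes U W C :: "'a set" and P Q :: "'a set set"
  assumes P: "perfect_matching_on U P" and Q: "perfect_matching_on W Q"
    and CP: "\<And>v. v \<in> C \<Longrightarrow> mate P v \<in> C" and CQ: "\<And>v. v \<in> C \<Longrightarrow> mate Q v \<in> C"
begin

lemma perfect_matching_switch: "perfect_matching_on ((U - C) \<union> (W \<inter> C)) (switch C P Q)"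
  unfolding perfect_matching_on_def
proof (intro conjI ballI)
  fix e assume e: "e \<in> switch C P Q"
  show "card e = 2" using e P Q by (auto simp: switch_def perfect_matching_on_def)
  show "e \<subseteq> (U - C) \<union> (W \<inter> C)" using e P Q by (auto simp: switch_def perfect_matching_on_def)
next
  fix v assume v: "v \<in> (U - C) \<union> (W \<inter> C)"
  show "\<exists>!e. e \<in> switch C P Q \<and> v \<in> e"
  proof (cases "v \<in> C")
    case True
    then have "v \<in> W" using v by blast
    then have "{v, mate Q v} \<in> switch C P Q"
      using mate_edge[OF Q] CQ True by (auto simp: switch_def)
    moreover have "e = {v, mate Q v}" if "e \<in> switch C P Q" "v \<in> e" for e
      using that True edge_eq_mate[OF Q] by (auto simp: switch_def)
    ultimately show ?thesis by blast
  next
    case False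
    then have "v \<in> U" using v by blast
    then have "{v, mate P v} \<in> P" using mate_edge[OF P] by blast
    then have "{v, mate P v} \<in> switch C P Q"
      using edge_inside_or_outside[OF P CP] False by (auto simp: switch_def)
    moreover have "e = {v, mate P v}" if "e \<in> switch C P Q" "v \<in> e" for e
      using that False edge_eq_mate[OF P] by (auto simp: switch_def)
    ultimately show ?thesis by blast
  qed
qed

lemma mate_switch: "mate (switch C P Q) v = (if v \<in> C then mate Q v else mate P v)"
proof -
  note S = perfect_matching_switch
  consider "v \<in> C" "v \<in> W" | "v \<in> C" "v \<notin> W" | "v \<notin> C" "v \<in> U" | "v \<notin> C" "v \<notin> U" by blast
  then show ?thesis
  proof cases
    case 1
    then have "{v, mate Q v} \<in> switch C P Q"
      using mate_edge[OF Q] CQ by (auto simp: switch_def)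
    then show ?thesis using mate_eqI[OF S] mate_edge[OF Q] 1 by auto
  next
    case 2
    then show ?thesis using mate_outside[OF S, of v] mate_outside[OF Q] by auto
  next
    case 3
    then have "{v, mate P v} \<in> P" using mate_edge[OF P] by blast
    then have "{v, mate P v} \<in> switch C P Q"
      using edge_inside_or_outside[OF P CP] 3 by (auto simp: switch_def)
    then show ?thesis using mate_eqI[OF S] mate_edge[OF P] 3 by auto
  next
    case 4
    then show ?thesis using mate_outside[OF S, of v] mate_outside[OF P] by auto
  qed
qed

lemma switch_switch: "switch C (switch C P Q) (switch C Q P) = P"
proof
  show "switch C (switch C P Q) (switch C Q P) \<subseteq> P"
    using edge_nonempty[OF P] edge_nonempty[OF Q] by (auto simp: switch_def)
  show "P \<subseteq> switch C (switch C P Q) (switch C Q P)"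
    using edge_inside_or_outside[OF P CP] by (auto simp: switch_def)
qed

lemma prod_switch:
  fixes w :: "'a set \<Rightarrow> 'b::comm_monoid_mult"
  assumes fin: "finite P" "finite Q"
  shows "prod w (switch C P Q) * prod w (switch C Q P) = prod w P * prod w Q"
proof -
  define Po Pi Qo Qi where "Po = {e \<in> P. e \<inter> C = {}}" "Pi = {e \<in> P. e \<subseteq> C}"
    "Qo = {e \<in> Q. e \<inter> C = {}}" "Qi = {e \<in> Q. e \<subseteq> C}"
  note defs = this
  have disj: "Po \<inter> Pi = {}" "Qo \<inter> Qi = {}" "Po \<inter> Qi = {}" "Qo \<inter> Pi = {}"
    using edge_nonempty[OF P] edge_nonempty[OF Q] by (auto simp: defs)
  have "P = Po \<union> Pi" "Q = Qo \<union> Qi"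
    using edge_inside_or_outside[OF P CP] edge_inside_or_outside[OF Q CQ] by (auto simp: defs)
  moreover have "switch C P Q = Po \<union> Qi" "switch C Q P = Qo \<union> Pi" by (auto simp: switch_def defs)
  moreover have "finite Po" "finite Pi" "finite Qo" "finite Qi" using fin by (auto simp: defs)
  ultimately show ?thesis using disj by (simp add: prod.union_disjoint ac_simps)
qed

end

text \<open>On the component the switched matchings have the same two partner maps in exchanged
  roles, and an orbit does not depend on the order of the maps. So the component survives the
  switch, and switching a second time undoes the first.\<close>

lemma orbit2_switch:
  fixes i :: 'a
  assumes P: "perfect_matching_on U P" and Q: "perfect_matching_on W Q"
  defines "C \<equiv> orbit2 (mate P) (mate Q) i"
  shows "orbit2 (mate (switch C P Q)) (mate (switch C Q P)) i = C"
proof -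
  have CP: "v \<in> C \<Longrightarrow> mate P v \<in> C" and CQ: "v \<in> C \<Longrightarrow> mate Q v \<in> C" for v
    by (auto simp: C_def intro: orbit2.intros)
  note m = mate_switch[OF P Q CP CQ] mate_switch[OF Q P CQ CP]
  let ?D = "orbit2 (mate (switch C P Q)) (mate (switch C Q P)) i"
  have i: "i \<in> C" by (simp add: C_def orbit2.base)
  have 1: "?D \<subseteq> C" by (rule orbit2_subset) (auto simp: i m CP CQ)
  have "v \<in> orbit2 (mate P) (mate Q) i \<Longrightarrow> v \<in> ?D" for v
  proof (induction rule: orbit2.induct)
    case (left v)
    then have "v \<in> C" by (simp add: C_def)
    then show ?case using orbit2.right[OF left.IH] m by simp
  next
    case (right v)
    then have "v \<in> C" by (simp add: C_def)
    then show ?case using orbit2.left[OF right.IH] m by simp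
  qed (rule orbit2.base)
  then have "C \<subseteq> ?D" by (auto simp: C_def)
  with 1 show ?thesis by blast
qed

section \<open>Components of the superposition as subsets of the plane\<close>

definition strand :: "matchgate \<Rightarrow> complex set set \<Rightarrow> complex set \<Rightarrow> complex set" where
  "strand H E C = C \<union> (\<Union>e\<in>{e \<in> E. e \<subseteq> C}. path_image (curve H e))"

lemma path_component_curve:
  assumes "plane_graph H" "{u, v} \<in> edges H" "path_image (curve H {u, v}) \<subseteq> S"
  shows "path_component S u v"
proof -
  have "arc (curve H {u, v})"
    and ends: "{pathstart (curve H {u, v}), pathfinish (curve H {u, v})} = {u, v}"
    using assms(1,2) by (auto simp: plane_graph_def)
  then have "path_component S (pathstart (curve H {u, v})) (pathfinish (curve H {u, v}))"
    using assms(3) arc_imp_path unfolding path_component_def by blast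
  then show ?thesis using ends path_component_sym by (metis doubleton_eq_iff)
qed

text \<open>Path connectedness is all that the crossing argument needs, so the vertices of a
  component need not be listed in the order of a path: induction over the orbit suffices, each step
  following the curve of one matching edge or standing still at an uncovered vertex.\<close>

lemma strand_path_component:
  assumes H: "plane_graph H" and P: "perfect_matching_on U P" "P \<subseteq> edges H"
    and Q: "perfect_matching_on W Q" "Q \<subseteq> edges H"
    and j: "j \<in> orbit2 (mate P) (mate Q) i"
  shows "path_component (strand H (P \<union> Q) (orbit2 (mate P) (mate Q) i)) i j"
  using j
proof induction
  let ?C = "orbit2 (mate P) (mate Q) i" and ?S = "strand H (P \<union> Q) (orbit2 (mate P) (mate Q) i)"
  case base
  show ?case by (rule path_component_refl) (simp add: strand_def orbit2.base)
next
  let ?C = "orbit2 (mate P) (mate Q) i" and ?S = "strand H (P \<union> Q) (orbit2 (mate P) (mate Q) i)"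
  have step: "path_component ?S v (mate R v)"
    if "v \<in> ?C" "mate R v \<in> ?C" "perfect_matching_on X R" "R \<subseteq> edges H" "R \<subseteq> P \<union> Q" for v R X
  proof (cases "v \<in> X")
    case True
    then have e: "{v, mate R v} \<in> R" using mate_edge that(3) by metis
    have "path_image (curve H {v, mate R v}) \<subseteq> ?S"
      unfolding strand_def using e that by auto
    then show ?thesis using path_component_curve[OF H] e that(4) by blast
  next
    case False
    then have "mate R v = v" using mate_outside that(3) by metis
    then show ?thesis using that(1) by (auto simp: strand_def intro: path_component_refl)
  qed
  {
    case (left v)
    then show ?case using step[OF left.hyps orbit2.left[OF left.hyps] P] path_component_trans
      by blast
  next
    case (right v)
    then show ?case using step[OF right.hyps orbit2.right[OF right.hyps] Q] path_component_trans
      by blast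
  }
qed

text \<open>A curve of a plane drawing meets vertices only at its ends, and another curve only at
  common ends. A common point of the strands would therefore be a common vertex of \<open>C\<close>
  and \<open>D\<close>.\<close>

lemma strand_disjoint:
  assumes H: "plane_graph H" "E \<subseteq> edges H"
    and C: "C \<subseteq> verts H" "D \<subseteq> verts H" "C \<inter> D = {}" and ne: "{} \<notin> E"
  shows "strand H E C \<inter> strand H E D = {}"
proof -
  have vert: "x \<in> e" if "x \<in> verts H" "x \<in> path_image (curve H e)" "e \<in> E" for x e
    using H that unfolding plane_graph_def by blast
  have edge: "x \<in> e \<inter> f"
    if "x \<in> path_image (curve H e)" "x \<in> path_image (curve H f)" "e \<in> E" "f \<in> E" "e \<noteq> f" for x e f
    using H that unfolding plane_graph_def by blast
  have "False" if x: "x \<in> strand H E C" "x \<in> strand H E D" for x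
  proof -
    consider "x \<in> C" "x \<in> D"
      | e where "x \<in> C" "x \<in> path_image (curve H e)" "e \<in> E" "e \<subseteq> D"
      | e where "x \<in> D" "x \<in> path_image (curve H e)" "e \<in> E" "e \<subseteq> C"
      | e f where "x \<in> path_image (curve H e)" "e \<in> E" "e \<subseteq> C"
          "x \<in> path_image (curve H f)" "f \<in> E" "f \<subseteq> D"
      using x unfolding strand_def by blast
    then show False
    proof cases
      case (4 e f)
      then have "e \<noteq> f" using C(3) ne by (metis le_inf_iff subset_empty)
      then show False using edge[of x e f] 4 C(3) by blast
    qed (use vert C in blast)+
  qed
  then show ?thesis by blast
qed

lemma strand_drawing:
  assumes "C \<subseteq> verts H" "E \<subseteq> edges H"
  shows "strand H E C \<subseteq> drawing H"
  using assms by (fastforce simp: strand_def drawing_def)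

lemma strand_verts:
  assumes "plane_graph H" "E \<subseteq> edges H"
  shows "strand H E C \<inter> verts H \<subseteq> C"
proof -
  have "path_image (curve H e) \<inter> verts H = e" if "e \<in> E" for e
    using assms that by (meson plane_graph_def subsetD)
  then have "x \<in> C" if "x \<in> path_image (curve H e)" "x \<in> verts H" "e \<in> E" "e \<subseteq> C" for x e
    using that by (metis IntI subsetD)
  then show ?thesis by (auto simp: strand_def)
qed

text \<open>Prolonged by the arcs through the outer face, two crossing pairs of outputs would give
  two disjoint paths in a disc whose ends interlace on the circle.\<close>

lemma strands_do_not_cross:
  assumes H: "plane_graph H" and ccw: "ccw_on_outer_face H ps" and ps: "set ps \<subseteq> verts H"
    and abcd: "a < b" "b < c" "c < d" "d < length ps"
    and E: "E \<subseteq> edges H" "{} \<notin> E" and CD: "C \<subseteq> verts H" "D \<subseteq> verts H" "C \<inter> D = {}"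
    and C: "path_component (strand H E C) (ps ! a) (ps ! c)" "ps ! a \<in> C" "ps ! c \<in> C"
    and D: "path_component (strand H E D) (ps ! b) (ps ! d)" "ps ! b \<in> D" "ps ! d \<in> D"
  shows False
proof -
  obtain R \<theta> h where dr: "drawing H \<subseteq> ball 0 R"
    and \<theta>: "\<And>i j. i < j \<Longrightarrow> j < length ps \<Longrightarrow> \<theta> i < \<theta> j \<and> \<theta> j < \<theta> i + 2 * pi"
    and h: "\<And>j. j < length ps \<Longrightarrow> arc (h j) \<and> pathstart (h j) = ps ! j \<and>
           pathfinish (h j) = of_real R * cis (\<theta> j) \<and>
           path_image (h j) - {ps ! j} \<subseteq> outer_face H \<and>
           path_image (h j) - {pathfinish (h j)} \<subseteq> ball 0 R"
    and hd: "\<And>i j. i < length ps \<Longrightarrow> j < length ps \<Longrightarrow> i \<noteq> j \<Longrightarrow>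
           path_image (h i) \<inter> path_image (h j) = {}"
    using ccw unfolding ccw_on_outer_face_def by metis
  have len: "a < length ps" "b < length ps" "c < length ps" "d < length ps" using abcd by auto
  define X Y where "X = strand H E C" and "Y = strand H E D"
  have XY: "X \<inter> Y = {}" "X \<subseteq> drawing H" "Y \<subseteq> drawing H"
    using strand_disjoint[OF H E(1) CD E(2)] strand_drawing[OF CD(1) E(1)]
      strand_drawing[OF CD(2) E(1)] by (auto simp: X_def Y_def)
  have long: "path_component (path_image (h i) \<union> Z \<union> path_image (h j))
      (R * cis (\<theta> i)) (R * cis (\<theta> j))"
    if "i < length ps" "j < length ps" "path_component Z (ps ! i) (ps ! j)" for i j Z
  proof -
    have "path_component (path_image (h i)) (ps ! i) (R * cis (\<theta> i))"
      "path_component (path_image (h j)) (ps ! j) (R * cis (\<theta> j))"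
      using h[OF that(1)] h[OF that(2)] arc_imp_path unfolding path_component_def by blast+
    then have "path_component (path_image (h i) \<union> Z \<union> path_image (h j)) (ps ! i) (R * cis (\<theta> i))"
      "path_component (path_image (h i) \<union> Z \<union> path_image (h j)) (ps ! j) (R * cis (\<theta> j))"
      "path_component (path_image (h i) \<union> Z \<union> path_image (h j)) (ps ! i) (ps ! j)"
      using that(3) by (auto elim: path_component_of_subset[rotated])
    then show ?thesis by (blast intro: path_component_sym path_component_trans)
  qed
  let ?X = "path_image (h a) \<union> X \<union> path_image (h c)"
  let ?Y = "path_image (h b) \<union> Y \<union> path_image (h d)"
  obtain f where f: "path f" "path_image f \<subseteq> ?X"
      "pathstart f = R * cis (\<theta> a)" "pathfinish f = R * cis (\<theta> c)"
    using long[OF len(1) len(3) C(1)] unfolding path_component_def X_def by blast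
  obtain g where g: "path g" "path_image g \<subseteq> ?Y"
      "pathstart g = R * cis (\<theta> b)" "pathfinish g = R * cis (\<theta> d)"
    using long[OF len(2) len(4) D(1)] unfolding path_component_def Y_def by blast
  have inball: "path_image (h i) \<subseteq> ball 0 R \<union> {R * cis (\<theta> i)}" if "i < length ps" for i
    using h[OF that] by auto
  have out: "outer_face H \<inter> drawing H = {}" by (auto simp: outside_def)
  \<comment> \<open>The arc \<open>h i\<close> meets the drawing only at its own output, and this
    output belongs to the vertex set of the opposite strand.\<close>
  have hX: "path_image (h i) \<inter> X = {}" if "i < length ps" "ps ! i \<in> D" for i
  proof -
    have "ps ! i \<notin> X"
      using strand_verts[OF H E(1), of C] that CD unfolding X_def by blast
    then show ?thesis using h[OF that(1)] out XY(2) by blast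
  qed
  have hY: "path_image (h i) \<inter> Y = {}" if "i < length ps" "ps ! i \<in> C" for i
  proof -
    have "ps ! i \<notin> Y"
      using strand_verts[OF H E(1), of D] that CD unfolding Y_def by blast
    then show ?thesis using h[OF that(1)] out XY(3) by blast
  qed
  have "ps ! a \<in> ball 0 R" using dr ps len(1) nth_mem unfolding drawing_def by blast
  then have R: "0 < R" by (metis ball_eq_empty empty_iff not_less)
  have "path_image f \<inter> path_image g \<noteq> {}"
  proof (rule paths_cross_in_disc[of "\<theta> a" "\<theta> b" "\<theta> c" "\<theta> d" R f g])
    show "path_image f \<subseteq> ball 0 R \<union> {R * cis (\<theta> a), R * cis (\<theta> c)}"
      using f(2) inball[OF len(1)] inball[OF len(3)] subset_trans[OF XY(2) dr] by auto
    show "path_image g \<subseteq> ball 0 R \<union> {R * cis (\<theta> b), R * cis (\<theta> d)}"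
      using g(2) inball[OF len(2)] inball[OF len(4)] subset_trans[OF XY(3) dr] by auto
    have "\<theta> a < \<theta> b" "\<theta> b < \<theta> c" "\<theta> c < \<theta> d" "\<theta> d < \<theta> a + 2 * pi"
      using \<theta>[of a b] \<theta>[of b c] \<theta>[of c d] \<theta>[of a d] abcd len by linarith+
    then show "\<theta> a < \<theta> b" "\<theta> b < \<theta> c" "\<theta> c < \<theta> d" "\<theta> d < \<theta> a + 2 * pi" .
  qed (fact R f g)+
  moreover have "?X \<inter> ?Y = {}"
    using XY(1) hX[OF len(2) D(2)] hX[OF len(4) D(3)] hY[OF len(1) C(2)] hY[OF len(3) C(3)]
      hd[of a b] hd[of a d] hd[of c b] hd[of c d] len abcd by (auto simp: Int_Un_distrib Int_Un_distrib2 Int_commute)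
  ultimately show False using f(2) g(2) by blast
qed

section \<open>The matchgate identities\<close>

lemma even_card_fixpoint_free_involution:
  assumes "finite S" "\<And>x. x \<in> S \<Longrightarrow> f x \<in> S" "\<And>x. x \<in> S \<Longrightarrow> f (f x) = x"
    "\<And>x. x \<in> S \<Longrightarrow> f x \<noteq> x"
  shows "even (card S)"
  using assms
proof (induction S rule: finite_psubset_induct)
  case (psubset S)
  show ?case
  proof (cases "S = {}")
    case False
    then obtain x where x: "x \<in> S" by blast
    let ?S = "S - {x, f x}"
    have "even (card ?S)"
    proof (rule psubset.IH)
      show "?S \<subset> S" using x by blast
      show "f y \<in> ?S" if "y \<in> ?S" for y
        using that psubset.prems x by (metis Diff_iff insertCI insertE singletonD)
    qed (use psubset.prems in auto)
    moreover have "card S = card ?S + 2"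
    proof -
      have c: "card {x, f x} = 2" using psubset.prems(3)[OF x] by auto
      have sub: "{x, f x} \<subseteq> S" using x psubset.prems(1) by blast
      have "card ?S = card S - card {x, f x}" by (rule card_Diff_subset[OF _ sub]) simp
      then show ?thesis using c card_mono[OF psubset.hyps sub] by simp
    qed
    ultimately show ?thesis by simp
  qed simp
qed

definition toggle :: "'a \<Rightarrow> 'a set \<Rightarrow> 'a set" where
  "toggle i A = (if i \<in> A then A - {i} else insert i A)"

lemma in_toggle_iff: "k \<in> toggle i A \<longleftrightarrow> (k \<in> A) \<noteq> (k = i)"
  by (auto simp: toggle_def)

lemma perfect_matchings_iff:
  assumes "plane_graph H"
  shows "P \<in> perfect_matchings H Z \<longleftrightarrow> P \<subseteq> edges H \<and> perfect_matching_on (verts H - Z) P"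
proof -
  have "card e = 2" if "e \<in> edges H" for e
    using assms that by (simp add: plane_graph_def)
  then show ?thesis
    by (simp add: perfect_matchings_def perfect_matching_on_def subset_iff conj_assoc) blast
qed

lemma finite_edges:
  assumes "plane_graph H"
  shows "finite (edges H)"
proof (rule finite_subset)
  show "edges H \<subseteq> Pow (verts H)" using assms by (auto simp: plane_graph_def)
  show "finite (Pow (verts H))" using assms by (simp add: plane_graph_def)
qed

lemma finite_perfect_matchings:
  assumes "plane_graph H"
  shows "finite (perfect_matchings H Z)"
proof (rule finite_subset)
  show "perfect_matchings H Z \<subseteq> Pow (edges H)" by (auto simp: perfect_matchings_def)
  show "finite (Pow (edges H))" using finite_edges[OF assms] by simp
qed

abbreviation output_set :: "matchgate \<Rightarrow> nat set \<Rightarrow> complex set" where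
  "output_set H A \<equiv> (\<lambda>k. outputs H ! k) ` A"

text \<open>The signature entry at the word whose ones stand at the 0-based positions in
  \<open>A\<close>. Sets replace words because the identities toggle single positions.\<close>

definition matching_sum :: "matchgate \<Rightarrow> nat set \<Rightarrow> complex" where
  "matching_sum H A = (\<Sum>P\<in>perfect_matchings H (output_set H A). \<Prod>e\<in>P. weight H e)"

text \<open>\<open>T\<close> consists of the outputs removed for exactly one of the two matchings,
  hence of the path ends. It is a parameter because switching changes \<open>A\<close> and
  \<open>B\<close> but not \<open>T\<close>, so that the switched pair is an instance with the same
  \<open>T\<close>.\<close>

locale superposition =
  fixes H :: matchgate and A B T :: "nat set" and P Q :: "complex set set"
  assumes gen: "generator_matchgate H"
    and A: "A \<subseteq> {..<length (outputs H)}" and B: "B \<subseteq> {..<length (outputs H)}"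
    and T: "T = {k. (k \<in> A) \<noteq> (k \<in> B)}"
    and P: "P \<in> perfect_matchings H (output_set H A)"
    and Q: "Q \<in> perfect_matchings H (output_set H B)"
begin

abbreviation component :: "nat \<Rightarrow> complex set" where
  "component i \<equiv> orbit2 (mate P) (mate Q) (outputs H ! i)"

lemma plane: "plane_graph H" using gen by (simp add: generator_matchgate_def)

lemma edgesP: "P \<subseteq> edges H" and edgesQ: "Q \<subseteq> edges H"
  and pmP: "perfect_matching_on (verts H - output_set H A) P"
  and pmQ: "perfect_matching_on (verts H - output_set H B) Q"
  using P Q perfect_matchings_iff[OF plane] by auto

lemma T_less: "k \<in> T \<Longrightarrow> k < length (outputs H)"
  using T A B by auto

lemma finite_T: "finite T"
  using T_less by (meson finite_nat_set_iff_bounded)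

lemma output_inj:
  "\<lbrakk>k < length (outputs H); k' < length (outputs H)\<rbrakk> \<Longrightarrow> outputs H ! k = outputs H ! k' \<longleftrightarrow> k = k'"
  using gen nth_eq_iff_index_eq by (auto simp: generator_matchgate_def)

lemma output_in_verts: "k < length (outputs H) \<Longrightarrow> outputs H ! k \<in> verts H"
  using gen nth_mem by (auto simp: generator_matchgate_def)

lemma output_set_iff:
  "\<lbrakk>k < length (outputs H); S \<subseteq> {..<length (outputs H)}\<rbrakk> \<Longrightarrow> outputs H ! k \<in> output_set H S \<longleftrightarrow> k \<in> S"
  using output_inj by (auto simp: subset_iff)

lemma comp_subset: "k < length (outputs H) \<Longrightarrow> component k \<subseteq> verts H"
proof (rule orbit2_subset)
  fix v assume v: "v \<in> verts H"
  show "mate P v \<in> verts H"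
    using v mate_in[OF pmP, of v] mate_outside[OF pmP, of v]
    by (cases "v \<in> output_set H A") auto
  show "mate Q v \<in> verts H"
    using v mate_in[OF pmQ, of v] mate_outside[OF pmQ, of v]
    by (cases "v \<in> output_set H B") auto
qed (rule output_in_verts)

lemma terminal_iff: "terminal (mate P) (mate Q) v \<longleftrightarrow> v \<in> output_set H T"
proof -
  have "terminal (mate P) (mate Q) v \<longleftrightarrow>
      (v \<notin> verts H - output_set H A) \<noteq> (v \<notin> verts H - output_set H B)"
    unfolding terminal_def mate_fixed_iff[OF pmP] mate_fixed_iff[OF pmQ] by blast
  also have "\<dots> \<longleftrightarrow> (v \<in> output_set H A) \<noteq> (v \<in> output_set H B)"
    using output_in_verts A B by auto
  also have "\<dots> \<longleftrightarrow> v \<in> output_set H T"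
  proof (cases "v \<in> set (outputs H)")
    case True
    then obtain k where k: "k < length (outputs H)" "v = outputs H ! k" by (metis in_set_conv_nth)
    have "T \<subseteq> {..<length (outputs H)}" using T_less by auto
    then show ?thesis
      unfolding k(2) output_set_iff[OF k(1) A] output_set_iff[OF k(1) B]
      using output_set_iff[OF k(1), of T] by (simp add: T)
  next
    case False
    then have "v \<notin> output_set H S" if "S \<subseteq> {..<length (outputs H)}" for S
      using that by auto
    then show ?thesis using A B T_less by blast
  qed
  finally show ?thesis .
qed

lemma partner_ex1:
  assumes "i \<in> T"
  shows "\<exists>!j. j \<in> T \<and> j \<noteq> i \<and> outputs H ! j \<in> component i"
proof -
  have i: "i < length (outputs H)" using T_less assms .
  have "finite (component i)"
    using comp_subset[OF i] plane finite_subset by (auto simp: plane_graph_def)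
  then have "\<exists>!v. v \<in> component i \<and> v \<noteq> outputs H ! i \<and> terminal (mate P) (mate Q) v"
    using other_terminal[of "mate P" "mate Q"] mate_mate[OF pmP] mate_mate[OF pmQ]
      terminal_iff assms by blast
  then have ex: "\<exists>!v. v \<in> component i \<and> v \<noteq> outputs H ! i \<and> v \<in> output_set H T"
    by (simp only: terminal_iff)
  then obtain j where j: "outputs H ! j \<in> component i" "outputs H ! j \<noteq> outputs H ! i" "j \<in> T"
    by blast
  show ?thesis
  proof (rule ex1I[of _ j])
    fix k assume k: "k \<in> T \<and> k \<noteq> i \<and> outputs H ! k \<in> component i"
    then have "outputs H ! k = outputs H ! j"
      using ex j output_inj[OF T_less[of k] i] by blast
    then show "k = j" using output_inj T_less j k by blast
  qed (use j in auto)
qed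

definition partner :: "nat \<Rightarrow> nat" where
  "partner i = (THE j. j \<in> T \<and> j \<noteq> i \<and> outputs H ! j \<in> component i)"

lemma partner:
  assumes "i \<in> T"
  shows "partner i \<in> T" "partner i \<noteq> i" "outputs H ! partner i \<in> component i"
  using theI'[OF partner_ex1[OF assms]] by (simp_all add: partner_def)

lemma partner_eqI:
  assumes "i \<in> T" "j \<in> T" "j \<noteq> i" "outputs H ! j \<in> component i"
  shows "partner i = j"
  using partner_ex1[OF assms(1)] partner[OF assms(1)] assms by blast

lemma comp_partner: "i \<in> T \<Longrightarrow> component (partner i) = component i"
  using orbit2_eq mate_mate[OF pmP] mate_mate[OF pmQ] partner(3) by metis

lemma partner_partner:
  assumes "i \<in> T"
  shows "partner (partner i) = i"
proof (rule partner_eqI)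
  show "outputs H ! i \<in> component (partner i)"
    unfolding comp_partner[OF assms] by (rule orbit2.base)
  show "i \<noteq> partner i" using partner(2)[OF assms] by simp
qed (use assms partner(1) in auto)

lemma comp_disjoint:
  assumes "i \<in> T" "k \<in> T" "k \<noteq> i" "k \<noteq> partner i"
  shows "component i \<inter> component k = {}"
proof (rule ccontr)
  assume "component i \<inter> component k \<noteq> {}"
  then obtain v where "v \<in> component i" "v \<in> component k" by blast
  then have "component k = component i" using orbit2_eq mate_mate[OF pmP] mate_mate[OF pmQ] by metis
  then show False using partner_eqI[OF assms(1,2,3)] assms(4) orbit2.base by metis
qed

lemma no_crossing:
  assumes "a \<in> T" "b \<in> T" "a < b" "b < partner a" "partner a < partner b"
  shows False
proof -
  have E: "P \<union> Q \<subseteq> edges H" "{} \<notin> P \<union> Q"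
    using edgesP edgesQ edge_nonempty[OF pmP] edge_nonempty[OF pmQ] by auto
  have len: "partner b < length (outputs H)" "a < length (outputs H)" "b < length (outputs H)"
    using T_less partner assms by auto
  have path: "path_component (strand H (P \<union> Q) (component i)) (outputs H ! i) (outputs H ! partner i)"
    if "i \<in> T" for i
    using strand_path_component[OF plane pmP edgesP pmQ edgesQ partner(3)[OF that]] .
  show False
    by (rule strands_do_not_cross[OF plane _ _ assms(3,4,5) len(1) E
          comp_subset[OF len(2)] comp_subset[OF len(3)] comp_disjoint path[OF assms(1)] _ _ path[OF assms(2)]])
      (use gen assms partner in \<open>auto simp: generator_matchgate_def orbit2.base\<close>)
qed

text \<open>Paths do not cross, so the members of \<open>T\<close> strictly between \<open>i\<close>
  and \<open>partner i\<close> are paired among themselves and their number is even. The ranks of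
  the two ends in \<open>T\<close> differ by this number plus one, the one coming from
  \<open>i\<close> itself.\<close>

lemma partner_parity_aux:
  assumes "i \<in> T" "i < partner i"
  shows "odd (card {k \<in> T. k < i} + card {k \<in> T. k < partner i})"
proof -
  define S where "S = {k \<in> T. i < k \<and> k < partner i}"
  have "even (card S)"
  proof (rule even_card_fixpoint_free_involution[of S partner])
    fix k assume k: "k \<in> S"
    then have kT: "k \<in> T" and k': "i < k" "k < partner i" by (auto simp: S_def)
    have "partner k \<noteq> i" "partner k \<noteq> partner i"
      using k' partner_partner assms(1) kT by (metis less_irrefl)+
    moreover have "\<not> partner k < i"
      using no_crossing[of "partner k" i] partner[OF kT] partner_partner[OF kT] assms k' by auto
    moreover have "\<not> partner i < partner k"
      using no_crossing[of i k] assms kT k' by auto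
    ultimately show "partner k \<in> S" using partner[OF kT] by (auto simp: S_def)
    show "partner (partner k) = k" "partner k \<noteq> k" using partner_partner partner kT by auto
  qed (simp add: S_def finite_T)
  moreover have "{k \<in> T. k < partner i} = {k \<in> T. k < i} \<union> {i} \<union> S"
    using assms by (auto simp: S_def)
  moreover have "card ({k \<in> T. k < i} \<union> {i} \<union> S) = card {k \<in> T. k < i} + 1 + card S"
    using finite_T by (subst card_Un_disjoint) (auto simp: S_def)
  ultimately show ?thesis by simp
qed

lemma partner_parity:
  assumes "i \<in> T"
  shows "odd (card {k \<in> T. k < i} + card {k \<in> T. k < partner i})"
proof (cases "i < partner i")
  case False
  then have "partner i < i" using partner[OF assms] by simp
  then show ?thesis
    using partner_parity_aux[of "partner i"] partner[OF assms] partner_partner[OF assms]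
    by (simp add: add.commute)
qed (use partner_parity_aux assms in auto)

end

lemma toggle_toggle: "toggle i (toggle i A) = A"
  by (auto simp: toggle_def)

lemma toggle_subset: "i \<in> S \<Longrightarrow> A \<subseteq> S \<Longrightarrow> toggle i A \<subseteq> S"
  by (auto simp: toggle_def)

lemma superposition_commute: "superposition H A B T P Q \<Longrightarrow> superposition H B A T Q P"
  unfolding superposition_def by auto

context superposition
begin

text \<open>Inside the component \<open>P\<close> is replaced by \<open>Q\<close>, so the uncovered
  outputs change only where exactly one of the matchings covers the vertex, that is at members of
  \<open>T\<close> in the component. These are \<open>i\<close> and its partner.\<close>

lemma switched_matching:
  assumes i: "i \<in> T"
  shows "switch (component i) P Q \<in> perfect_matchings H (output_set H (toggle (partner i) (toggle i A)))"
proof -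
  let ?C = "component i" and ?j = "partner i"
  have C: "\<And>v. v \<in> ?C \<Longrightarrow> mate P v \<in> ?C" "\<And>v. v \<in> ?C \<Longrightarrow> mate Q v \<in> ?C"
    by (auto intro: orbit2.intros)
  let ?A = "toggle ?j (toggle i A)"
  have j: "?j \<in> T" "?j \<noteq> i" "outputs H ! ?j \<in> ?C" using partner[OF i] .
  have A': "?A \<subseteq> {..<length (outputs H)}"
    using A T_less[OF i] T_less[OF j(1)] by (auto simp: toggle_def)
  have k_in: "k = i \<or> k = ?j" if "k \<in> T" "outputs H ! k \<in> ?C" for k
    using that partner_eqI[OF i, of k] by auto
  have "v \<in> (verts H - output_set H A - ?C) \<union> ((verts H - output_set H B) \<inter> ?C) \<longleftrightarrow>
      v \<in> verts H - output_set H ?A" if v: "v \<in> verts H" for v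
  proof (cases "v \<in> set (outputs H)")
    case False
    then have "v \<notin> output_set H S" if "S \<subseteq> {..<length (outputs H)}" for S
      using that by auto
    then show ?thesis using v A B A' by blast
  next
    case True
    then obtain k where k: "k < length (outputs H)" "v = outputs H ! k" by (metis in_set_conv_nth)
    have iC: "outputs H ! i \<in> ?C" by (rule orbit2.base)
    have eq: "v \<in> output_set H A \<longleftrightarrow> k \<in> A" "v \<in> output_set H B \<longleftrightarrow> k \<in> B"
        "v \<in> output_set H ?A \<longleftrightarrow> k \<in> ?A"
      unfolding k(2) using output_set_iff[OF k(1)] A B A' by blast+
    show ?thesis
    proof (cases "v \<in> ?C")
      case True
      then have "k \<in> T \<longleftrightarrow> k = i \<or> k = ?j" using k k_in i j by blast
      moreover have "k \<in> T \<longleftrightarrow> (k \<in> A) \<noteq> (k \<in> B)" by (simp add: T)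
      ultimately show ?thesis
        using True v j(2) by (auto simp: eq in_toggle_iff)
    next
      case False
      then have "k \<noteq> i" "k \<noteq> ?j" using iC j(3) k by auto
      then show ?thesis using False v by (auto simp: eq in_toggle_iff)
    qed
  qed
  then have "verts H - output_set H ?A
      = (verts H - output_set H A - ?C) \<union> ((verts H - output_set H B) \<inter> ?C)"
    by blast
  moreover have "switch ?C P Q \<subseteq> edges H" using edgesP edgesQ by (auto simp: switch_def)
  ultimately show ?thesis
    using perfect_matching_switch[OF pmP pmQ C] perfect_matchings_iff[OF plane] by metis
qed

text \<open>The statement about the second matching is \<open>switched_matching\<close> for the pair
  in reverse order, which has the same components and partners. \<open>T\<close> stays the same
  because both sets are toggled at the same two positions.\<close>

lemma superposition_switch:
  assumes i: "i \<in> T"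
  shows "superposition H (toggle (partner i) (toggle i A)) (toggle (partner i) (toggle i B)) T
    (switch (component i) P Q) (switch (component i) Q P)"
proof -
  interpret S: superposition H B A T Q P
    using superposition_commute superposition_axioms .
  have comm: "S.component k = component k" for k by (rule orbit2_swap)
  have "S.partner i = partner i" unfolding S.partner_def partner_def comm ..
  then have "switch (component i) Q P
      \<in> perfect_matchings H (output_set H (toggle (partner i) (toggle i B)))"
    using S.switched_matching[OF i] unfolding comm by simp
  moreover have "toggle (partner i) (toggle i S) \<subseteq> {..<length (outputs H)}"
    if "S \<subseteq> {..<length (outputs H)}" for S
    using that T_less i partner(1)[OF i] by (intro toggle_subset) auto
  ultimately show ?thesis
    using gen A B switched_matching[OF i] by unfold_locales (auto simp: T in_toggle_iff)
qed

lemma partner_switch: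
  assumes i: "i \<in> T"
  shows "superposition.partner H T (switch (component i) P Q) (switch (component i) Q P) (partner i) = i"
    and "orbit2 (mate (switch (component i) P Q)) (mate (switch (component i) Q P)) (outputs H ! partner i)
      = component i"
proof -
  interpret S: superposition H "toggle (partner i) (toggle i A)" "toggle (partner i) (toggle i B)" T
    "switch (component i) P Q" "switch (component i) Q P"
    using superposition_switch[OF i] .
  have "component (partner i) = component i" using comp_partner[OF i] .
  then show *: "S.component (partner i) = component i"
    using orbit2_switch[OF pmP pmQ, of "outputs H ! partner i"] by simp
  show "S.partner (partner i) = i"
  proof (rule S.partner_eqI)
    show "outputs H ! i \<in> S.component (partner i)" unfolding * by (rule orbit2.base)
    show "i \<noteq> partner i" using partner(2)[OF i] by simp
  qed (use i partner(1) in auto)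
qed

lemma weight_switch:
  "prod (weight H) (switch (component i) P Q) * prod (weight H) (switch (component i) Q P)
    = prod (weight H) P * prod (weight H) Q"
  by (rule prod_switch[OF pmP pmQ])
    (use edgesP edgesQ finite_edges[OF plane] in \<open>auto intro: orbit2.intros finite_subset\<close>)

lemma switch_switch_component:
  "switch (component i) (switch (component i) P Q) (switch (component i) Q P) = P"
  "switch (component i) (switch (component i) Q P) (switch (component i) P Q) = Q"
  by (rule switch_switch[OF pmP pmQ] switch_switch[OF pmQ pmP]; auto intro: orbit2.intros)+

end

text \<open>Combinatorial form of the Grassmann-Pluecker relations of Pfaffians; the exponent is the
  0-based rank of \<open>i\<close> in the symmetric difference \<open>T\<close>. Expanding the
  products gives a sum over triples of an index and two matchings. Toggling the same index in both
  sets leaves \<open>T\<close> unchanged, so \<open>T\<close> serves for all triples.\<close>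

theorem matchgate_identity:
  fixes A B :: "nat set"
  assumes gen: "generator_matchgate H"
    and A: "A \<subseteq> {..<length (outputs H)}" and B: "B \<subseteq> {..<length (outputs H)}"
  defines "T \<equiv> {k. (k \<in> A) \<noteq> (k \<in> B)}"
  shows "(\<Sum>i\<in>T. (-1) ^ card {k \<in> T. k < i} * matching_sum H (toggle i A) * matching_sum H (toggle i B)) = 0"
proof -
  have plane: "plane_graph H" using gen by (simp add: generator_matchgate_def)
  have finT: "finite T" using A B by (auto intro: finite_subset[of _ "{..<length (outputs H)}"] simp: T_def)
  define PM where "PM S = perfect_matchings H (output_set H S)" for S
  define X where "X = (SIGMA i:T. PM (toggle i A) \<times> PM (toggle i B))"
  define h :: "nat \<times> complex set set \<times> complex set set \<Rightarrow> complex" where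
    "h = (\<lambda>(i, P, Q). (-1) ^ card {k \<in> T. k < i} * (prod (weight H) P * prod (weight H) Q))"
  define \<phi> where "\<phi> = (\<lambda>(i, P, Q). (superposition.partner H T P Q i,
     switch (orbit2 (mate P) (mate Q) (outputs H ! i)) P Q,
     switch (orbit2 (mate P) (mate Q) (outputs H ! i)) Q P))"
  have sup: "superposition H (toggle i A) (toggle i B) T P Q" if "(i, P, Q) \<in> X" for i P Q
  proof -
    have "i < length (outputs H)" using that A B by (auto simp: X_def T_def)
    then show ?thesis
      using that gen A B by unfold_locales (auto simp: X_def T_def PM_def toggle_def)
  qed
  have "(\<Sum>i\<in>T. (-1) ^ card {k \<in> T. k < i} * matching_sum H (toggle i A) * matching_sum H (toggle i B))
    = (\<Sum>i\<in>T. \<Sum>(P, Q)\<in>PM (toggle i A) \<times> PM (toggle i B). h (i, P, Q))"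
  proof (rule sum.cong[OF refl])
    fix i
    show "(-1) ^ card {k \<in> T. k < i} * matching_sum H (toggle i A) * matching_sum H (toggle i B)
      = (\<Sum>(P, Q)\<in>PM (toggle i A) \<times> PM (toggle i B). h (i, P, Q))"
      unfolding matching_sum_def PM_def h_def prod.case mult.assoc sum_product sum.cartesian_product
      by (simp add: sum_distrib_left case_prod_unfold)
  qed
  also have "\<dots> = sum h X"
    unfolding X_def using finT finite_perfect_matchings[OF plane]
    by (subst sum.Sigma) (auto simp: PM_def case_prod_unfold)
  also have "\<dots> = 0"
  proof (rule sum_involution_eq_0[of X h \<phi>])
    fix x assume x: "x \<in> X"
    obtain i P Q where xe: "x = (i, P, Q)" by (cases x)
    have iT: "i \<in> T" using x by (simp add: X_def xe)
    interpret S: superposition H "toggle i A" "toggle i B" T P Q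
      using sup x unfolding xe .
    have \<phi>: "\<phi> x = (S.partner i, switch (S.component i) P Q, switch (S.component i) Q P)"
      by (simp add: \<phi>_def xe)
    \<comment> \<open>The two toggles at \<open>i\<close> cancel, so the switched pair belongs to
      the term of index \<open>partner i\<close>.\<close>
    interpret S': superposition H "toggle (S.partner i) A" "toggle (S.partner i) B" T
      "switch (S.component i) P Q" "switch (S.component i) Q P"
      using S.superposition_switch[OF iT] unfolding toggle_toggle .
    show "\<phi> x \<in> X"
      using S.partner(1)[OF iT] S'.P S'.Q by (simp add: \<phi> X_def PM_def)
    show "\<phi> (\<phi> x) = x"
      unfolding \<phi> by (simp add: \<phi>_def S.partner_switch[OF iT] S.switch_switch_component xe)
    show "\<phi> x \<noteq> x" unfolding \<phi> using S.partner(2)[OF iT] by (simp add: xe)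
    have "(-1) ^ card {k \<in> T. k < S.partner i} = - ((-1) ^ card {k \<in> T. k < i} :: complex)"
      using S.partner_parity[OF iT] by (cases "even (card {k \<in> T. k < i})") auto
    then show "h (\<phi> x) + h x = 0"
      unfolding \<phi> by (simp add: h_def xe S.weight_switch)
  qed
  finally show ?thesis .
qed

section \<open>Deleting and complementing outputs\<close>

text \<open>Deleting the outputs in \<open>Z\<close> fixes the letter one at these positions.
  Outputs that occur neither in \<open>Z\<close> nor in \<open>ks\<close> remain as ordinary
  vertices, which fixes the letter zero there.\<close>

definition delete_outputs :: "matchgate \<Rightarrow> nat set \<Rightarrow> nat list \<Rightarrow> matchgate" where
  "delete_outputs H Z ks = H\<lparr>verts := verts H - output_set H Z,
     edges := {e \<in> edges H. e \<subseteq> verts H - output_set H Z},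
     outputs := map (\<lambda>k. outputs H ! k) ks\<rparr>"

text \<open>A smaller drawing has a larger outer face, so the arcs of the kept outputs can be
  reused; an increasing \<open>ks\<close> preserves the order of their angles.\<close>

lemma generator_delete_outputs:
  assumes gen: "generator_matchgate H" and ks: "sorted_wrt (<) ks" "set ks \<subseteq> {..<length (outputs H)}"
    and Z: "Z \<subseteq> {..<length (outputs H)}" "set ks \<inter> Z = {}"
  shows "generator_matchgate (delete_outputs H Z ks)"
  unfolding generator_matchgate_def
proof (intro conjI)
  let ?H = "delete_outputs H Z ks"
  have plane: "plane_graph H" and dist: "distinct (outputs H)" and ov: "set (outputs H) \<subseteq> verts H"
    and ccw: "ccw_on_outer_face H (outputs H)"
    using gen by (auto simp: generator_matchgate_def)
  show "plane_graph ?H"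
    unfolding plane_graph_def
  proof (intro conjI ballI impI)
    show "finite (verts ?H)" using plane by (simp add: delete_outputs_def plane_graph_def)
    fix e assume e: "e \<in> edges ?H"
    then have eH: "e \<in> edges H" by (simp add: delete_outputs_def)
    show "e \<subseteq> verts ?H" using e by (simp add: delete_outputs_def)
    show "card e = 2" "arc (curve ?H e)" "{pathstart (curve ?H e), pathfinish (curve ?H e)} = e"
      using eH plane by (simp_all add: delete_outputs_def plane_graph_def)
    have "path_image (curve H e) \<inter> verts H = e" using eH plane by (simp add: plane_graph_def)
    then show "path_image (curve ?H e) \<inter> verts ?H = e"
      using e by (auto simp: delete_outputs_def)
    fix f assume "f \<in> edges ?H" "e \<noteq> f"
    then have "f \<in> edges H" "e \<noteq> f" by (simp_all add: delete_outputs_def)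
    then show "path_image (curve ?H e) \<inter> path_image (curve ?H f) \<subseteq> e \<inter> f"
      using eH plane by (simp add: delete_outputs_def plane_graph_def)
  qed
  have nth_ks: "ks ! j < length (outputs H)" if "j < length ks" for j
    using ks(2) nth_mem[OF that] by auto
  have inj: "inj_on (\<lambda>k. outputs H ! k) {..<length (outputs H)}"
    using dist nth_eq_iff_index_eq by (auto simp: inj_on_def)
  have "distinct ks" using ks(1) by (simp add: strict_sorted_iff)
  then show "distinct (outputs ?H)"
    using inj_on_subset[OF inj ks(2)] by (simp add: delete_outputs_def distinct_map)
  show "set (outputs ?H) \<subseteq> verts ?H"
  proof
    fix v assume "v \<in> set (outputs ?H)"
    then obtain k where k: "k \<in> set ks" "v = outputs H ! k" by (auto simp: delete_outputs_def)
    then have kl: "k < length (outputs H)" using ks(2) by auto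
    then have "v \<in> verts H" using k ov nth_mem by auto
    moreover have "v \<notin> output_set H Z"
    proof
      assume "v \<in> output_set H Z"
      then obtain z where "z \<in> Z" "v = outputs H ! z" by blast
      then have "k = z" using inj Z(1) kl k(2) by (auto simp: inj_on_def)
      then show False using k(1) Z(2) \<open>z \<in> Z\<close> by blast
    qed
    ultimately show "v \<in> verts ?H" by (simp add: delete_outputs_def)
  qed
  obtain R \<theta> h where dr: "drawing H \<subseteq> ball 0 R"
    and \<theta>: "\<And>i j. i < j \<Longrightarrow> j < length (outputs H) \<Longrightarrow> \<theta> i < \<theta> j \<and> \<theta> j < \<theta> i + 2 * pi"
    and h: "\<And>j. j < length (outputs H) \<Longrightarrow> arc (h j) \<and> pathstart (h j) = outputs H ! j \<and>
           pathfinish (h j) = of_real R * cis (\<theta> j) \<and>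
           path_image (h j) - {outputs H ! j} \<subseteq> outer_face H \<and>
           path_image (h j) - {pathfinish (h j)} \<subseteq> ball 0 R"
    and hd: "\<And>i j. i < length (outputs H) \<Longrightarrow> j < length (outputs H) \<Longrightarrow> i \<noteq> j \<Longrightarrow>
           path_image (h i) \<inter> path_image (h j) = {}"
    using ccw unfolding ccw_on_outer_face_def by metis
  have sub: "drawing ?H \<subseteq> drawing H" by (auto simp: drawing_def delete_outputs_def)
  have outer: "outer_face H \<subseteq> outer_face ?H" using sub by (rule outside_mono)
  have len: "length (outputs ?H) = length ks" by (simp add: delete_outputs_def)
  have nth: "outputs ?H ! j = outputs H ! (ks ! j)" if "j < length ks" for j
    using that by (simp add: delete_outputs_def)
  show "ccw_on_outer_face ?H (outputs ?H)"
    unfolding ccw_on_outer_face_def len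
  proof (intro exI[of _ R] exI[of _ "\<lambda>j. \<theta> (ks ! j)"] exI[of _ "\<lambda>j. h (ks ! j)"] conjI allI impI)
    show "drawing ?H \<subseteq> ball 0 R" using sub dr by blast
    fix i j assume ij: "i < j \<and> j < length ks"
    then have "ks ! i < ks ! j" using ks(1) by (simp add: sorted_wrt_nth_less)
    then show "\<theta> (ks ! i) < \<theta> (ks ! j)" "\<theta> (ks ! j) < \<theta> (ks ! i) + 2 * pi"
      using \<theta> nth_ks ij by auto
  next
    fix j assume j: "j < length ks"
    show "arc (h (ks ! j))" "pathstart (h (ks ! j)) = outputs ?H ! j"
      "pathfinish (h (ks ! j)) = of_real R * cis (\<theta> (ks ! j))"
      "path_image (h (ks ! j)) - {pathfinish (h (ks ! j))} \<subseteq> ball 0 R"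
      using h[OF nth_ks[OF j]] nth[OF j] by auto
    show "path_image (h (ks ! j)) - {outputs ?H ! j} \<subseteq> outer_face ?H"
      using h[OF nth_ks[OF j]] nth[OF j] outer by auto
  next
    fix i j assume "i < length ks" "j < length ks" "i \<noteq> j"
    then show "path_image (h (ks ! i)) \<inter> path_image (h (ks ! j)) = {}"
      using hd nth_ks \<open>distinct ks\<close> by (metis nth_eq_iff_index_eq)
  qed
qed

lemma perfect_matchings_delete_outputs:
  "perfect_matchings (delete_outputs H Z ks) Y = perfect_matchings H (output_set H Z \<union> Y)"
proof -
  let ?X = "output_set H Z"
  have fields: "verts (delete_outputs H Z ks) = verts H - ?X"
    "edges (delete_outputs H Z ks) = {e \<in> edges H. e \<subseteq> verts H - ?X}"
    by (simp_all add: delete_outputs_def)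
  have eq: "verts H - ?X - Y = verts H - (?X \<union> Y)" by blast
  have "(P \<subseteq> {e \<in> edges H. e \<subseteq> verts H - ?X} \<and> (\<forall>e\<in>P. e \<subseteq> verts H - (?X \<union> Y)))
      \<longleftrightarrow> (P \<subseteq> edges H \<and> (\<forall>e\<in>P. e \<subseteq> verts H - (?X \<union> Y)))" for P
    by blast
  then show ?thesis
    unfolding perfect_matchings_def conj_assoc[symmetric]
    by (simp only: fields eq)
qed

lemma matching_sum_delete_outputs:
  assumes "A \<subseteq> {..<length ks}"
  shows "matching_sum (delete_outputs H Z ks) A = matching_sum H (Z \<union> (\<lambda>j. ks ! j) ` A)"
proof -
  have "output_set (delete_outputs H Z ks) A = output_set H ((\<lambda>j. ks ! j) ` A)"
    unfolding image_image using assms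
    by (intro image_cong refl) (auto simp: delete_outputs_def)
  then have "perfect_matchings (delete_outputs H Z ks) (output_set (delete_outputs H Z ks) A)
      = perfect_matchings H (output_set H (Z \<union> (\<lambda>j. ks ! j) ` A))"
    by (simp add: perfect_matchings_delete_outputs image_Un)
  moreover have "weight (delete_outputs H Z ks) = weight H" by (simp add: delete_outputs_def)
  ultimately show ?thesis unfolding matching_sum_def by simp
qed

lemma standard_signature_matching_sum:
  assumes "x < 2 ^ length (outputs H)"
  shows "standard_signature H $ x
    = matching_sum H {k. k < length (outputs H) \<and> digit 2 (length (outputs H)) (Suc k) x = 1}"
proof -
  have "removed_outputs H x
      = output_set H {k. k < length (outputs H) \<and> digit 2 (length (outputs H)) (Suc k) x = 1}"
    (is "?L = ?R")
  proof (intro equalityI subsetI)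
    fix v assume "v \<in> ?L"
    then obtain j where "v = outputs H ! (j - 1)" "j \<in> {1..length (outputs H)}"
        "digit 2 (length (outputs H)) j x = 1"
      by (auto simp: removed_outputs_def)
    then show "v \<in> ?R" by (intro image_eqI[of _ _ "j - 1"]) auto
  next
    fix v assume "v \<in> ?R"
    then obtain k where "v = outputs H ! k" "k < length (outputs H)"
        "digit 2 (length (outputs H)) (Suc k) x = 1" by auto
    then show "v \<in> ?L" unfolding removed_outputs_def by (auto intro!: exI[of _ "Suc k"])
  qed
  then show ?thesis using assms by (simp add: standard_signature_def matching_sum_def)
qed

lemma is_matchgate_signatureI:
  assumes "generator_matchgate H" "length (outputs H) = m" "v \<in> carrier_vec (2 ^ m)"
    "\<And>x. x < 2 ^ m \<Longrightarrow> v $ x = matching_sum H {k. k < m \<and> digit 2 m (Suc k) x = 1}"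
  shows "is_matchgate_signature m v"
  unfolding is_matchgate_signature_def
proof (intro exI[of _ H] conjI)
  show "v = standard_signature H"
  proof (rule eq_vecI)
    show "v $ x = standard_signature H $ x" if "x < dim_vec (standard_signature H)" for x
      using that assms(2,4) standard_signature_matching_sum[of x H] by (simp add: standard_signature_def)
  qed (use assms in \<open>simp add: standard_signature_def\<close>)
qed (use assms in auto)

section \<open>Pendant edges drawn along the outer arcs\<close>

locale outer_arcs =
  fixes H :: matchgate and R :: real and \<theta> :: "nat \<Rightarrow> real" and h :: "nat \<Rightarrow> real \<Rightarrow> complex"
  assumes plane: "plane_graph H" and distinct_outputs: "distinct (outputs H)"
    and outputs_verts: "set (outputs H) \<subseteq> verts H"
    and in_ball: "drawing H \<subseteq> ball 0 R"
    and angles: "\<And>i j. i < j \<Longrightarrow> j < length (outputs H) \<Longrightarrow> \<theta> i < \<theta> j \<and> \<theta> j < \<theta> i + 2 * pi"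
    and arc_h: "\<And>j. j < length (outputs H) \<Longrightarrow> arc (h j)"
    and start_h: "\<And>j. j < length (outputs H) \<Longrightarrow> pathstart (h j) = outputs H ! j"
    and finish_h: "\<And>j. j < length (outputs H) \<Longrightarrow> pathfinish (h j) = of_real R * cis (\<theta> j)"
    and outer_h: "\<And>j. j < length (outputs H) \<Longrightarrow> path_image (h j) - {outputs H ! j} \<subseteq> outer_face H"
    and ball_h: "\<And>j. j < length (outputs H) \<Longrightarrow> path_image (h j) - {pathfinish (h j)} \<subseteq> ball 0 R"
    and disjoint_h: "\<And>i j. i < length (outputs H) \<Longrightarrow> j < length (outputs H) \<Longrightarrow> i \<noteq> j \<Longrightarrow>
           path_image (h i) \<inter> path_image (h j) = {}"
begin

abbreviation m :: nat where "m \<equiv> length (outputs H)"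

text \<open>The midpoint splits each outer arc in two: the first half draws the pendant edge, the
  midpoint becomes the new output, and the second half is its arc through the new outer
  face.\<close>

definition leaf :: "nat \<Rightarrow> complex" where "leaf j = h j (1 / 2)"

definition stem :: "nat \<Rightarrow> complex set" where "stem j = {outputs H ! j, leaf j}"

text \<open>Curves are indexed by edges, so the index of a stem has to be recovered from the leaf
  that it contains, whence the \<open>THE\<close>. Weight 1 on the stems keeps the weight of a
  matching unchanged.\<close>

definition pendant :: matchgate where
  "pendant = \<lparr>verts = verts H \<union> leaf ` {..<m}, edges = edges H \<union> stem ` {..<m},
     weight = (\<lambda>e. if e \<in> edges H then weight H e else 1),
     curve = (\<lambda>e. if e \<in> edges H then curve H e else subpath 0 (1 / 2) (h (THE j. j < m \<and> leaf j \<in> e))),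
     outputs = map leaf [0..<m]\<rparr>"

lemma output_in_verts: "j < m \<Longrightarrow> outputs H ! j \<in> verts H"
  using outputs_verts nth_mem by auto

lemma h_0: "j < m \<Longrightarrow> h j 0 = outputs H ! j"
  using start_h by (simp add: pathstart_def)

lemma h_inj: "\<lbrakk>j < m; s \<in> {0..1}; t \<in> {0..1}; h j s = h j t\<rbrakk> \<Longrightarrow> s = t"
  using arc_h by (auto simp: arc_def inj_on_def)

lemma h_outer:
  assumes "j < m" "0 < t" "t \<le> 1"
  shows "h j t \<in> outer_face H"
proof -
  have "h j t \<noteq> outputs H ! j" using h_inj[of j t 0] h_0 assms by auto
  then show ?thesis using outer_h assms by (force simp: path_image_def)
qed

lemma h_not_drawing: "\<lbrakk>j < m; 0 < t; t \<le> 1\<rbrakk> \<Longrightarrow> h j t \<notin> drawing H"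
  using h_outer by (force simp: outside_def)

lemma drawing_h: "\<lbrakk>j < m; t \<in> {0..1}; h j t \<in> drawing H\<rbrakk> \<Longrightarrow> t = 0"
  using h_not_drawing[of j t] by force

lemma leaf_not_drawing: "j < m \<Longrightarrow> leaf j \<notin> drawing H"
  using h_not_drawing by (simp add: leaf_def)

lemma verts_drawing: "verts H \<subseteq> drawing H" and curve_drawing: "e \<in> edges H \<Longrightarrow> path_image (curve H e) \<subseteq> drawing H"
  by (auto simp: drawing_def)

lemma leaf_not_vert: "j < m \<Longrightarrow> leaf j \<notin> verts H"
  using leaf_not_drawing verts_drawing by blast

lemma h_eq: "\<lbrakk>i < m; j < m; s \<in> {0..1}; t \<in> {0..1}; h i s = h j t\<rbrakk> \<Longrightarrow> i = j \<and> s = t"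
  using disjoint_h[of i j] h_inj[of j s t] by (force simp: path_image_def)

lemma leaf_ne_output: "\<lbrakk>i < m; j < m\<rbrakk> \<Longrightarrow> leaf i \<noteq> outputs H ! j"
  using leaf_not_vert output_in_verts by metis

lemma leaf_inj: "\<lbrakk>i < m; j < m; leaf i = leaf j\<rbrakk> \<Longrightarrow> i = j"
  using h_eq[of i j "1/2" "1/2"] by (simp add: leaf_def)

lemma stem_not_edge: "j < m \<Longrightarrow> stem j \<notin> edges H"
  using plane leaf_not_vert by (auto simp: plane_graph_def stem_def)

lemma leaf_in_stem: "\<lbrakk>i < m; j < m\<rbrakk> \<Longrightarrow> leaf i \<in> stem j \<longleftrightarrow> i = j"
  using leaf_inj leaf_ne_output by (auto simp: stem_def)

lemma curve_stem: "j < m \<Longrightarrow> curve pendant (stem j) = subpath 0 (1 / 2) (h j)"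
proof -
  assume j: "j < m"
  have "(THE i. i < m \<and> leaf i \<in> stem j) = j" using leaf_in_stem j by (intro the_equality) auto
  then show ?thesis using stem_not_edge j by (simp add: pendant_def)
qed

lemma curve_old: "e \<in> edges H \<Longrightarrow> curve pendant e = curve H e"
  by (simp add: pendant_def)

lemma image_stem: "j < m \<Longrightarrow> path_image (curve pendant (stem j)) = h j ` {0..1 / 2}"
  by (simp add: curve_stem path_image_subpath)

lemma image_stem_drawing:
  assumes "j < m"
  shows "path_image (curve pendant (stem j)) \<inter> drawing H = {outputs H ! j}"
proof -
  have "h j t = outputs H ! j" if "t \<in> {0..1/2}" "h j t \<in> drawing H" for t
    using drawing_h[of j t] that assms h_0 by auto
  moreover have "outputs H ! j \<in> h j ` {0..1/2}"
    unfolding h_0[OF assms, symmetric] by (rule imageI) simp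
  moreover have "outputs H ! j \<in> drawing H"
    using output_in_verts[OF assms] verts_drawing by blast
  ultimately show ?thesis unfolding image_stem[OF assms] by blast
qed

lemma image_stem_leaf:
  assumes "i < m" "j < m" "leaf i \<in> path_image (curve pendant (stem j))"
  shows "i = j"
proof -
  obtain x where "x \<in> {0..1/2}" "h i (1/2) = h j x"
    using assms by (auto simp: image_stem leaf_def)
  then show ?thesis using h_eq[of i j "1/2" x] assms by auto
qed

text \<open>An outer arc meets the old drawing only at its output and distinct outer arcs are
  disjoint, so a stem touches an old edge at most in that output and never touches another
  stem.\<close>

lemma plane_pendant: "plane_graph pendant"
  unfolding plane_graph_def
proof (intro conjI ballI impI)
  have verts': "verts pendant = verts H \<union> leaf ` {..<m}"
    and edges': "edges pendant = edges H \<union> stem ` {..<m}" by (simp_all add: pendant_def)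
  show "finite (verts pendant)" using plane by (simp add: verts' plane_graph_def)
  fix e assume e: "e \<in> edges pendant"
  have old: "e \<subseteq> verts H \<and> card e = 2 \<and> arc (curve H e) \<and>
      {pathstart (curve H e), pathfinish (curve H e)} = e \<and> path_image (curve H e) \<inter> verts H = e"
    if "e \<in> edges H" for e
    using plane that by (simp add: plane_graph_def)
  have oldv: "path_image (curve H e) \<inter> verts pendant = e" if "e \<in> edges H" for e
    using old[OF that] leaf_not_drawing curve_drawing[OF that] by (auto simp: verts')
  have stem_verts: "path_image (curve pendant (stem j)) \<inter> verts pendant = stem j" if j: "j < m" for j
  proof -
    have "leaf j \<in> path_image (curve pendant (stem j))" using j by (auto simp: image_stem leaf_def)
    then show ?thesis
      using image_stem_drawing[OF j] verts_drawing output_in_verts[OF j] image_stem_leaf[OF _ j] j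
      unfolding verts' stem_def by blast
  qed
  have "e \<subseteq> verts pendant \<and> card e = 2 \<and> arc (curve pendant e) \<and>
      {pathstart (curve pendant e), pathfinish (curve pendant e)} = e \<and>
      path_image (curve pendant e) \<inter> verts pendant = e"
  proof (cases "e \<in> edges H")
    case True
    then show ?thesis using old[OF True] oldv[OF True] by (auto simp: curve_old verts')
  next
    case False
    then obtain j where j: "j < m" "e = stem j" using e by (auto simp: edges')
    have "outputs H ! j \<noteq> leaf j" using output_in_verts leaf_not_vert j by metis
    moreover have "arc (curve pendant e)"
      using arc_h j by (auto simp: curve_stem intro!: arc_subpath_arc)
    moreover have "{pathstart (curve pendant e), pathfinish (curve pendant e)} = e"
      unfolding j(2) curve_stem[OF j(1)] by (simp add: h_0[OF j(1)] stem_def leaf_def)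
    ultimately show ?thesis
      using stem_verts j output_in_verts by (auto simp: verts' stem_def)
  qed
  then show "e \<subseteq> verts pendant" "card e = 2" "arc (curve pendant e)"
    "{pathstart (curve pendant e), pathfinish (curve pendant e)} = e"
    "path_image (curve pendant e) \<inter> verts pendant = e" by - (elim conjE, assumption)+
  fix f assume f: "f \<in> edges pendant" and ef: "e \<noteq> f"
  have mixed: "path_image (curve pendant e) \<inter> path_image (curve pendant (stem j)) \<subseteq> e \<inter> stem j"
    if "e \<in> edges H" "j < m" for e j
  proof -
    have "path_image (curve H e) \<inter> path_image (curve pendant (stem j)) \<subseteq> {outputs H ! j}"
      using image_stem_drawing[OF that(2)] curve_drawing[OF that(1)] by blast
    moreover have "outputs H ! j \<in> path_image (curve H e) \<Longrightarrow> outputs H ! j \<in> e"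
      using old[OF that(1)] output_in_verts[OF that(2)] by blast
    ultimately show ?thesis by (auto simp: curve_old[OF that(1)] stem_def)
  qed
  consider "e \<in> edges H" "f \<in> edges H" | j where "e \<in> edges H" "j < m" "f = stem j"
    | j where "f \<in> edges H" "j < m" "e = stem j" | i j where "i < m" "j < m" "e = stem i" "f = stem j"
    using e f unfolding edges' by blast
  then show "path_image (curve pendant e) \<inter> path_image (curve pendant f) \<subseteq> e \<inter> f"
  proof cases
    case 1
    then show ?thesis using plane ef by (simp add: curve_old plane_graph_def)
  next
    case (4 i j)
    then have "i \<noteq> j" using ef by blast
    then have "path_image (h i) \<inter> path_image (h j) = {}" using disjoint_h 4 by blast
    then have "h i ` {0..1/2} \<inter> h j ` {0..1/2} = {}" unfolding path_image_def
      by (metis (no_types, lifting) Int_mono atLeastatMost_subset_iff divide_le_eq_1_pos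
          image_mono le_numeral_extra(3) one_le_numeral subset_empty zero_less_numeral)
    then show ?thesis using 4 by (simp add: image_stem)
  qed (use mixed in blast)+
qed

lemma drawing_pendant: "drawing pendant = drawing H \<union> (\<Union>j<m. h j ` {0..1 / 2})"
proof -
  have "(\<Union>e\<in>edges pendant. path_image (curve pendant e))
      = (\<Union>e\<in>edges H. path_image (curve H e)) \<union> (\<Union>j<m. h j ` {0..1 / 2})"
  proof -
    have "edges pendant = edges H \<union> stem ` {..<m}" by (simp add: pendant_def)
    then show ?thesis by (simp add: UN_Un curve_old image_stem)
  qed
  moreover have "leaf ` {..<m} \<subseteq> (\<Union>j<m. h j ` {0..1 / 2})" by (auto simp: leaf_def)
  ultimately show ?thesis unfolding drawing_def by (auto simp: pendant_def)
qed

lemma drawing_pendant_ball: "drawing pendant \<subseteq> ball 0 R"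
proof -
  have "h j t \<in> ball 0 R" if "j < m" "t \<in> {0..1/2}" for j t
  proof -
    have "h j t \<noteq> pathfinish (h j)"
      using h_inj[of j t 1] that by (auto simp: pathfinish_def)
    moreover have "h j t \<in> path_image (h j)" using that by (auto simp: path_image_def)
    ultimately show ?thesis using ball_h that by blast
  qed
  then show ?thesis using in_ball unfolding drawing_pendant by blast
qed

text \<open>The rest of the arc, from \<open>t\<close> on, is connected, avoids the enlarged drawing
  and ends on the circle, which lies outside a disc containing that drawing. So all of it belongs to
  the outside.\<close>

lemma outer_pendant:
  assumes j: "j < m" and t: "1 / 2 < t" "t \<le> 1"
  shows "h j t \<in> outer_face pendant"
proof -
  have "connected (h j ` {t..1})"
    using arc_h[OF j] t
    by (intro connected_continuous_image) (auto simp: arc_def path_def intro: continuous_on_subset)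
  moreover have "h j ` {t..1} \<subseteq> - drawing pendant"
  proof -
    have "h j s \<notin> drawing H" if "s \<in> {t..1}" for s
      using h_not_drawing[OF j, of s] that t by auto
    moreover have "h j s \<notin> h i ` {0..1/2}" if "s \<in> {t..1}" "i < m" for s i
      using h_eq[OF j that(2), of s] that t by force
    ultimately have "h j s \<notin> drawing pendant" if "s \<in> {t..1}" for s
      unfolding drawing_pendant using that by blast
    then show ?thesis by blast
  qed
  moreover have "h j 1 \<in> h j ` {t..1}" "h j t \<in> h j ` {t..1}" using t by auto
  ultimately have "connected_component (- drawing pendant) (h j 1) (h j t)"
    by (meson connected_component_def)
  moreover have "h j 1 \<in> outside (drawing pendant)"
  proof -
    have "h j 1 = of_real R * cis (\<theta> j)" using finish_h[OF j] by (simp add: pathfinish_def)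
    then have "h j 1 \<in> - ball 0 R" by (simp add: norm_mult)
    then show ?thesis
      using outside_subset_convex[OF convex_ball drawing_pendant_ball] by blast
  qed
  ultimately show ?thesis by (rule outside_same_component)
qed

lemma generator_pendant: "generator_matchgate pendant"
  unfolding generator_matchgate_def
proof (intro conjI)
  have outs: "outputs pendant = map leaf [0..<m]" by (simp add: pendant_def)
  show "plane_graph pendant" by (rule plane_pendant)
  show "distinct (outputs pendant)" using leaf_inj by (auto simp: outs distinct_map inj_on_def)
  show "set (outputs pendant) \<subseteq> verts pendant" by (auto simp: pendant_def)
  show "ccw_on_outer_face pendant (outputs pendant)"
    unfolding ccw_on_outer_face_def
  proof (intro exI[of _ R] exI[of _ \<theta>] exI[of _ "\<lambda>j. subpath (1 / 2) 1 (h j)"] conjI allI impI)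
    show "drawing pendant \<subseteq> ball 0 R" by (rule drawing_pendant_ball)
    fix i j assume "i < j \<and> j < length (outputs pendant)"
    then show "\<theta> i < \<theta> j" "\<theta> j < \<theta> i + 2 * pi" using angles by (auto simp: outs)
  next
    fix j assume "j < length (outputs pendant)"
    then have j: "j < m" by (simp add: outs)
    have img: "path_image (subpath (1 / 2) 1 (h j)) = h j ` {1/2..1}" by (simp add: path_image_subpath)
    show "arc (subpath (1 / 2) 1 (h j))" using arc_h[OF j] by (intro arc_subpath_arc) auto
    show "pathstart (subpath (1 / 2) 1 (h j)) = outputs pendant ! j"
      using j by (simp add: outs leaf_def)
    show fin: "pathfinish (subpath (1 / 2) 1 (h j)) = of_real R * cis (\<theta> j)"
      using finish_h[OF j] by (simp add: pathfinish_def subpath_def)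
    have "h j t \<in> outer_face pendant" if "t \<in> {1/2..1}" "h j t \<noteq> leaf j" for t
      using outer_pendant[OF j, of t] that by (cases "t = 1/2") (auto simp: leaf_def)
    then have "h j ` {1/2..1} - {leaf j} \<subseteq> outer_face pendant" by blast
    then show "path_image (subpath (1 / 2) 1 (h j)) - {outputs pendant ! j} \<subseteq> outer_face pendant"
      using j by (simp add: img outs)
    have "h j ` {1/2..1} \<subseteq> path_image (h j)" by (auto simp: path_image_def)
    then show "path_image (subpath (1 / 2) 1 (h j)) - {pathfinish (subpath (1 / 2) 1 (h j))} \<subseteq> ball 0 R"
      using ball_h[OF j] unfolding img fin finish_h[OF j] by blast
  next
    fix i j assume "i < length (outputs pendant)" "j < length (outputs pendant)" "i \<noteq> j"
    then have "path_image (h i) \<inter> path_image (h j) = {}" using disjoint_h by (simp add: outs)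
    moreover have "path_image (subpath (1 / 2) 1 (h k)) \<subseteq> path_image (h k)" for k
      by (rule path_image_subpath_subset) auto
    ultimately show "path_image (subpath (1 / 2) 1 (h i)) \<inter> path_image (subpath (1 / 2) 1 (h j)) = {}"
      by blast
  qed
qed

end

lemma perfect_matching_on_Un:
  assumes P: "perfect_matching_on U P" and Q: "perfect_matching_on W Q" and "U \<inter> W = {}"
  shows "perfect_matching_on (U \<union> W) (P \<union> Q)"
  unfolding perfect_matching_on_def
proof (intro conjI ballI)
  have PU: "e \<subseteq> U" "card e = 2" if "e \<in> P" for e using P that by (auto simp: perfect_matching_on_def)
  have QW: "e \<subseteq> W" "card e = 2" if "e \<in> Q" for e using Q that by (auto simp: perfect_matching_on_def)
  fix e assume "e \<in> P \<union> Q"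
  then show "card e = 2" "e \<subseteq> U \<union> W" using PU QW by blast+
next
  have PU: "e \<subseteq> U" if "e \<in> P" for e using P that by (auto simp: perfect_matching_on_def)
  have QW: "e \<subseteq> W" if "e \<in> Q" for e using Q that by (auto simp: perfect_matching_on_def)
  fix v assume "v \<in> U \<union> W"
  then consider "v \<in> U" "v \<notin> W" | "v \<in> W" "v \<notin> U" using assms(3) by blast
  then show "\<exists>!e. e \<in> P \<union> Q \<and> v \<in> e"
  proof cases
    case 1
    then have "\<exists>!e. e \<in> P \<and> v \<in> e" using P by (simp add: perfect_matching_on_def)
    moreover have "e \<in> P \<union> Q \<and> v \<in> e \<longleftrightarrow> e \<in> P \<and> v \<in> e" for e using QW 1 by blast
    ultimately show ?thesis by simp
  next
    case 2
    then have "\<exists>!e. e \<in> Q \<and> v \<in> e" using Q by (simp add: perfect_matching_on_def)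
    moreover have "e \<in> P \<union> Q \<and> v \<in> e \<longleftrightarrow> e \<in> Q \<and> v \<in> e" for e using PU 2 by blast
    ultimately show ?thesis by simp
  qed
qed

lemma perfect_matching_on_Diff:
  assumes P: "perfect_matching_on U P" and N: "perfect_matching_on W N" and "N \<subseteq> P" "W \<subseteq> U"
  shows "perfect_matching_on (U - W) (P - N)"
  unfolding perfect_matching_on_def
proof (intro conjI ballI)
  fix e assume e: "e \<in> P - N"
  then show "card e = 2" using P by (auto simp: perfect_matching_on_def)
  have "v \<notin> W" if "v \<in> e" for v
  proof
    assume v: "v \<in> W"
    then obtain f where "f \<in> N" "v \<in> f" using N by (auto simp: perfect_matching_on_def)
    moreover have "\<exists>!e. e \<in> P \<and> v \<in> e" using P v \<open>W \<subseteq> U\<close> by (simp add: perfect_matching_on_def subsetD)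
    ultimately show False using that e \<open>N \<subseteq> P\<close> by blast
  qed
  then show "e \<subseteq> U - W" using P e by (auto simp: perfect_matching_on_def)
next
  fix v assume v: "v \<in> U - W"
  then have "\<exists>!e. e \<in> P \<and> v \<in> e" using P by (simp add: perfect_matching_on_def)
  moreover have "v \<notin> e" if "e \<in> N" for e using N v that by (auto simp: perfect_matching_on_def)
  then have "e \<in> P - N \<and> v \<in> e \<longleftrightarrow> e \<in> P \<and> v \<in> e" for e by blast
  ultimately show "\<exists>!e. e \<in> P - N \<and> v \<in> e" by simp
qed

context outer_arcs
begin

lemma perfect_matching_stems:
  assumes "B \<subseteq> {..<m}"
  shows "perfect_matching_on (output_set H B \<union> leaf ` B) (stem ` B)"
  unfolding perfect_matching_on_def
proof (intro conjI ballI)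
  fix e assume "e \<in> stem ` B"
  then obtain j where j: "j \<in> B" "e = stem j" by blast
  then have "j < m" using assms by auto
  then have "outputs H ! j \<noteq> leaf j" using leaf_ne_output by metis
  then show "card e = 2" using j by (simp add: stem_def)
  show "e \<subseteq> output_set H B \<union> leaf ` B" using j by (auto simp: stem_def)
next
  have out: "outputs H ! i = outputs H ! j \<longleftrightarrow> i = j" if "i < m" "j < m" for i j
    using distinct_outputs that nth_eq_iff_index_eq by auto
  fix v assume "v \<in> output_set H B \<union> leaf ` B"
  then obtain j where j: "j \<in> B" "v \<in> stem j" "v = outputs H ! j \<or> v = leaf j" by (auto simp: stem_def)
  have "e = stem j" if e: "e \<in> stem ` B" "v \<in> e" for e
  proof -
    obtain i where i: "i \<in> B" "e = stem i" using e(1) by blast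
    have ij: "i < m" "j < m" using i j assms by auto
    have "i = j" using e(2) j(3) out[OF ij] leaf_ne_output[OF ij] leaf_ne_output[OF ij(2,1)] leaf_inj[OF ij]
      unfolding i(2) stem_def by auto
    then show ?thesis by (simp add: i)
  qed
  then show "\<exists>!e. e \<in> stem ` B \<and> v \<in> e" using j by blast
qed

text \<open>A leaf that stays can be covered only by its stem, which uses up the old output; a
  removed leaf forbids its stem, so the old output has to be covered inside \<open>H\<close>. Hence
  the old outputs missing from the matching of \<open>H\<close> are those whose leaves were
  kept.\<close>

lemma perfect_matchings_pendant:
  assumes A: "A \<subseteq> {..<m}"
  shows "perfect_matchings pendant (output_set pendant A)
    = (\<lambda>P. P \<union> stem ` ({..<m} - A)) ` perfect_matchings H (output_set H ({..<m} - A))"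
proof -
  define B where "B = {..<m} - A"
  have B: "B \<subseteq> {..<m}" by (auto simp: B_def)
  have outA: "output_set pendant A = leaf ` A"
    using A by (intro image_cong refl) (auto simp: pendant_def)
  define U where "U = verts H \<union> leaf ` B"
  define W where "W = output_set H B \<union> leaf ` B"
  have "leaf ` {..<m} - leaf ` A = leaf ` B"
    using leaf_inj A by (auto simp: B_def)
  moreover have "verts H \<inter> leaf ` A = {}" using leaf_not_vert A by auto
  ultimately have U: "verts pendant - output_set pendant A = U"
    unfolding outA by (auto simp: pendant_def U_def)
  have "output_set H B \<subseteq> verts H" using output_in_verts B by auto
  moreover have "verts H \<inter> leaf ` B = {}" using leaf_not_vert B by auto
  ultimately have UW: "U - W = verts H - output_set H B" "W \<subseteq> U"
    "(verts H - output_set H B) \<union> W = U" "(verts H - output_set H B) \<inter> W = {}"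
    by (auto simp: U_def W_def)
  have N: "perfect_matching_on W (stem ` B)" unfolding W_def by (rule perfect_matching_stems[OF B])
  have edges': "edges pendant = edges H \<union> stem ` {..<m}" by (simp add: pendant_def)
  show ?thesis
  proof (intro equalityI subsetI)
    fix P assume "P \<in> perfect_matchings pendant (output_set pendant A)"
    then have P: "P \<subseteq> edges pendant" "perfect_matching_on U P"
      using perfect_matchings_iff[OF plane_pendant] U by auto
    have "stem j \<in> P" if "j \<in> B" for j
    proof -
      have j: "j < m" using that B by auto
      have "leaf j \<in> U" using that by (simp add: U_def)
      then obtain e where e: "e \<in> P" "leaf j \<in> e" using P(2) by (auto simp: perfect_matching_on_def)
      then have "e \<notin> edges H" using leaf_not_vert[OF j] plane by (auto simp: plane_graph_def)
      then obtain i where "i < m" "e = stem i" using e P(1) edges' by auto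
      then show ?thesis using leaf_in_stem j e by auto
    qed
    then have NP: "stem ` B \<subseteq> P" by blast
    have "j \<in> B" if "stem j \<in> P" "j < m" for j
    proof -
      have "stem j \<subseteq> U" using P(2) that by (auto simp: perfect_matching_on_def)
      then have "leaf j \<in> leaf ` B" using leaf_not_vert that(2) by (auto simp: stem_def U_def)
      then show ?thesis using leaf_inj B that(2) by auto
    qed
    then have "P - stem ` B \<subseteq> edges H" using P(1) edges' by blast
    moreover have "perfect_matching_on (U - W) (P - stem ` B)"
      by (rule perfect_matching_on_Diff[OF P(2) N NP UW(2)])
    ultimately have "P - stem ` B \<in> perfect_matchings H (output_set H B)"
      using perfect_matchings_iff[OF plane] UW(1) by simp
    moreover have "P = (P - stem ` B) \<union> stem ` B" using NP by blast
    ultimately show "P \<in> (\<lambda>P. P \<union> stem ` ({..<m} - A)) ` perfect_matchings H (output_set H ({..<m} - A))"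
      unfolding B_def by blast
  next
    fix P' assume "P' \<in> (\<lambda>P. P \<union> stem ` ({..<m} - A)) ` perfect_matchings H (output_set H ({..<m} - A))"
    then obtain P where P': "P' = P \<union> stem ` B" and "P \<in> perfect_matchings H (output_set H B)"
      unfolding B_def by blast
    then have P: "P \<subseteq> edges H" "perfect_matching_on (verts H - output_set H B) P"
      using perfect_matchings_iff[OF plane] by auto
    have "perfect_matching_on U P'"
      using perfect_matching_on_Un[OF P(2) N UW(4)] unfolding UW(3) P' .
    moreover have "P' \<subseteq> edges pendant" using P(1) B unfolding P' edges' by blast
    ultimately show "P' \<in> perfect_matchings pendant (output_set pendant A)"
      using perfect_matchings_iff[OF plane_pendant] U by simp
  qed
qed

lemma matching_sum_pendant:
  assumes A: "A \<subseteq> {..<m}"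
  shows "matching_sum pendant A = matching_sum H ({..<m} - A)"
proof -
  let ?N = "stem ` ({..<m} - A)" and ?M = "perfect_matchings H (output_set H ({..<m} - A))"
  have sub: "P \<subseteq> edges H" if "P \<in> ?M" for P using that by (simp add: perfect_matchings_def)
  have disj: "P \<inter> ?N = {}" if "P \<in> ?M" for P using sub[OF that] stem_not_edge by auto
  have "inj_on (\<lambda>P. P \<union> ?N) ?M"
  proof (rule inj_on_inverseI[where g = "\<lambda>P. P - ?N"])
    show "P \<union> ?N - ?N = P" if "P \<in> ?M" for P using disj[OF that] by blast
  qed
  then have "matching_sum pendant A = (\<Sum>P\<in>?M. \<Prod>e\<in>P \<union> ?N. weight pendant e)"
    unfolding matching_sum_def perfect_matchings_pendant[OF A] by (simp add: sum.reindex)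
  also have "\<dots> = (\<Sum>P\<in>?M. \<Prod>e\<in>P. weight H e)"
  proof (rule sum.cong[OF refl])
    fix P assume P: "P \<in> ?M"
    have "finite P" using sub[OF P] finite_edges[OF plane] by (rule finite_subset)
    then have "(\<Prod>e\<in>P \<union> ?N. weight pendant e) = (\<Prod>e\<in>P. weight pendant e) * (\<Prod>e\<in>?N. weight pendant e)"
      using disj[OF P] by (intro prod.union_disjoint) auto
    moreover have "(\<Prod>e\<in>?N. weight pendant e) = 1"
      using stem_not_edge by (intro prod.neutral) (auto simp: pendant_def)
    moreover have "(\<Prod>e\<in>P. weight pendant e) = (\<Prod>e\<in>P. weight H e)"
      using sub[OF P] by (intro prod.cong refl) (auto simp: pendant_def)
    ultimately show "(\<Prod>e\<in>P \<union> ?N. weight pendant e) = (\<Prod>e\<in>P. weight H e)" by simp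
  qed
  finally show ?thesis by (simp add: matching_sum_def)
qed

end

lemma complementary_matchgate:
  assumes "generator_matchgate H"
  obtains H' where "generator_matchgate H'" "length (outputs H') = length (outputs H)"
    "\<And>A. A \<subseteq> {..<length (outputs H)} \<Longrightarrow>
      matching_sum H' A = matching_sum H ({..<length (outputs H)} - A)"
proof -
  obtain R \<theta> h where dr: "drawing H \<subseteq> ball 0 R"
    and th: "\<And>i j. i < j \<Longrightarrow> j < length (outputs H) \<Longrightarrow> \<theta> i < \<theta> j \<and> \<theta> j < \<theta> i + 2 * pi"
    and h: "\<And>j. j < length (outputs H) \<Longrightarrow> arc (h j) \<and> pathstart (h j) = outputs H ! j \<and>
           pathfinish (h j) = of_real R * cis (\<theta> j) \<and>
           path_image (h j) - {outputs H ! j} \<subseteq> outer_face H \<and>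
           path_image (h j) - {pathfinish (h j)} \<subseteq> ball 0 R"
    and hd: "\<And>i j. i < length (outputs H) \<Longrightarrow> j < length (outputs H) \<Longrightarrow> i \<noteq> j \<Longrightarrow>
           path_image (h i) \<inter> path_image (h j) = {}"
    using assms unfolding generator_matchgate_def ccw_on_outer_face_def by metis
  interpret outer_arcs H R \<theta> h
  proof
    show "plane_graph H" "distinct (outputs H)" "set (outputs H) \<subseteq> verts H"
      using assms by (simp_all add: generator_matchgate_def)
    fix j assume "j < length (outputs H)"
    note hj = h[OF this]
    show "arc (h j)" "pathstart (h j) = outputs H ! j" "pathfinish (h j) = of_real R * cis (\<theta> j)"
      "path_image (h j) - {outputs H ! j} \<subseteq> outer_face H"
      "path_image (h j) - {pathfinish (h j)} \<subseteq> ball 0 R"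
      using hj by - (elim conjE, assumption)+
  qed (fact dr th hd)+
  show ?thesis
    using that[OF generator_pendant] matching_sum_pendant by (simp add: pendant_def)
qed

section \<open>Words and multilinear forms\<close>

text \<open>Inverse to \<open>digit\<close>. Describing words by functions on \<open>{1..n}\<close>
  makes the change of one block a function update.\<close>

definition word :: "nat \<Rightarrow> nat \<Rightarrow> (nat \<Rightarrow> nat) \<Rightarrow> nat" where
  "word b n d = (\<Sum>s = 1..n. d s * b ^ (n - s))"

lemma word_Suc: "word b (Suc n) d = word b n d * b + d (Suc n)"
proof -
  have "(\<Sum>s = 1..n. d s * b ^ (Suc n - s)) = (\<Sum>s = 1..n. d s * b ^ (n - s)) * b"
    unfolding sum_distrib_right by (intro sum.cong refl) (auto simp: Suc_diff_le)
  then show ?thesis by (simp add: word_def)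
qed

lemma digit_Suc: "s \<le> n \<Longrightarrow> digit b (Suc n) s x = digit b n s (x div b)"
  by (simp add: digit_def Suc_diff_le div_mult2_eq)

lemma digit_last: "digit b n n x = x mod b"
  by (simp add: digit_def)

lemma digit_less: "0 < b \<Longrightarrow> digit b n s x < b"
  by (simp add: digit_def)

lemma word_less: "(\<And>s. s \<in> {1..n} \<Longrightarrow> d s < b) \<Longrightarrow> word b n d < b ^ n"
proof (induction n)
  case (Suc n)
  then have "word b n d + 1 \<le> b ^ n" "d (Suc n) < b" by (auto simp: Suc_le_eq)
  then have "(word b n d + 1) * b \<le> b ^ n * b" "d (Suc n) < b" by (simp_all only: mult_le_mono1)
  then show ?case by (simp add: word_Suc algebra_simps)
qed (simp add: word_def)

lemma digit_word:
  "\<lbrakk>\<And>s. s \<in> {1..n} \<Longrightarrow> d s < b; s \<in> {1..n}\<rbrakk> \<Longrightarrow> digit b n s (word b n d) = d s"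
proof (induction n)
  case (Suc n)
  have d: "d (Suc n) < b" using Suc.prems(1) by auto
  show ?case
  proof (cases "s = Suc n")
    case True
    then show ?thesis using d by (simp add: digit_last word_Suc)
  next
    case False
    then have s: "s \<in> {1..n}" using Suc.prems(2) by auto
    have "(word b n d * b + d (Suc n)) div b = word b n d" using d by simp
    then show ?thesis using Suc.IH Suc.prems(1) s by (simp add: digit_Suc word_Suc)
  qed
qed simp

lemma word_digit: "x < b ^ n \<Longrightarrow> word b n (\<lambda>s. digit b n s x) = x"
proof (induction n arbitrary: x)
  case (Suc n)
  have "word b n (\<lambda>s. digit b (Suc n) s x) = word b n (\<lambda>s. digit b n s (x div b))"
    unfolding word_def by (intro sum.cong refl) (simp add: digit_Suc)
  moreover have "x div b < b ^ n" using Suc.prems by (simp add: less_mult_imp_div_less mult.commute)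
  ultimately show ?case using Suc.IH[of "x div b"] by (simp add: word_Suc digit_last)
qed (simp add: word_def)

lemma word_cong: "(\<And>s. s \<in> {1..n} \<Longrightarrow> d s = d' s) \<Longrightarrow> word b n d = word b n d'"
  unfolding word_def by (intro sum.cong refl) simp

lemma digit_eq_imp_eq:
  assumes "x < b ^ n" "y < b ^ n" "\<And>s. s \<in> {1..n} \<Longrightarrow> digit b n s x = digit b n s y"
  shows "x = y"
  using word_digit[OF assms(1)] word_digit[OF assms(2)]
    word_cong[of n "\<lambda>s. digit b n s x" "\<lambda>s. digit b n s y" b] assms(3) by simp

lemma word_update:
  assumes "t \<in> {1..n}"
  shows "word b n (d(t := a)) = word b n (d(t := 0)) + a * b ^ (n - t)"
proof -
  have split: "word b n f = f t * b ^ (n - t) + (\<Sum>s\<in>{1..n} - {t}. f s * b ^ (n - s))" for f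
    unfolding word_def by (rule sum.remove) (use assms in auto)
  have "(\<Sum>s\<in>{1..n} - {t}. (d(t := a)) s * b ^ (n - s)) = (\<Sum>s\<in>{1..n} - {t}. (d(t := 0)) s * b ^ (n - s))"
    by (intro sum.cong refl) auto
  then show ?thesis unfolding split by simp
qed

text \<open>This is the index expression in \<open>matrix_form\<close>, named so that an entry in
  row \<open>a\<close> can be compared with the word of an updated function
  \<open>d(t := a)\<close>.\<close>

definition insert_letter :: "nat \<Rightarrow> nat \<Rightarrow> nat \<Rightarrow> nat \<Rightarrow> nat \<Rightarrow> nat" where
  "insert_letter b n t a c = (c div b ^ (n - t)) * b ^ (n - t + 1) + a * b ^ (n - t) + c mod b ^ (n - t)"

lemma insert_letter_0: "insert_letter b n t a c = insert_letter b n t 0 c + a * b ^ (n - t)"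
  by (simp add: insert_letter_def)

lemma insert_letter_less:
  assumes "t \<in> {1..n}" "c < b ^ (n - 1)" "a < b"
  shows "insert_letter b n t a c < b ^ n"
proof -
  define k where "k = n - t"
  have "n - 1 = t - 1 + k" "n = t - 1 + (k + 1)" using assms(1) by (auto simp: k_def)
  then have n: "b ^ (n - 1) = b ^ (t - 1) * b ^ k" "b ^ n = b ^ (t - 1) * b ^ (k + 1)"
    by (metis power_add)+
  have b: "0 < b ^ k" using assms(3) by simp
  have "c div b ^ k + 1 \<le> b ^ (t - 1)"
    using assms(2) unfolding n by (simp add: Suc_le_eq less_mult_imp_div_less)
  then have 1: "(c div b ^ k + 1) * b ^ (k + 1) \<le> b ^ n" unfolding n by (rule mult_le_mono1)
  have "(a + 1) * b ^ k \<le> b * b ^ k" using assms(3) by (intro mult_le_mono1) simp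
  moreover have "c mod b ^ k < b ^ k" using b by simp
  ultimately have "a * b ^ k + c mod b ^ k < b ^ (k + 1)" by simp
  then show ?thesis using 1 unfolding insert_letter_def k_def[symmetric] by (simp add: algebra_simps)
qed

lemma digit_insert_letter_0:
  assumes "0 < b"
  shows "digit b n t (insert_letter b n t 0 c) = 0"
proof -
  have "insert_letter b n t 0 c div b ^ (n - t) = c div b ^ (n - t) * b"
    using assms by (simp add: insert_letter_def mult.assoc[symmetric] div_mult_self4)
  then show ?thesis by (simp add: digit_def)
qed

lemma insert_letter_is_word:
  assumes "t \<in> {1..n}" "c < b ^ (n - 1)" "0 < b"
  obtains d where "\<And>s. d s < b" "\<And>a. insert_letter b n t a c = word b n (d(t := a))"
proof -
  define d where "d = (\<lambda>s. digit b n s (insert_letter b n t 0 c))"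
  have "d t = 0" using digit_insert_letter_0[OF assms(3)] by (simp add: d_def)
  then have "word b n (d(t := 0)) = word b n d" by (intro word_cong) auto
  also have "\<dots> = insert_letter b n t 0 c"
    unfolding d_def by (rule word_digit[OF insert_letter_less[OF assms]])
  finally have base: "word b n (d(t := 0)) = insert_letter b n t 0 c" .
  show ?thesis
  proof (rule that)
    show "d s < b" for s unfolding d_def using assms(3) by (rule digit_less)
    show "insert_letter b n t a c = word b n (d(t := a))" for a
      unfolding insert_letter_0[of b n t a c] word_update[OF assms(1), of b d a] base ..
  qed
qed

lemma word_is_insert_letter:
  assumes t: "t \<in> {1..n}" and d: "\<And>s. s \<in> {1..n} \<Longrightarrow> d s < b"
  obtains c where "c < b ^ (n - 1)" "\<And>a. word b n (d(t := a)) = insert_letter b n t a c"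
proof -
  define k where "k = n - t"
  define x where "x = word b n (d(t := 0))"
  have b: "0 < b" using d[OF t] by simp
  have "n - 1 = t - 1 + k" "n = t - 1 + (k + 1)" using t by (auto simp: k_def)
  then have n: "b ^ (n - 1) = b ^ (t - 1) * b ^ k" "b ^ n = b ^ (t - 1) * b ^ (k + 1)"
    by (metis power_add)+
  have "x < b ^ n" unfolding x_def by (rule word_less) (use d b in auto)
  then have q: "x div b ^ (k + 1) + 1 \<le> b ^ (t - 1)"
    unfolding n by (simp add: Suc_le_eq less_mult_imp_div_less)
  \<comment> \<open>\<open>c\<close> is \<open>x\<close> with its letter \<open>t\<close>, which is
    0, deleted: the letters to the left of it move down by one place.\<close>
  define c where "c = (x div b ^ (k + 1)) * b ^ k + x mod b ^ k"
  have r: "x mod b ^ k < b ^ k" using b by simp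
  have "(x div b ^ (k + 1) + 1) * b ^ k \<le> b ^ (n - 1)" unfolding n(1) using q by (rule mult_le_mono1)
  then have c: "c < b ^ (n - 1)" using r by (simp add: c_def)
  have cdiv: "c div b ^ k = x div b ^ (k + 1)" "c mod b ^ k = x mod b ^ k"
    using r b by (simp_all add: c_def)
  have "digit b n t x = (d(t := 0)) t" unfolding x_def by (rule digit_word) (use d b t in auto)
  then have "(x div b ^ k) mod b = 0" by (simp add: digit_def k_def)
  then have "x div b ^ k = (x div b ^ k div b) * b" by (metis add.right_neutral div_mult_mod_eq)
  then have "x div b ^ k = (x div b ^ (k + 1)) * b" by (simp add: div_mult2_eq power_Suc2 del: power_Suc)
  then have base: "insert_letter b n t 0 c = x"
    unfolding insert_letter_def k_def[symmetric] cdiv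
    using div_mult_mod_eq[of x "b ^ k"] by (simp add: mult.assoc)
  show ?thesis
  proof (rule that[OF c])
    show "word b n (d(t := a)) = insert_letter b n t a c" for a
      unfolding insert_letter_0[of b n t a c] word_update[OF t, of b d a] base x_def ..
  qed
qed

text \<open>Columns of the matrix form correspond to the letters outside position \<open>t\<close>.
  Phrased with updates at \<open>t\<close>, independence of rows becomes a statement about entries
  at words, to which multilinearity applies.\<close>

lemma lin_indpt_rows_iff:
  assumes t: "t \<in> {1..n}" and u: "u < b" and v: "v < b"
  shows "lin_indpt_pair (Matrix.row (matrix_form b n t V) u) (Matrix.row (matrix_form b n t V) v) \<longleftrightarrow>
    (\<forall>p q. (\<forall>d. (\<forall>s\<in>{1..n}. d s < b) \<longrightarrow>
        p * V $ word b n (d(t := u)) + q * V $ word b n (d(t := v)) = 0) \<longrightarrow> p = 0 \<and> q = 0)"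
proof -
  let ?r = "\<lambda>u. Matrix.row (matrix_form b n t V) u"
  have dim: "dim_row (matrix_form b n t V) = b" "dim_col (matrix_form b n t V) = b ^ (n - 1)"
    by (simp_all add: matrix_form_def)
  have entry: "matrix_form b n t V $$ (a, c) = V $ insert_letter b n t a c"
    if "a < b" "c < b ^ (n - 1)" for a c
    using that by (simp add: matrix_form_def insert_letter_def)
  have "p \<cdot>\<^sub>v ?r u + q \<cdot>\<^sub>v ?r v = 0\<^sub>v (dim_vec (?r u)) \<longleftrightarrow>
      (\<forall>d. (\<forall>s\<in>{1..n}. d s < b) \<longrightarrow>
        p * V $ word b n (d(t := u)) + q * V $ word b n (d(t := v)) = 0)" (is "?L \<longleftrightarrow> ?R") for p q
  proof -
    have "?L \<longleftrightarrow> (\<forall>c<b ^ (n - 1). p * V $ insert_letter b n t u c + q * V $ insert_letter b n t v c = 0)"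
      unfolding vec_eq_iff using u v by (auto simp: dim entry simp del: One_nat_def)
    also have "\<dots> \<longleftrightarrow> ?R"
    proof (intro iffI allI impI)
      fix d assume *: "\<forall>c<b ^ (n - 1). p * V $ insert_letter b n t u c + q * V $ insert_letter b n t v c = 0"
        and "\<forall>s\<in>{1..n}. d s < b"
      then obtain c where "c < b ^ (n - 1)" "\<And>a. word b n (d(t := a)) = insert_letter b n t a c"
        using word_is_insert_letter[OF t, of d b] by blast
      then show "p * V $ word b n (d(t := u)) + q * V $ word b n (d(t := v)) = 0" using * by simp
    next
      fix c assume *: ?R and "c < b ^ (n - 1)"
      then obtain d where "\<And>s. d s < b" "\<And>a. insert_letter b n t a c = word b n (d(t := a))"
        using insert_letter_is_word[OF t, of c b] u by (metis gr_zeroI not_less_zero)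
      then show "p * V $ insert_letter b n t u c + q * V $ insert_letter b n t v c = 0" using * by simp
    qed
    finally show ?thesis .
  qed
  then show ?thesis unfolding lin_indpt_pair_def by simp
qed

text \<open>Independent rows force a nonzero minor of order two. Its two columns are independent,
  and two-dimensional vectors admit no larger independent set.\<close>

lemma mat_rank_two_rows:
  assumes A: "A \<in> carrier_mat 2 N" and ind: "lin_indpt_pair (Matrix.row A 0) (Matrix.row A 1)"
  shows "mat_rank A = 2"
proof -
  interpret vec_space "TYPE(complex)" 2 .
  have "\<exists>j<N. \<exists>k<N. A $$ (0, j) * A $$ (1, k) \<noteq> A $$ (0, k) * A $$ (1, j)"
  proof (rule ccontr)
    assume "\<not> ?thesis"
    then have minor: "A $$ (0, j) * A $$ (1, k) = A $$ (0, k) * A $$ (1, j)" if "j < N" "k < N" for j k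
      using that by blast
    have rel: "a = 0 \<and> b = 0" if "\<And>k. k < N \<Longrightarrow> a * A $$ (0, k) + b * A $$ (1, k) = 0" for a b
    proof -
      have "a \<cdot>\<^sub>v Matrix.row A 0 + b \<cdot>\<^sub>v Matrix.row A 1 = 0\<^sub>v (dim_vec (Matrix.row A 0))"
        using A that by (intro eq_vecI) auto
      then show ?thesis using ind unfolding lin_indpt_pair_def by blast
    qed
    \<comment> \<open>If all minors vanish, the entries of column \<open>j\<close>, exchanged and
      one of them negated, are the coefficients of a relation between the rows, so the column is
      zero.\<close>
    have "A $$ (1, j) = 0 \<and> - A $$ (0, j) = 0" if "j < N" for j
      by (rule rel) (use minor[OF that] in \<open>auto simp: algebra_simps\<close>)
    then show False using rel[of 1 0] by simp
  qed
  then obtain j k where jk: "j < N" "k < N" "A $$ (0, j) * A $$ (1, k) \<noteq> A $$ (0, k) * A $$ (1, j)" by blast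
  define B where "B = mat_of_cols 2 [col A j, col A k]"
  have B: "B \<in> carrier_mat 2 2" using mat_of_cols_carrier(1)[of 2 "[col A j, col A k]"]
    by (simp add: B_def numeral_2_eq_2)
  have "set [col A j, col A k] \<subseteq> carrier_vec 2"
    using col_dim[of A j] col_dim[of A k] unfolding carrier_matD(1)[OF A] by simp
  then have cols: "cols B = [col A j, col A k]" unfolding B_def by (rule cols_mat_of_cols)
  have entries: "col A j $ i = A $$ (i, j)" "col A k $ i = A $$ (i, k)" if "i < 2" for i
    using that jk A by simp_all
  have "col A j \<noteq> col A k"
  proof
    assume "col A j = col A k"
    then have "A $$ (0, j) = A $$ (0, k)" "A $$ (1, j) = A $$ (1, k)"
      using entries[of 0] entries[of 1] by simp_all
    then show False using jk(3) by simp
  qed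
  then have dist: "distinct (cols B)" unfolding cols by simp
  have "lin_indpt (set (cols B))"
  proof
    assume "lin_dep (set (cols B))"
    then obtain v where v: "v \<in> carrier_vec 2" "v \<noteq> 0\<^sub>v 2" "B *\<^sub>v v = 0\<^sub>v 2"
      using lin_depE[OF B _ dist] by blast
    have Bij: "B $$ (i, 0) = A $$ (i, j)" "B $$ (i, 1) = A $$ (i, k)" if "i < 2" for i
      using entries[OF that] that by (simp_all add: B_def mat_of_cols_def)
    have eq: "A $$ (i, j) * v $ 0 + A $$ (i, k) * v $ 1 = 0" if "i < 2" for i
    proof -
      have "(B *\<^sub>v v) $ i = (\<Sum>c<2. B $$ (i, c) * v $ c)"
        using that B v(1) by (simp add: scalar_prod_def lessThan_atLeast0)
      also have "\<dots> = A $$ (i, j) * v $ 0 + A $$ (i, k) * v $ 1"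
        using Bij[OF that] by (simp add: numeral_2_eq_2)
      finally show ?thesis using that v(3) by simp
    qed
    let ?D = "A $$ (0, j) * A $$ (1, k) - A $$ (0, k) * A $$ (1, j)"
    \<comment> \<open>Cramer's rule: the minor times a coordinate of \<open>v\<close> is a
      combination of the two equations.\<close>
    have "?D * v $ 0 = A $$ (1, k) * (A $$ (0, j) * v $ 0 + A $$ (0, k) * v $ 1)
        - A $$ (0, k) * (A $$ (1, j) * v $ 0 + A $$ (1, k) * v $ 1)"
      "?D * v $ 1 = A $$ (0, j) * (A $$ (1, j) * v $ 0 + A $$ (1, k) * v $ 1)
        - A $$ (1, j) * (A $$ (0, j) * v $ 0 + A $$ (0, k) * v $ 1)"
      by (simp_all add: algebra_simps)
    then have "?D * v $ 0 = 0" "?D * v $ 1 = 0" using eq[of 0] eq[of 1] by simp_all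
    then have "v $ 0 = 0" "v $ 1 = 0" using jk(3) by simp_all
    then have "v = 0\<^sub>v 2" using v(1) by (intro eq_vecI) (auto simp: less_2_cases_iff)
    then show False using v(2) by blast
  qed
  moreover have "set (cols B) \<subseteq> set (cols A)" unfolding cols using jk A by (auto simp: cols_def)
  ultimately have "card (set (cols B)) \<le> rank A" by (intro rank_ge_card_indpt[OF A])
  moreover have "card (set (cols B)) = 2" using distinct_card[OF dist] B by simp
  moreover have "rank A \<le> 2"
  proof -
    obtain S where "maximal S (\<lambda>T. T \<subseteq> set (cols A) \<and> lin_indpt T)"
      using maximal_exists_superset[of "set (cols A)" "\<lambda>T. T \<subseteq> set (cols A) \<and> lin_indpt T" "set (cols B)"]
        \<open>lin_indpt (set (cols B))\<close> \<open>set (cols B) \<subseteq> set (cols A)\<close> by blast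
    then have S: "rank A = card S" "S \<subseteq> set (cols A)" "lin_indpt S"
      using rank_card_indpt[OF A] by (auto simp: maximal_def)
    moreover have "S \<subseteq> carrier_vec 2" using S(2) cols_dim[of A] A by auto
    ultimately show ?thesis using li_le_dim(2)[OF fin_dim] dim_is_n by simp
  qed
  ultimately show ?thesis using A by simp
qed

text \<open>Vectors of dimension two are functions on \<open>bool\<close>, with \<open>True\<close> for the index 1, so that there are no
  junk coordinates.\<close>

definition multilinear_form :: "nat \<Rightarrow> complex Matrix.vec \<Rightarrow> (nat \<Rightarrow> bool \<Rightarrow> complex) \<Rightarrow> complex" where
  "multilinear_form n G v = (\<Sum>y<2 ^ n. (\<Prod>s = 1..n. v s (digit 2 n s y = 1)) * G $ y)"

lemma multilinear_form_cong:
  "(\<And>s. s \<in> {1..n} \<Longrightarrow> v s = w s) \<Longrightarrow> multilinear_form n G v = multilinear_form n G w"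
  unfolding multilinear_form_def by (intro sum.cong prod.cong arg_cong2[of _ _ _ _ "(*)"] refl) simp

lemma prod_update_linear:
  fixes p q :: complex and t n :: nat
  assumes "t \<in> {1..n}"
  shows "(\<Prod>s = 1..n. (f(t := p * a + q * b)) s)
    = p * (\<Prod>s = 1..n. (f(t := a)) s) + q * (\<Prod>s = 1..n. (f(t := b)) s)"
proof -
  have "(\<Prod>s = 1..n. (f(t := c)) s) = c * (\<Prod>s\<in>{1..n} - {t}. f s)" for c
  proof -
    have "(\<Prod>s = 1..n. (f(t := c)) s) = (f(t := c)) t * (\<Prod>s\<in>{1..n} - {t}. (f(t := c)) s)"
      by (rule prod.remove) (use assms in auto)
    also have "(\<Prod>s\<in>{1..n} - {t}. (f(t := c)) s) = (\<Prod>s\<in>{1..n} - {t}. f s)"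
      by (intro prod.cong refl) auto
    finally show ?thesis by simp
  qed
  then show ?thesis by (simp add: algebra_simps)
qed

lemma multilinear_form_update:
  assumes "t \<in> {1..n}"
  shows "multilinear_form n G (v(t := \<lambda>i. p * a i + q * b i))
    = p * multilinear_form n G (v(t := a)) + q * multilinear_form n G (v(t := b))"
proof -
  have "(\<Prod>s = 1..n. (v(t := \<lambda>i. p * a i + q * b i)) s (digit 2 n s y = 1))
      = p * (\<Prod>s = 1..n. (v(t := a)) s (digit 2 n s y = 1))
        + q * (\<Prod>s = 1..n. (v(t := b)) s (digit 2 n s y = 1))" for y
  proof -
    have upd: "(v(t := w)) s (digit 2 n s y = 1)
        = ((\<lambda>s. v s (digit 2 n s y = 1))(t := w (digit 2 n t y = 1))) s" for w s
      by simp
    show ?thesis unfolding upd by (rule prod_update_linear[OF assms])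
  qed
  then show ?thesis
    unfolding multilinear_form_def by (simp add: sum.distrib sum_distrib_left algebra_simps)
qed

lemma multilinear_form_zero:
  assumes "t \<in> {1..n}" "v t = (\<lambda>_. 0)"
  shows "multilinear_form n G v = 0"
proof -
  have "v = v(t := \<lambda>i. 0 * v t i + 0 * v t i)" using assms(2) by (simp add: fun_eq_iff)
  then show ?thesis using multilinear_form_update[OF assms(1), of G v 0 "v t" 0 "v t"] by simp
qed

text \<open>Recovers the tensor from its form, so that a factorisation of the form yields one of the
  tensor.\<close>

lemma multilinear_form_unit:
  assumes "x < 2 ^ n"
  shows "multilinear_form n G (\<lambda>s i. if i = (digit 2 n s x = 1) then 1 else 0) = G $ x"
proof -
  have "(\<Prod>s = 1..n. if (digit 2 n s y = 1) = (digit 2 n s x = 1) then 1 else 0) = (if y = x then 1 else 0 :: complex)"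
    if y: "y < 2 ^ n" for y
  proof (cases "y = x")
    case False
    then obtain s where s: "s \<in> {1..n}" "digit 2 n s y \<noteq> digit 2 n s x"
      using digit_eq_imp_eq[OF y assms] by blast
    have "digit 2 n s y < 2" "digit 2 n s x < 2" by (simp_all add: digit_less)
    then have "(digit 2 n s y = 1) \<noteq> (digit 2 n s x = 1)" using s(2) by auto
    then show ?thesis using s(1) False by (auto intro!: prod_zero bexI[of _ s])
  qed simp
  then have "multilinear_form n G (\<lambda>s i. if i = (digit 2 n s x = 1) then 1 else 0)
      = (\<Sum>y<2 ^ n. if y = x then G $ y else 0)"
    unfolding multilinear_form_def by (intro sum.cong refl) auto
  then show ?thesis using assms by simp
qed

text \<open>Each entry of the transformed tensor is a value of the form of \<open>G\<close> at rows
  of \<open>A\<close>, the letters of \<open>x\<close> selecting the row for each slot. Entries of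
  \<open>uG\<close> and of the transformed tensor thus become values of one and the same
  form.\<close>

lemma tensor_power_mult_vec:
  assumes A: "A \<in> carrier_mat r 2" and G: "G \<in> carrier_vec (2 ^ n)" and x: "x < r ^ n"
  shows "(tensor_power n A *\<^sub>v G) $ x
    = multilinear_form n G (\<lambda>s i. A $$ (digit r n s x, of_bool i))"
proof -
  have bool: "of_bool (digit 2 n s y = 1) = digit 2 n s y" for s y
    using digit_less[of 2 n s y] by (cases "digit 2 n s y") auto
  have "(tensor_power n A *\<^sub>v G) $ x = (\<Sum>y<2 ^ n. tensor_power n A $$ (x, y) * G $ y)"
    using A G x by (simp add: tensor_power_def scalar_prod_def lessThan_atLeast0)
  also have "\<dots> = (\<Sum>y<2 ^ n. (\<Prod>s = 1..n. A $$ (digit r n s x, digit 2 n s y)) * G $ y)"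
    using A x by (intro sum.cong refl) (simp add: tensor_power_def)
  finally show ?thesis unfolding multilinear_form_def bool .
qed

text \<open>Induction on the number \<open>k\<close> of initial slots that are still arbitrary, all
  later ones holding one of the two spanning vectors: the last arbitrary slot is expanded in these
  vectors.\<close>

lemma span_induct_slots:
  fixes P :: "(nat \<Rightarrow> bool \<Rightarrow> complex) \<Rightarrow> bool"
  assumes lin: "\<And>t v a b p q. \<lbrakk>t \<in> {1..n}; P (v(t := a)); P (v(t := b))\<rbrakk> \<Longrightarrow> P (v(t := \<lambda>i. p * a i + q * b i))"
    and base: "\<And>v. (\<And>s. s \<in> {1..n} \<Longrightarrow> v s = basea \<or> v s = baseb) \<Longrightarrow> P v"
    and span: "\<And>u. \<exists>p q. u = (\<lambda>i. p * basea i + q * baseb i)"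
  shows "P v"
proof -
  have "P v" if "k \<le> n" "\<And>s. s \<in> {k<..n} \<Longrightarrow> v s = basea \<or> v s = baseb" for k v
    using that
  proof (induction k arbitrary: v)
    case 0
    show ?case by (rule base) (use 0 in auto)
  next
    case (Suc k)
    obtain p q where pq: "v (Suc k) = (\<lambda>i. p * basea i + q * baseb i)" using span by blast
    have "P (v(Suc k := basea))" "P (v(Suc k := baseb))"
    proof -
      have "(v(Suc k := w)) s = basea \<or> (v(Suc k := w)) s = baseb" if "s \<in> {k<..n}" "w = basea \<or> w = baseb" for s w
        using Suc.prems(2)[of s] that by (cases "s = Suc k") auto
      then show "P (v(Suc k := basea))" "P (v(Suc k := baseb))"
        using Suc.prems(1) Suc.IH by (metis Suc_leD)+
    qed
    then have "P (v(Suc k := \<lambda>i. p * basea i + q * baseb i))" using Suc.prems(1) by (intro lin) auto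
    then show ?case unfolding pq[symmetric] by simp
  qed
  from this[of n v] show ?thesis by simp
qed

text \<open>Together with \<open>coord1\<close> this gives the coordinates of \<open>u\<close> in
  the basis \<open>a\<close>, \<open>b\<close> by Cramer's rule; being explicit, they are visibly
  linear in \<open>u\<close>.\<close>

definition coord0 :: "(bool \<Rightarrow> complex) \<Rightarrow> (bool \<Rightarrow> complex) \<Rightarrow> (bool \<Rightarrow> complex) \<Rightarrow> complex" where
  "coord0 a b u = (u False * b True - u True * b False) / (a False * b True - a True * b False)"

definition coord1 :: "(bool \<Rightarrow> complex) \<Rightarrow> (bool \<Rightarrow> complex) \<Rightarrow> (bool \<Rightarrow> complex) \<Rightarrow> complex" where
  "coord1 a b u = (a False * u True - a True * u False) / (a False * b True - a True * b False)"

context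
  fixes a b :: "bool \<Rightarrow> complex"
  assumes indpt: "\<And>p q. (\<And>i. p * a i + q * b i = 0) \<Longrightarrow> p = 0 \<and> q = 0"
begin

lemma indpt_det: "a False * b True - a True * b False \<noteq> 0"
proof
  assume D: "a False * b True - a True * b False = 0"
  have "b False = 0 \<and> - a False = 0"
  proof (rule indpt)
    show "b False * a i + - a False * b i = 0" for i
      using D by (cases i) (auto simp: algebra_simps)
  qed
  moreover have "b True = 0 \<and> - a True = 0"
  proof (rule indpt)
    show "b True * a i + - a True * b i = 0" for i
      using D by (cases i) (auto simp: algebra_simps)
  qed
  ultimately have "1 * a i + 0 * b i = 0" for i by (cases i) auto
  then show False using indpt[of 1 0] by simp
qed

lemma coord_expansion: "u = (\<lambda>i. coord0 a b u * a i + coord1 a b u * b i)"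
proof
  fix i
  let ?D = "a False * b True - a True * b False"
  have "?D * u i = (u False * b True - u True * b False) * a i + (a False * u True - a True * u False) * b i"
    by (cases i) (simp_all add: algebra_simps)
  then show "u i = coord0 a b u * a i + coord1 a b u * b i"
    using indpt_det by (simp add: coord0_def coord1_def divide_simps mult.commute)
qed

lemma coord_basis: "coord0 a b a = 1" "coord1 a b a = 0" "coord0 a b b = 0" "coord1 a b b = 1"
  using indpt_det by (simp_all add: coord0_def coord1_def algebra_simps)

lemma coord_linear:
  "coord0 a b (\<lambda>i. p * u i + q * w i) = p * coord0 a b u + q * coord0 a b w"
  "coord1 a b (\<lambda>i. p * u i + q * w i) = p * coord1 a b u + q * coord1 a b w"
  by (simp_all add: coord0_def coord1_def algebra_simps flip: add_divide_distrib diff_divide_distrib)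

text \<open>Exchanging one letter at a time with a fixed word at which the tensor does not vanish shows that
  the tensor is of rank one in the basis \<open>a\<close>, \<open>b\<close>; by multilinearity it is so in the standard basis.\<close>

lemma degenerate_if_exchange:
  assumes n: "1 \<le> n" and G: "G \<in> carrier_vec (2 ^ n)"
  defines "g \<equiv> \<lambda>e. multilinear_form n G (\<lambda>s. if e s then b else a)"
  assumes exchange: "\<And>e e' s. s \<in> {1..n} \<Longrightarrow> g e * g e' = g (e(s := e' s)) * g (e'(s := e s))"
  shows "degenerate 2 n G"
proof -
  have g_cong: "g e = g e'" if "\<And>s. s \<in> {1..n} \<Longrightarrow> e s = e' s" for e e'
    unfolding g_def by (rule multilinear_form_cong) (simp add: that)
  obtain K c where c: "\<And>e. g e = K * (\<Prod>s = 1..n. c s (e s))"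
  proof (cases "\<forall>e. g e = 0")
    case True
    then show thesis using that[of 0] by simp
  next
    case False
    then obtain e0 where e0: "g e0 \<noteq> 0" by blast
    define c where "c = (\<lambda>s i. g (e0(s := i)) / g e0)"
    have part: "k \<le> n \<Longrightarrow> g (\<lambda>s. if s \<in> {1..k} then e s else e0 s) = g e0 * (\<Prod>s = 1..k. c s (e s))" for k e
    proof (induction k)
      case (Suc k)
      \<comment> \<open>The second word is chosen such that the exchange at \<open>Suc k\<close>
        turns it back into \<open>e0\<close>, whose value is nonzero and can be divided out.\<close>
      let ?e = "\<lambda>k s. if s \<in> {1..k} then e s else e0 s" and ?e' = "e0(Suc k := e (Suc k))"
      have "(?e k)(Suc k := ?e' (Suc k)) = ?e (Suc k)" "?e'(Suc k := ?e k (Suc k)) = e0"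
        by (auto simp: fun_eq_iff le_Suc_eq)
      then have "g (?e k) * g ?e' = g (?e (Suc k)) * g e0"
        using exchange[of "Suc k" "?e k" ?e'] Suc.prems by simp
      then have "g (?e (Suc k)) = g (?e k) * c (Suc k) (e (Suc k))"
        using e0 by (simp add: c_def field_simps)
      then show ?case using Suc by simp
    qed (simp add: c_def)
    have "g e = g e0 * (\<Prod>s = 1..n. c s (e s))" for e
      using part[of n e] g_cong[of "\<lambda>s. if s \<in> {1..n} then e s else e0 s" e] by simp
    then show thesis using that by blast
  qed
  \<comment> \<open>The linear functional with values \<open>c s False\<close> at \<open>a\<close>
    and \<open>c s True\<close> at \<open>b\<close>. A product of functionals, one per slot, is the
    form of a rank one tensor.\<close>
  define \<Lambda> where "\<Lambda> s u = coord0 a b u * c s False + coord1 a b u * c s True" for s u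
  have \<Lambda>: "multilinear_form n G v = K * (\<Prod>s = 1..n. \<Lambda> s (v s))" for v
  proof (rule span_induct_slots[where basea = a and baseb = b and n = n
        and P = "\<lambda>v. multilinear_form n G v = K * (\<Prod>s = 1..n. \<Lambda> s (v s))"])
    fix t v u w p q
    assume t: "t \<in> {1..n}"
      and u: "multilinear_form n G (v(t := u)) = K * (\<Prod>s = 1..n. \<Lambda> s ((v(t := u)) s))"
      and w: "multilinear_form n G (v(t := w)) = K * (\<Prod>s = 1..n. \<Lambda> s ((v(t := w)) s))"
    have upd: "\<Lambda> s ((v(t := x)) s) = ((\<lambda>s. \<Lambda> s (v s))(t := \<Lambda> t x)) s" for s x by simp
    have lin: "\<Lambda> t (\<lambda>i. p * u i + q * w i) = p * \<Lambda> t u + q * \<Lambda> t w"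
      by (simp add: \<Lambda>_def coord_linear algebra_simps)
    show "multilinear_form n G (v(t := \<lambda>i. p * u i + q * w i))
        = K * (\<Prod>s = 1..n. \<Lambda> s ((v(t := \<lambda>i. p * u i + q * w i)) s))"
      unfolding multilinear_form_update[OF t] u w upd lin prod_update_linear[OF t]
      by (simp add: algebra_simps)
  next
    fix v assume v: "\<And>s. s \<in> {1..n} \<Longrightarrow> v s = a \<or> v s = b"
    have ne: "a \<noteq> b" using indpt_det by auto
    have basis: "\<Lambda> s a = c s False" "\<Lambda> s b = c s True" for s
      by (simp_all add: \<Lambda>_def coord_basis)
    have "multilinear_form n G v = g (\<lambda>s. v s = b)"
      unfolding g_def by (rule multilinear_form_cong) (use v in auto)
    also have "\<dots> = K * (\<Prod>s = 1..n. c s (v s = b))" by (rule c)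
    also have "(\<Prod>s = 1..n. c s (v s = b)) = (\<Prod>s = 1..n. \<Lambda> s (v s))"
    proof (rule prod.cong[OF refl])
      fix s assume "s \<in> {1..n}"
      then show "c s (v s = b) = \<Lambda> s (v s)" using v[of s] ne basis by metis
    qed
    finally show "multilinear_form n G v = K * (\<Prod>s = 1..n. \<Lambda> s (v s))" .
  next
    show "\<exists>p q. u = (\<lambda>i. p * a i + q * b i)" for u using coord_expansion by blast
  qed
  \<comment> \<open>The factors are the values of the functionals at the unit vectors; the scalar
    \<open>K\<close> is absorbed by factor 1, which exists since \<open>n\<close> is
    positive.\<close>
  define \<gamma> where "\<gamma> s = Matrix.vec 2 (\<lambda>j. (if s = 1 then K else 1) * \<Lambda> s (\<lambda>i. if i = (j = 1) then 1 else 0))" for s :: nat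
  have "G = tensor_vecs 2 n \<gamma>"
  proof (rule eq_vecI)
    fix x assume "x < dim_vec (tensor_vecs 2 n \<gamma>)"
    then have x: "x < 2 ^ n" by (simp add: tensor_vecs_def)
    have "G $ x = K * (\<Prod>s = 1..n. \<Lambda> s (\<lambda>i. if i = (digit 2 n s x = 1) then 1 else 0))"
      using multilinear_form_unit[OF x, of G] \<Lambda> by simp
    also have "K = (\<Prod>s = 1..n. if s = 1 then K else 1)" using n by (simp add: prod.delta)
    also have "(\<Prod>s = 1..n. if s = 1 then K else 1) * (\<Prod>s = 1..n. \<Lambda> s (\<lambda>i. if i = (digit 2 n s x = 1) then 1 else 0))
        = (\<Prod>s = 1..n. \<gamma> s $ digit 2 n s x)"
      unfolding prod.distrib[symmetric]
      by (intro prod.cong refl) (simp add: \<gamma>_def digit_less)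
    finally show "G $ x = tensor_vecs 2 n \<gamma> $ x" using x by (simp add: tensor_vecs_def)
  qed (use G in \<open>simp add: tensor_vecs_def\<close>)
  then show ?thesis unfolding degenerate_def by (intro exI[of _ \<gamma>]) (simp add: \<gamma>_def)
qed

end

section \<open>Closest pairs of rows\<close>

text \<open>The 0-based output positions at which the word with blocks \<open>D 1, \<dots>, D n\<close> has a one. Position \<open>k\<close>
  lies in block \<open>k div l + 1\<close>, and the bits of a block are numbered from its right end.\<close>

definition ones :: "nat \<Rightarrow> nat \<Rightarrow> (nat \<Rightarrow> nat) \<Rightarrow> nat set" where
  "ones l n D = {k. k < n * l \<and> bit (D (k div l + 1)) (l - 1 - k mod l)}"

lemma digit_2_eq_1_iff: "digit 2 m j x = 1 \<longleftrightarrow> bit x (m - j)"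
  by (simp add: digit_def bit_iff_odd odd_iff_mod_2_eq_one)

lemma digit_power_2: "digit (2 ^ l) n s x = take_bit l (drop_bit (l * (n - s)) x)"
  by (simp add: digit_def take_bit_eq_mod drop_bit_eq_div power_mult)

lemma block_less: "(k::nat) < n * l \<Longrightarrow> k div l + 1 \<in> {1..n}"
  by (simp add: Suc_le_eq less_mult_imp_div_less)

text \<open>Outputs are numbered from the left and bits from the right: position
  \<open>q * l + r\<close> is bit \<open>l - 1 - r\<close> of block \<open>q + 1\<close>, and bit
  \<open>l * (n - (q + 1)) + (l - 1 - r)\<close> of the whole word.\<close>

lemma removed_positions_word:
  assumes D: "\<And>s. s \<in> {1..n} \<Longrightarrow> D s < 2 ^ l"
  shows "{k. k < n * l \<and> digit 2 (n * l) (Suc k) (word (2 ^ l) n D) = 1} = ones l n D"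
proof -
  have "bit (word (2 ^ l) n D) (n * l - Suc k) \<longleftrightarrow> bit (D (k div l + 1)) (l - 1 - k mod l)"
    if k: "k < n * l" for k
  proof -
    define q r where "q = k div l" and "r = k mod l"
    have l: "0 < l" using k by (cases l) auto
    have kqr: "k = q * l + r" and r: "r < l" and q: "q < n"
      using l k by (simp_all add: q_def r_def less_mult_imp_div_less)
    have "D (q + 1) = digit (2 ^ l) n (q + 1) (word (2 ^ l) n D)"
      using digit_word[of n D "2 ^ l" "q + 1"] D q by simp
    then have "bit (D (q + 1)) (l - 1 - r) \<longleftrightarrow> bit (word (2 ^ l) n D) (l * (n - (q + 1)) + (l - 1 - r))"
      using r by (simp add: digit_power_2 bit_take_bit_iff bit_drop_bit_eq)
    moreover have "n * l - Suc k = l * (n - (q + 1)) + (l - 1 - r)"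
    proof -
      obtain p where p: "n = q + 1 + p" using q by (metis Suc_eq_plus1 add.commute less_iff_Suc_add add_Suc_right)
      obtain z where z: "l = r + 1 + z" using r by (metis Suc_eq_plus1 less_iff_Suc_add add_Suc)
      have "n * l = Suc k + (l * p + z)" unfolding kqr p by (simp add: algebra_simps) (simp add: z)
      then show ?thesis by (simp add: p z)
    qed
    ultimately show ?thesis by (simp add: q_def r_def)
  qed
  then show ?thesis unfolding digit_2_eq_1_iff ones_def by blast
qed

text \<open>Links the identities, which toggle output positions, with the blocks: a toggle is a bit
  flip in the one block that contains the position.\<close>

lemma toggle_ones:
  assumes k: "k < n * l"
  shows "toggle k (ones l n D)
    = ones l n (D(k div l + 1 := flip_bit (l - 1 - k mod l) (D (k div l + 1))))"
proof -
  let ?D = "D(k div l + 1 := flip_bit (l - 1 - k mod l) (D (k div l + 1)))"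
  have l: "0 < l" using k by (cases l) auto
  have "k' \<in> toggle k (ones l n D) \<longleftrightarrow> k' \<in> ones l n ?D" for k'
  proof (cases "k' < n * l \<and> k' div l = k div l")
    case True
    have "l - 1 - k mod l = l - 1 - k' mod l \<longleftrightarrow> k' mod l = k mod l"
      using mod_less_divisor[OF l, of k] mod_less_divisor[OF l, of k'] by linarith
    also have "\<dots> \<longleftrightarrow> k' = k" using True by (metis div_mult_mod_eq)
    finally show ?thesis
      using True by (auto simp: in_toggle_iff ones_def bit_flip_bit_iff)
  next
    case False
    then show ?thesis using k by (auto simp: in_toggle_iff ones_def)
  qed
  then show ?thesis by blast
qed

lemma hamming_weight_xor: "hamming_weight (Bit_Operations.xor x y) = card {i. bit x i \<noteq> bit y i}"
  by (simp add: hamming_weight_def bit_xor_iff)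

lemma bit_less_exp:
  fixes x :: nat
  assumes "x < 2 ^ l" "bit x i"
  shows "i < l"
proof -
  have "bit x i = bit (take_bit l x) i" by (simp only: take_bit_nat_eq_self[OF assms(1)])
  then show ?thesis using assms(2) by (simp add: bit_take_bit_iff)
qed

lemma flip_bit_less:
  fixes x :: nat
  assumes "x < 2 ^ l" "i < l"
  shows "flip_bit i x < 2 ^ l"
proof -
  have "take_bit l (flip_bit i x) = flip_bit i x"
  proof (rule bit_eqI)
    show "bit (take_bit l (flip_bit i x)) m = bit (flip_bit i x) m" for m
      using bit_less_exp[OF assms(1), of m] assms(2)
      by (cases "m < l") (auto simp: bit_take_bit_iff bit_flip_bit_iff)
  qed
  then show ?thesis using take_bit_nat_less_exp[of l "flip_bit i x"] by simp
qed

text \<open>Only the consequence of minimality for the matchgate is kept: by \<open>vanish\<close>,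
  a word has value zero if one of its blocks is different from \<sigma> and \<tau> and closer to
  both than they are to each other. Matrices and ranks do not occur here.\<close>

locale closest_pair =
  fixes H :: matchgate and n l :: nat and \<sigma> \<tau> :: nat
  assumes gen: "generator_matchgate H" and len: "length (outputs H) = n * l"
    and \<sigma>: "\<sigma> < 2 ^ l" and \<tau>: "\<tau> < 2 ^ l"
    and vanish: "\<And>D s. \<lbrakk>s \<in> {1..n}; \<And>r. r \<in> {1..n} \<Longrightarrow> D r < 2 ^ l; D s \<noteq> \<sigma>; D s \<noteq> \<tau>;
        card {i. bit \<sigma> i \<noteq> bit (D s) i} < card {i. bit \<sigma> i \<noteq> bit \<tau> i};
        card {i. bit \<tau> i \<noteq> bit (D s) i} < card {i. bit \<sigma> i \<noteq> bit \<tau> i}\<rbrakk>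
      \<Longrightarrow> matching_sum H (ones l n D) = 0"
begin

definition \<Delta> :: "nat set" where "\<Delta> = {i. bit \<sigma> i \<noteq> bit \<tau> i}"

text \<open>The entry of the transformed tensor at the bit string \<open>e\<close>, where
  \<open>True\<close> selects the row \<tau>, expressed by the given matchgate.\<close>

definition val :: "(nat \<Rightarrow> bool) \<Rightarrow> complex" where
  "val e = matching_sum H (ones l n (\<lambda>s. if e s then \<tau> else \<sigma>))"

lemma \<Delta>_less: "i \<in> \<Delta> \<Longrightarrow> i < l"
  using bit_less_exp[OF \<sigma>, of i] bit_less_exp[OF \<tau>, of i] by (auto simp: \<Delta>_def)

lemma finite_\<Delta>: "finite \<Delta>"
  using \<Delta>_less by (meson finite_nat_set_iff_bounded)

text \<open>Flipping a nonempty proper subset \<open>S\<close> of the differing bits in one word of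
  the pair gives a word at distance \<open>card S\<close> from it and
  \<open>card (\<Delta> - S)\<close> from the other, both positive and below
  \<open>card \<Delta>\<close>.\<close>

lemma vanish_flips:
  assumes S: "S \<subseteq> \<Delta>" "S \<noteq> {}" "S \<noteq> \<Delta>" and s: "s \<in> {1..n}" and D: "\<And>r. r \<in> {1..n} \<Longrightarrow> D r < 2 ^ l"
    and w: "w = \<sigma> \<or> w = \<tau>" and Ds: "\<And>i. bit (D s) i \<longleftrightarrow> bit w i \<noteq> (i \<in> S)"
  shows "matching_sum H (ones l n D) = 0"
proof -
  have "{i. bit w i \<noteq> bit (D s) i} = S" using Ds by auto
  moreover have "{i. bit w' i \<noteq> bit (D s) i} = \<Delta> - S" if "w' = \<sigma> \<or> w' = \<tau>" "w' \<noteq> w" for w'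
    using Ds w that S(1) by (auto simp: \<Delta>_def)
  ultimately have sets: "{i. bit \<sigma> i \<noteq> bit (D s) i} \<in> {S, \<Delta> - S}" "{i. bit \<tau> i \<noteq> bit (D s) i} \<in> {S, \<Delta> - S}"
    using w by blast+
  have "S \<subset> \<Delta>" "\<Delta> - S \<subset> \<Delta>" "S \<noteq> {}" "\<Delta> - S \<noteq> {}" using S by auto
  then have "X \<noteq> {} \<and> card X < card \<Delta>" if "X \<in> {S, \<Delta> - S}" for X
    using that psubset_card_mono[OF finite_\<Delta>] by auto
  note X = this[OF sets(1)] this[OF sets(2)]
  show ?thesis
  proof (rule vanish[OF s D])
    show "D s \<noteq> \<sigma>" "D s \<noteq> \<tau>" using X by auto
  qed (use X in \<open>auto simp: \<Delta>_def\<close>)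
qed

definition pos :: "nat \<Rightarrow> nat \<Rightarrow> nat" where "pos s i = (s - 1) * l + (l - 1 - i)"

lemma pos:
  assumes "s \<in> {1..n}" "i < l"
  shows "pos s i < n * l" "pos s i div l + 1 = s" "l - 1 - pos s i mod l = i"
proof -
  have r: "l - 1 - i < l" using assms(2) by simp
  have "pos s i < (s - 1) * l + l" using r by (simp add: pos_def)
  also have "\<dots> = s * l" using assms(1) by (cases s) auto
  also have "\<dots> \<le> n * l" using assms(1) by simp
  finally show "pos s i < n * l" .
  define c where "c = l - 1 - i"
  have "pos s i = (s - 1) * l + c" "c < l" "l - 1 - c = i" using r assms(2) by (simp_all add: pos_def c_def)
  then show "pos s i div l + 1 = s" "l - 1 - pos s i mod l = i" using assms(1) by simp_all
qed

lemma pos_block: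
  assumes "k div l + 1 = s" "0 < l"
  shows "k = pos s (l - 1 - k mod l)"
proof -
  have "k mod l < l" using assms(2) by simp
  then have "l - 1 - (l - 1 - k mod l) = k mod l" by simp
  then show ?thesis using div_mult_mod_eq[of k l] assms(1) by (auto simp: pos_def)
qed

text \<open>The positions at which the words of \<open>e\<close> and \<open>e'\<close> differ.
  Altering both words at one common position does not change this set.\<close>

definition T :: "(nat \<Rightarrow> bool) \<Rightarrow> (nat \<Rightarrow> bool) \<Rightarrow> nat set" where
  "T e e' = {k. k < n * l \<and> e (k div l + 1) \<noteq> e' (k div l + 1) \<and> l - 1 - k mod l \<in> \<Delta>}"

text \<open>Of the terms of the matchgate identity that starts with the words of \<open>e\<close> and \<open>e'\<close>, both altered
  at one position in block \<open>s\<close>, only those in which block \<open>s\<close> becomes a word of the pair survive.\<close>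

lemma block_identity:
  assumes s: "s \<in> {1..n}" and ee': "e s \<noteq> e' s" and i0: "i0 \<in> \<Delta>" and \<Delta>: "2 \<le> card \<Delta>"
  shows "(\<Sum>j\<in>\<Delta>. (-1) ^ card {k \<in> T e e'. k < pos s j}
      * matching_sum H (toggle (pos s j) (toggle (pos s i0) (ones l n (\<lambda>s. if e s then \<tau> else \<sigma>))))
      * matching_sum H (toggle (pos s j) (toggle (pos s i0) (ones l n (\<lambda>s. if e' s then \<tau> else \<sigma>))))) = 0"
proof -
  define W where "W e = (\<lambda>s. if e s then \<tau> else \<sigma>)" for e :: "nat \<Rightarrow> bool"
  let ?k0 = "pos s i0"
  have Wl: "W e r < 2 ^ l" for e r using \<sigma> \<tau> by (simp add: W_def)
  have i0l: "i0 < l" using \<Delta>_less[OF i0] .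
  note k0 = pos[OF s i0l]
  have sub: "toggle ?k0 (ones l n (W e)) \<subseteq> {..<length (outputs H)}" for e
    using k0(1) len by (intro toggle_subset) (auto simp: ones_def)
  have T_eq: "{k. (k \<in> toggle ?k0 (ones l n (W e))) \<noteq> (k \<in> toggle ?k0 (ones l n (W e')))} = T e e'"
    by (auto simp: in_toggle_iff ones_def W_def T_def \<Delta>_def)
  define F where "F k = (-1) ^ card {k' \<in> T e e'. k' < k}
      * matching_sum H (toggle k (toggle ?k0 (ones l n (W e))))
      * matching_sum H (toggle k (toggle ?k0 (ones l n (W e'))))" for k
  have "sum F (T e e') = 0"
    using matchgate_identity[OF gen sub[of e] sub[of e']] unfolding T_eq F_def .
  moreover have "sum F (T e e') = sum F (pos s ` \<Delta>)"
  proof (rule sum.mono_neutral_right)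
    show "finite (T e e')" by (rule finite_subset[of _ "{..<n * l}"]) (auto simp: T_def)
    show "pos s ` \<Delta> \<subseteq> T e e'"
      using pos[OF s] \<Delta>_less ee' by (auto simp: T_def)
    show "\<forall>k\<in>T e e' - pos s ` \<Delta>. F k = 0"
    proof
      fix k assume k: "k \<in> T e e' - pos s ` \<Delta>"
      have other: "k div l + 1 \<noteq> s"
      proof
        assume "k div l + 1 = s"
        then have "k = pos s (l - 1 - k mod l)" by (rule pos_block) (use i0l in simp)
        then show False using k by (auto simp: T_def)
      qed
      have kl: "k < n * l" "l - 1 - k mod l < l" using k i0l by (auto simp: T_def)
      \<comment> \<open>Since \<open>k\<close> lies in another block, block \<open>s\<close> of
        \<open>D'\<close> still differs from its original word in the single bit \<open>i0\<close>,
        and one of at least two differing bits is a proper part. So already the first factor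
        vanishes.\<close>
      define D where "D = (W e)(s := flip_bit i0 (W e s))"
      define D' where "D' = D(k div l + 1 := flip_bit (l - 1 - k mod l) (D (k div l + 1)))"
      have Dl: "D r < 2 ^ l" for r using Wl flip_bit_less[OF Wl i0l] by (simp add: D_def)
      have "toggle k (toggle ?k0 (ones l n (W e))) = ones l n D'"
        unfolding toggle_ones[OF k0(1)] k0(2,3) D_def[symmetric] toggle_ones[OF kl(1)] D'_def ..
      moreover have "matching_sum H (ones l n D') = 0"
      proof (rule vanish_flips[of "{i0}" s D' "W e s"])
        show "{i0} \<noteq> \<Delta>"
        proof
          assume "{i0} = \<Delta>"
          from arg_cong[OF this, of card] \<Delta> show False by simp
        qed
        show "D' r < 2 ^ l" for r using Dl flip_bit_less[OF Dl kl(2)] by (simp add: D'_def)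
        show "bit (D' s) i \<longleftrightarrow> bit (W e s) i \<noteq> (i \<in> {i0})" for i
          using other by (auto simp: D'_def D_def bit_flip_bit_iff)
      qed (use i0 s in \<open>auto simp: W_def\<close>)
      ultimately show "F k = 0" by (simp add: F_def)
    qed
  qed
  moreover have "inj_on (pos s) \<Delta>"
    by (rule inj_on_inverseI[where g = "\<lambda>k. l - 1 - k mod l"]) (use pos(3)[OF s] \<Delta>_less in auto)
  ultimately have "(\<Sum>j\<in>\<Delta>. F (pos s j)) = 0" by (simp add: sum.reindex)
  then show ?thesis by (simp add: F_def W_def)
qed

lemma toggle_two_positions:
  assumes s: "s \<in> {1..n}" and ij: "i < l" "j < l"
  shows "toggle (pos s j) (toggle (pos s i) (ones l n D)) = ones l n (D(s := flip_bit j (flip_bit i (D s))))"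
  unfolding toggle_ones[OF pos(1)[OF s ij(1)]] toggle_ones[OF pos(1)[OF s ij(2)]]
    pos(2,3)[OF s ij(1)] pos(2,3)[OF s ij(2)] by simp

lemma exchange:
  assumes \<Delta>: "2 \<le> card \<Delta>" and s: "s \<in> {1..n}"
  shows "val e * val e' = val (e(s := e' s)) * val (e'(s := e s))"
proof (cases "e s = e' s")
  case True
  have "e(s := e' s) = e" unfolding True[symmetric] by simp
  moreover have "e'(s := e s) = e'" unfolding True by simp
  ultimately show ?thesis by simp
next
  case False
  define W where "W e = (\<lambda>s. if e s then \<tau> else \<sigma>)" for e :: "nat \<Rightarrow> bool"
  have Wl: "W e r < 2 ^ l" for e r using \<sigma> \<tau> by (simp add: W_def)
  have val: "val e = matching_sum H (ones l n (W e))" for e by (simp add: val_def W_def)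
  obtain i0 where i0: "i0 \<in> \<Delta>" using \<Delta> by fastforce
  define F where "F e e' j = (-1) ^ card {k \<in> T e e'. k < pos s j}
      * matching_sum H (toggle (pos s j) (toggle (pos s i0) (ones l n (W e))))
      * matching_sum H (toggle (pos s j) (toggle (pos s i0) (ones l n (W e'))))" for e e' j
  have F_sum: "(\<Sum>j\<in>\<Delta>. F e e' j) = 0" if "e s \<noteq> e' s" for e e'
    using block_identity[of s e e' i0, OF s that i0 \<Delta>] by (simp add: F_def W_def)
  have F_i0: "F e e' i0 = (-1) ^ card {k \<in> T e e'. k < pos s i0} * val e * val e'" for e e'
    by (simp add: F_def val toggle_toggle)
  show ?thesis
  proof (cases "card \<Delta> = 2")
    case True
    then obtain x y where "\<Delta> = {x, y}" "x \<noteq> y" by (auto simp: card_2_iff)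
    then obtain j where j: "\<Delta> = {i0, j}" "j \<noteq> i0" using i0 by (metis insert_commute insertE singletonD)
    have ij: "i0 < l" "j < l" using \<Delta>_less j(1) by auto
    \<comment> \<open>With exactly two differing bits, flipping both carries one word of the pair to
      the other, so the term of \<open>j\<close> has block \<open>s\<close> exchanged in both
      words.\<close>
    have swap: "flip_bit j (flip_bit i0 (W e s)) = W (e(s := \<not> e s)) s" for e
    proof (rule bit_eqI)
      fix i
      have "i \<in> \<Delta> \<longleftrightarrow> i = i0 \<or> i = j" using j(1) by auto
      then have "bit \<sigma> i \<noteq> bit \<tau> i \<longleftrightarrow> i = i0 \<or> i = j" by (simp add: \<Delta>_def)
      then show "bit (flip_bit j (flip_bit i0 (W e s))) i = bit (W (e(s := \<not> e s)) s) i"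
        using j(2) by (auto simp: bit_flip_bit_iff W_def)
    qed
    have "(W e)(s := W (e(s := \<not> e s)) s) = W (e(s := \<not> e s))" for e by (auto simp: W_def)
    then have F_j: "F e e' j = (-1) ^ card {k \<in> T e e'. k < pos s j} * val (e(s := \<not> e s)) * val (e'(s := \<not> e' s))"
      for e e' by (simp add: F_def val toggle_two_positions[OF s ij] swap)
    \<comment> \<open>Within block \<open>s\<close> only the two positions in \<open>pos s\<close>
      applied to \<Delta> belong to \<open>T e e'\<close>, and nothing outside the block lies
      between them. Their ranks are consecutive, so their signs are opposite.\<close>
    have succ: "card {k \<in> T e e'. k < b} = card {k \<in> T e e'. k < a} + 1"
      if ab: "a < b" "{a, b} = pos s ` \<Delta>" for a b
    proof -
      have "k = a" if k: "k \<in> T e e'" "a \<le> k" "k < b" for k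
      proof -
        have "a \<in> pos s ` \<Delta>" "b \<in> pos s ` \<Delta>" using ab(2) by auto
        then have "a div l + 1 = s" "b div l + 1 = s" using pos(2)[OF s] \<Delta>_less by auto
        then have "k div l + 1 = s" using div_le_mono[of a k l] div_le_mono[of k b l] k by linarith
        then have "k = pos s (l - 1 - k mod l)" by (rule pos_block) (use ij in simp)
        moreover have "l - 1 - k mod l \<in> \<Delta>" using k(1) by (simp add: T_def)
        ultimately have "k \<in> {a, b}" unfolding ab(2) by (metis imageI)
        then show "k = a" using k(3) by auto
      qed
      moreover have "a \<in> T e e'"
      proof -
        have "a \<in> pos s ` \<Delta>" using ab(2) by auto
        then obtain i where "i \<in> \<Delta>" "a = pos s i" by blast
        then show ?thesis using pos[OF s, of i] \<Delta>_less[of i] False by (simp add: T_def)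
      qed
      ultimately have "{k \<in> T e e'. k < b} = insert a {k \<in> T e e'. k < a}" using ab(1) by force
      moreover have "finite {k \<in> T e e'. k < a}" by simp
      ultimately show ?thesis by simp
    qed
    have ne: "pos s i0 \<noteq> pos s j" using pos(3)[OF s ij(1)] pos(3)[OF s ij(2)] j(2) by auto
    have img: "{pos s i0, pos s j} = pos s ` \<Delta>" using j(1) by auto
    have sign: "(-1) ^ card {k \<in> T e e'. k < pos s j} = - ((-1) ^ card {k \<in> T e e'. k < pos s i0} :: complex)"
    proof (cases "pos s i0 < pos s j")
      case True
      show ?thesis using succ[OF True img] by simp
    next
      case False
      then have "pos s j < pos s i0" using ne by simp
      then show ?thesis using succ[of "pos s j" "pos s i0"] img by (simp add: insert_commute)
    qed
    have "e' s = (\<not> e s)" "e s = (\<not> e' s)" using False by auto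
    then have "e(s := e' s) = e(s := \<not> e s)" "e'(s := e s) = e'(s := \<not> e' s)" by auto
    moreover have "F e e' i0 + F e e' j = 0" using F_sum[of e e', OF False] j by simp
    then have "(-1) ^ card {k \<in> T e e'. k < pos s i0} * (val e * val e' - val (e(s := \<not> e s)) * val (e'(s := \<not> e' s))) = 0"
      unfolding F_i0 F_j sign by (simp add: algebra_simps)
    ultimately show ?thesis by simp
  next
    case card: False
    \<comment> \<open>With three or more differing bits, flipping two of them leaves the block
      strictly between \<sigma> and \<tau>, so the term of \<open>i0\<close> stands alone and
      vanishes. This applies to the exchanged words as well, hence both sides of the claim are
      zero.\<close>
    have zero: "val e * val e' = 0" if ee': "e s \<noteq> e' s" for e e'
    proof -
      have "F e e' j = 0" if j: "j \<in> \<Delta>" "j \<noteq> i0" for j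
      proof -
        have ij: "i0 < l" "j < l" using \<Delta>_less j(1) i0 by auto
        define D where "D = (W e)(s := flip_bit j (flip_bit i0 (W e s)))"
        have "matching_sum H (ones l n D) = 0"
        proof (rule vanish_flips[of "{i0, j}" s D "W e s"])
          show "{i0, j} \<noteq> \<Delta>"
          proof
            assume "{i0, j} = \<Delta>"
            from arg_cong[OF this, of card] card j(2) show False by simp
          qed
          show "D r < 2 ^ l" for r
            using Wl flip_bit_less[OF flip_bit_less[OF Wl ij(1)] ij(2)] by (simp add: D_def)
          show "bit (D s) i \<longleftrightarrow> bit (W e s) i \<noteq> (i \<in> {i0, j})" for i
            using j(2) by (auto simp: D_def bit_flip_bit_iff)
        qed (use i0 j s in \<open>auto simp: W_def\<close>)
        then show ?thesis by (simp add: F_def toggle_two_positions[OF s ij] D_def)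
      qed
      then have "(\<Sum>j\<in>\<Delta> - {i0}. F e e' j) = 0" by (intro sum.neutral) auto
      then have "F e e' i0 = 0" using F_sum[of e e', OF ee'] sum.remove[OF finite_\<Delta> i0, of "F e e'"] by simp
      then show ?thesis by (simp add: F_i0)
    qed
    have "val (e(s := e' s)) * val (e'(s := e s)) = 0" by (rule zero) (use False in auto)
    then show ?thesis using zero[of e e', OF False] by (simp only:)
  qed
qed

end

text \<open>All blocks agree outside bit \<open>i0\<close>, so the word of \<open>e\<close> is
  determined by this one bit per block: the bits read \<open>e\<close> itself if \<sigma> has a zero
  there, and the complement of \<open>e\<close> otherwise. Positions where both words have a zero
  become ordinary vertices.\<close>

lemma matchgate_signature_adjacent_words:
  assumes gen: "generator_matchgate H" and len: "length (outputs H) = n * l"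
    and \<sigma>: "\<sigma> < 2 ^ l" and \<tau>: "\<tau> < 2 ^ l" and i0: "{i. bit \<sigma> i \<noteq> bit \<tau> i} = {i0}"
    and v: "v \<in> carrier_vec (2 ^ n)"
    and v_eq: "\<And>x. x < 2 ^ n \<Longrightarrow>
      v $ x = matching_sum H (ones l n (\<lambda>s. if digit 2 n s x = 1 then \<tau> else \<sigma>))"
  shows "is_matchgate_signature n v"
proof -
  have ne: "bit \<sigma> i \<noteq> bit \<tau> i \<longleftrightarrow> i = i0" for i using i0 by blast
  have i0l: "i0 < l" using ne[of i0] bit_less_exp[OF \<sigma>] bit_less_exp[OF \<tau>] by blast
  \<comment> \<open>The offset of the kept output within its block counts from the left, while
    \<open>i0\<close> counts bits from the right.\<close>
  define c where "c = l - 1 - i0"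
  have c: "c < l" "l - 1 - c = i0" using i0l by (auto simp: c_def)
  define Z where "Z = {k. k < n * l \<and> l - 1 - k mod l \<noteq> i0 \<and> bit \<sigma> (l - 1 - k mod l)}"
  define ks where "ks = map (\<lambda>j. j * l + c) [0..<n]"
  have nth: "ks ! j = j * l + c" if "j < n" for j using that by (simp add: ks_def)
  have less: "j * l + c < n * l" if "j < n" for j
  proof -
    have "j * l + c < (j + 1) * l" using c(1) by simp
    also have "\<dots> \<le> n * l" using that by (intro mult_le_mono1) simp
    finally show ?thesis .
  qed
  have mod_c: "l - 1 - (j * l + c) mod l = i0" "(j * l + c) div l = j" for j using c by simp_all
  define H1 where "H1 = delete_outputs H Z ks"
  have H1: "generator_matchgate H1"
    unfolding H1_def
  proof (rule generator_delete_outputs[OF gen])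
    show "sorted_wrt (<) ks" using c(1) by (auto simp: ks_def sorted_wrt_map sorted_wrt_iff_nth_less)
    show "set ks \<subseteq> {..<length (outputs H)}" using less by (auto simp: ks_def len)
    show "Z \<subseteq> {..<length (outputs H)}" by (auto simp: Z_def len)
    show "set ks \<inter> Z = {}" using mod_c(1) by (auto simp: ks_def Z_def)
  qed
  have len1: "length (outputs H1) = n" by (simp add: H1_def delete_outputs_def ks_def)
  have ones_eq: "ones l n (\<lambda>s. if e s then \<tau> else \<sigma>)
      = Z \<union> (\<lambda>j. ks ! j) ` {j. j < n \<and> bit (if e (Suc j) then \<tau> else \<sigma>) i0}" (is "?L = Z \<union> ?R") for e
  proof (intro equalityI subsetI)
    fix k assume k: "k \<in> ?L"
    then have kl: "k < n * l" and b: "bit (if e (k div l + 1) then \<tau> else \<sigma>) (l - 1 - k mod l)"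
      by (auto simp: ones_def)
    show "k \<in> Z \<union> ?R"
    proof (cases "l - 1 - k mod l = i0")
      case True
      have "k mod l < l" using c(1) by simp
      then have "k mod l = c" using True by (simp add: c_def)
      then have "k = (k div l) * l + c" using div_mult_mod_eq[of k l] by simp
      moreover have "k div l < n" using block_less[OF kl] by simp
      ultimately have "k = ks ! (k div l)" "k div l < n" using nth[of "k div l"] by metis+
      moreover have "bit (if e (Suc (k div l)) then \<tau> else \<sigma>) i0" using b True by simp
      ultimately show ?thesis by blast
    next
      case False
      then have "bit \<sigma> (l - 1 - k mod l)" using b ne[of "l - 1 - k mod l"] by (cases "e (k div l + 1)") auto
      then show ?thesis using kl False by (simp add: Z_def)
    qed
  next
    fix k assume "k \<in> Z \<union> ?R"
    then show "k \<in> ?L"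
    proof
      assume "k \<in> Z"
      then show ?thesis using ne[of "l - 1 - k mod l"] by (auto simp: Z_def ones_def)
    next
      assume "k \<in> ?R"
      then obtain j where "j < n" "k = ks ! j" "bit (if e (Suc j) then \<tau> else \<sigma>) i0" by blast
      then show ?thesis using nth less mod_c by (simp add: ones_def)
    qed
  qed
  have sum_eq: "matching_sum H (ones l n (\<lambda>s. if e s then \<tau> else \<sigma>))
      = matching_sum H1 {j. j < n \<and> bit (if e (Suc j) then \<tau> else \<sigma>) i0}" for e
    unfolding ones_eq H1_def by (rule matching_sum_delete_outputs[symmetric]) (auto simp: ks_def)
  show ?thesis
  proof (cases "bit \<sigma> i0")
    case False
    then have eq: "{j. j < n \<and> bit (if e (Suc j) then \<tau> else \<sigma>) i0} = {j. j < n \<and> e (Suc j)}" for e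
      using ne[of i0] by auto
    have "v $ x = matching_sum H1 {k. k < n \<and> digit 2 n (Suc k) x = 1}" if "x < 2 ^ n" for x
      unfolding v_eq[OF that] sum_eq eq[of "\<lambda>s. digit 2 n s x = 1"] ..
    then show ?thesis by (rule is_matchgate_signatureI[OF H1 len1 v])
  next
    case True
    obtain H2 where H2: "generator_matchgate H2" "length (outputs H2) = n"
      "\<And>A. A \<subseteq> {..<n} \<Longrightarrow> matching_sum H2 A = matching_sum H1 ({..<n} - A)"
      using complementary_matchgate[OF H1] unfolding len1 by metis
    have compl: "{j. j < n \<and> bit (if e (Suc j) then \<tau> else \<sigma>) i0} = {..<n} - {j. j < n \<and> e (Suc j)}" for e
      using True ne[of i0] by auto
    have H2_sum: "matching_sum H2 {j. j < n \<and> e (Suc j)} = matching_sum H1 ({..<n} - {j. j < n \<and> e (Suc j)})" for e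
      by (rule H2(3)) auto
    have "v $ x = matching_sum H2 {k. k < n \<and> digit 2 n (Suc k) x = 1}" if "x < 2 ^ n" for x
      unfolding v_eq[OF that] sum_eq compl[of "\<lambda>s. digit 2 n s x = 1"] H2_sum[of "\<lambda>s. digit 2 n s x = 1"] ..
    then show ?thesis by (rule is_matchgate_signatureI[OF H2(1,2) v])
  qed
qed

section \<open>From the rows of the matrix to the matchgate, and the rank of the result\<close>

theorem theorem4p1:
  fixes n l t \<sigma> \<tau> :: nat
    and G uG :: "complex Matrix.vec"
    and M :: "complex Matrix.mat"
  assumes "G \<in> carrier_vec (2 ^ n)"
    and "full_rank 2 n G"
    and "t \<in> {1..n}"
    and "mat_rank (matrix_form 2 n t G) = 2"
    and "M \<in> carrier_mat (2 ^ l) 2"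
    and "mat_rank M = 2"
    and "uG = tensor_power n M *\<^sub>v G"
    and "is_matchgate_signature (n * l) uG"
    and "\<sigma> < 2 ^ l" and "\<tau> < 2 ^ l" and "\<sigma> \<noteq> \<tau>"
    and "lin_indpt_pair (Matrix.row (matrix_form (2 ^ l) n t uG) \<sigma>)
           (Matrix.row (matrix_form (2 ^ l) n t uG) \<tau>)"
    and "\<And>u v. u < 2 ^ l \<Longrightarrow> v < 2 ^ l \<Longrightarrow> u \<noteq> v \<Longrightarrow>
           lin_indpt_pair (Matrix.row (matrix_form (2 ^ l) n t uG) u)
             (Matrix.row (matrix_form (2 ^ l) n t uG) v) \<Longrightarrow>
           hamming_weight (Bit_Operations.xor \<sigma> \<tau>) \<le> hamming_weight (Bit_Operations.xor u v)"
  shows "is_matchgate_signature n (tensor_power n (two_rows M \<sigma> \<tau>) *\<^sub>v G) \<and>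
    (\<exists>s\<in>{1..n}. mat_rank (matrix_form 2 n s (tensor_power n (two_rows M \<sigma> \<tau>) *\<^sub>v G)) = 2)"
proof -
  define r where "r u = (\<lambda>i. M $$ (u, of_bool i))" for u
  define F where "F d = uG $ word (2 ^ l) n d" for d
  define G' where "G' = tensor_power n (two_rows M \<sigma> \<tau>) *\<^sub>v G"
  note G = assms(1) and t = assms(3) and M = assms(5) and \<sigma> = assms(9) and \<tau> = assms(10)
  have F_form: "F d = multilinear_form n G (\<lambda>s. r (d s))" if d: "\<And>s. s \<in> {1..n} \<Longrightarrow> d s < 2 ^ l" for d
  proof -
    have w: "word (2 ^ l) n d < (2 ^ l) ^ n" by (rule word_less) (rule d)
    have "F d = multilinear_form n G (\<lambda>s i. M $$ (digit (2 ^ l) n s (word (2 ^ l) n d), of_bool i))"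
      unfolding F_def assms(7) by (rule tensor_power_mult_vec[OF M G w])
    also have "\<dots> = multilinear_form n G (\<lambda>s. r (d s))"
    proof (rule multilinear_form_cong)
      fix s assume "s \<in> {1..n}"
      then have "digit (2 ^ l) n s (word (2 ^ l) n d) = d s" using digit_word[of n d "2 ^ l"] d by blast
      then show "(\<lambda>i. M $$ (digit (2 ^ l) n s (word (2 ^ l) n d), of_bool i)) = r (d s)" by (simp add: r_def)
    qed
    finally show ?thesis .
  qed
  have F_update: "F (d(t := u)) = multilinear_form n G ((\<lambda>s. r (d s))(t := r u))"
    if "\<forall>s\<in>{1..n}. d s < 2 ^ l" "u < 2 ^ l" for d u
    using that by (subst F_form) (auto intro!: multilinear_form_cong)
  have indpt: "p = 0 \<and> q = 0"
    if "\<And>d. \<forall>s\<in>{1..n}. d s < 2 ^ l \<Longrightarrow> p * F (d(t := \<sigma>)) + q * F (d(t := \<tau>)) = 0" for p q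
    using assms(12) that unfolding lin_indpt_rows_iff[OF t \<sigma> \<tau>] F_def by blast
  \<comment> \<open>By linearity in slot \<open>t\<close>, a relation between the rows \<sigma> and
    \<tau> of \<open>M\<close> would carry over to the corresponding rows of the matrix form of
    \<open>uG\<close>.\<close>
  have rows_indpt: "p = 0 \<and> q = 0" if pq: "\<And>i. p * r \<sigma> i + q * r \<tau> i = 0" for p q
  proof (rule indpt)
    fix d :: "nat \<Rightarrow> nat" assume d: "\<forall>s\<in>{1..n}. d s < 2 ^ l"
    let ?v = "\<lambda>s. r (d s)"
    have "p * F (d(t := \<sigma>)) + q * F (d(t := \<tau>)) = multilinear_form n G (?v(t := \<lambda>i. p * r \<sigma> i + q * r \<tau> i))"
      unfolding F_update[OF d \<sigma>] F_update[OF d \<tau>] by (rule multilinear_form_update[OF t, symmetric])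
    also have "\<dots> = 0" by (rule multilinear_form_zero[OF t]) (simp add: pq)
    finally show "p * F (d(t := \<sigma>)) + q * F (d(t := \<tau>)) = 0" .
  qed
  define \<alpha> \<beta> where "\<alpha> u = coord0 (r \<sigma>) (r \<tau>) (r u)" and "\<beta> u = coord1 (r \<sigma>) (r \<tau>) (r u)" for u
  have expand: "r u = (\<lambda>i. \<alpha> u * r \<sigma> i + \<beta> u * r \<tau> i)" for u
    unfolding \<alpha>_def \<beta>_def by (rule coord_expansion[OF rows_indpt])
  have F_expand: "F (d(t := u)) = \<alpha> u * F (d(t := \<sigma>)) + \<beta> u * F (d(t := \<tau>))"
    if d: "\<forall>s\<in>{1..n}. d s < 2 ^ l" and u: "u < 2 ^ l" for d u
    unfolding F_update[OF d u] F_update[OF d \<sigma>] F_update[OF d \<tau>]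
    by (subst expand) (rule multilinear_form_update[OF t])
  define dist where "dist x y = card {i. bit x i \<noteq> bit y i}" for x y :: nat
  have min: "dist \<sigma> \<tau> \<le> dist u v"
    if "u < 2 ^ l" "v < 2 ^ l" "u \<noteq> v"
      "\<And>p q. (\<And>d. \<forall>s\<in>{1..n}. d s < 2 ^ l \<Longrightarrow> p * F (d(t := u)) + q * F (d(t := v)) = 0) \<Longrightarrow> p = 0 \<and> q = 0" for u v
  proof -
    have "lin_indpt_pair (Matrix.row (matrix_form (2 ^ l) n t uG) u) (Matrix.row (matrix_form (2 ^ l) n t uG) v)"
      unfolding lin_indpt_rows_iff[OF t that(1,2)]
    proof (intro allI impI)
      fix p q
      assume *: "\<forall>d. (\<forall>s\<in>{1..n}. d s < 2 ^ l) \<longrightarrow>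
          p * uG $ word (2 ^ l) n (d(t := u)) + q * uG $ word (2 ^ l) n (d(t := v)) = 0"
      show "p = 0 \<and> q = 0" by (rule that(4)) (unfold F_def, rule *[THEN spec, THEN mp])
    qed
    then show ?thesis
      unfolding dist_def hamming_weight_xor[symmetric] by (rule assms(13)[OF that(1-3)])
  qed
  \<comment> \<open>If the coefficient of row \<open>u\<close> at \<tau> were nonzero, the rows
    \<sigma> and \<open>u\<close> of the matrix form of \<open>uG\<close> would be independent
    although \<open>u\<close> is closer to \<sigma> than \<tau> is. The coefficient at \<sigma> is
    excluded in the same way by the pair \<tau>, \<open>u\<close>.\<close>
  have row_0: "r u = (\<lambda>_. 0)"
    if u: "u < 2 ^ l" "u \<noteq> \<sigma>" "u \<noteq> \<tau>" "dist \<sigma> u < dist \<sigma> \<tau>" "dist \<tau> u < dist \<sigma> \<tau>" for u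
  proof -
    have "\<beta> u = 0"
    proof (rule ccontr)
      assume ne: "\<beta> u \<noteq> 0"
      have "dist \<sigma> \<tau> \<le> dist \<sigma> u"
      proof (rule min[OF \<sigma> u(1) u(2)[symmetric]])
        fix p q assume pq: "\<And>d. \<forall>s\<in>{1..n}. d s < 2 ^ l \<Longrightarrow> p * F (d(t := \<sigma>)) + q * F (d(t := u)) = 0"
        have "p + q * \<alpha> u = 0 \<and> q * \<beta> u = 0"
        proof (rule indpt)
          fix d :: "nat \<Rightarrow> nat" assume d: "\<forall>s\<in>{1..n}. d s < 2 ^ l"
          then show "(p + q * \<alpha> u) * F (d(t := \<sigma>)) + q * \<beta> u * F (d(t := \<tau>)) = 0"
            using pq[OF d] F_expand[OF d u(1)] by (simp add: algebra_simps)
        qed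
        then show "p = 0 \<and> q = 0" using ne by auto
      qed
      then show False using u(4) by simp
    qed
    moreover have "\<alpha> u = 0"
    proof (rule ccontr)
      assume ne: "\<alpha> u \<noteq> 0"
      have "dist \<sigma> \<tau> \<le> dist \<tau> u"
      proof (rule min[OF \<tau> u(1) u(3)[symmetric]])
        fix p q assume pq: "\<And>d. \<forall>s\<in>{1..n}. d s < 2 ^ l \<Longrightarrow> p * F (d(t := \<tau>)) + q * F (d(t := u)) = 0"
        have "q * \<alpha> u = 0 \<and> p + q * \<beta> u = 0"
        proof (rule indpt)
          fix d :: "nat \<Rightarrow> nat" assume d: "\<forall>s\<in>{1..n}. d s < 2 ^ l"
          then show "q * \<alpha> u * F (d(t := \<sigma>)) + (p + q * \<beta> u) * F (d(t := \<tau>)) = 0"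
            using pq[OF d] F_expand[OF d u(1)] by (simp add: algebra_simps)
        qed
        then show "p = 0 \<and> q = 0" using ne by auto
      qed
      then show False using u(5) by simp
    qed
    ultimately show ?thesis by (subst expand) simp
  qed
  obtain H where gen: "generator_matchgate H" and len: "length (outputs H) = n * l"
    and H: "uG = standard_signature H"
    using assms(8) unfolding is_matchgate_signature_def by blast
  have F_sum: "F d = matching_sum H (ones l n d)" if d: "\<And>s. s \<in> {1..n} \<Longrightarrow> d s < 2 ^ l" for d
  proof -
    have "word (2 ^ l) n d < 2 ^ length (outputs H)"
      using word_less[of n d, OF d] by (simp add: len power_mult[symmetric] mult.commute)
    moreover have "{k. k < n * l \<and> digit 2 (n * l) (Suc k) (word (2 ^ l) n d) = 1} = ones l n d"
      by (rule removed_positions_word) (rule d)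
    ultimately show ?thesis
      using standard_signature_matching_sum[of "word (2 ^ l) n d" H] unfolding F_def H len by metis
  qed
  interpret closest_pair H n l \<sigma> \<tau>
  proof
    fix D s
    assume s: "s \<in> {1..n}" and D: "\<And>r. r \<in> {1..n} \<Longrightarrow> D r < 2 ^ l" and ne: "D s \<noteq> \<sigma>" "D s \<noteq> \<tau>"
      and "card {i. bit \<sigma> i \<noteq> bit (D s) i} < card {i. bit \<sigma> i \<noteq> bit \<tau> i}"
        "card {i. bit \<tau> i \<noteq> bit (D s) i} < card {i. bit \<sigma> i \<noteq> bit \<tau> i}"
    then have "r (D s) = (\<lambda>_. 0)" by (intro row_0) (auto simp: dist_def)
    then have "multilinear_form n G (\<lambda>s. r (D s)) = 0" by (intro multilinear_form_zero[OF s]) simp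
    moreover have "F D = multilinear_form n G (\<lambda>s. r (D s))" by (rule F_form) (rule D)
    moreover have "F D = matching_sum H (ones l n D)" by (rule F_sum) (rule D)
    ultimately show "matching_sum H (ones l n D) = 0" by simp
  qed (use gen len \<sigma> \<tau> in auto)
  have val_form: "val e = multilinear_form n G (\<lambda>s. if e s then r \<tau> else r \<sigma>)" for e
  proof -
    have "val e = F (\<lambda>s. if e s then \<tau> else \<sigma>)" unfolding val_def by (rule F_sum[symmetric]) (use \<sigma> \<tau> in auto)
    also have "\<dots> = multilinear_form n G (\<lambda>s. if e s then r \<tau> else r \<sigma>)"
      using \<sigma> \<tau> by (subst F_form) (auto intro!: multilinear_form_cong)
    finally show ?thesis .
  qed
  have "card \<Delta> < 2"
  proof (rule ccontr)
    assume "\<not> card \<Delta> < 2"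
    then have \<Delta>: "2 \<le> card \<Delta>" by simp
    have "degenerate 2 n G"
    proof (rule degenerate_if_exchange[of "r \<sigma>" "r \<tau>"])
      show "p = 0 \<and> q = 0" if "\<And>i. p * r \<sigma> i + q * r \<tau> i = 0" for p q
        using that by (rule rows_indpt)
      show "1 \<le> n" using t by simp
      show "G \<in> carrier_vec (2 ^ n)" by (rule G)
      fix e e' :: "nat \<Rightarrow> bool" and s assume "s \<in> {1..n}"
      from exchange[OF \<Delta> this, of e e']
      show "multilinear_form n G (\<lambda>s. if e s then r \<tau> else r \<sigma>)
            * multilinear_form n G (\<lambda>s. if e' s then r \<tau> else r \<sigma>)
          = multilinear_form n G (\<lambda>r'. if (e(s := e' s)) r' then r \<tau> else r \<sigma>)
            * multilinear_form n G (\<lambda>r'. if (e'(s := e s)) r' then r \<tau> else r \<sigma>)"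
        unfolding val_form .
    qed
    then show False using assms(2) by (simp add: full_rank_def)
  qed
  moreover have "\<Delta> \<noteq> {}" using assms(11) by (auto simp: \<Delta>_def intro: bit_eqI)
  then have "card \<Delta> \<noteq> 0" using finite_\<Delta> by simp
  ultimately have "card \<Delta> = 1" by simp
  then obtain i0 where i0: "\<Delta> = {i0}" by (rule card_1_singletonE)
  have two: "two_rows M \<sigma> \<tau> \<in> carrier_mat 2 2"
    using M mat_of_rows_carrier(1)[of 2 "[Matrix.row M \<sigma>, Matrix.row M \<tau>]"]
    by (simp add: two_rows_def numeral_2_eq_2)
  have two_entry: "two_rows M \<sigma> \<tau> $$ (a, of_bool i) = (if a = 1 then r \<tau> i else r \<sigma> i)" if "a < 2" for a i
    using that M \<sigma> \<tau> by (cases a; cases i) (auto simp: two_rows_def mat_of_rows_def r_def less_Suc_eq)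
  have G'_val: "G' $ x = val (\<lambda>s. digit 2 n s x = 1)" if x: "x < 2 ^ n" for x
    unfolding G'_def tensor_power_mult_vec[OF two G x] val_form
    by (rule multilinear_form_cong) (auto simp: fun_eq_iff two_entry digit_less)
  have G'_word: "G' $ word 2 n d = multilinear_form n G (\<lambda>s. if d s = 1 then r \<tau> else r \<sigma>)"
    if d: "\<And>s. s \<in> {1..n} \<Longrightarrow> d s < 2" for d
  proof -
    have "word 2 n d < 2 ^ n" by (rule word_less) (rule d)
    moreover have "digit 2 n s (word 2 n d) = d s" if "s \<in> {1..n}" for s
      by (rule digit_word) (use d that in auto)
    then have "multilinear_form n G (\<lambda>s. if digit 2 n s (word 2 n d) = 1 then r \<tau> else r \<sigma>)
        = multilinear_form n G (\<lambda>s. if d s = 1 then r \<tau> else r \<sigma>)"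
      by (intro multilinear_form_cong) simp
    ultimately show ?thesis by (simp only: G'_val val_form)
  qed
  have G'_carrier: "G' \<in> carrier_vec (2 ^ n)"
    using carrier_matD(1)[OF two] by (intro carrier_vecI) (simp add: G'_def tensor_power_def)
  have sig: "is_matchgate_signature n G'"
  proof (rule matchgate_signature_adjacent_words[OF gen len \<sigma> \<tau> _ G'_carrier])
    show "{i. bit \<sigma> i \<noteq> bit \<tau> i} = {i0}" using i0 unfolding \<Delta>_def .
    show "G' $ x = matching_sum H (ones l n (\<lambda>s. if digit 2 n s x = 1 then \<tau> else \<sigma>))" if "x < 2 ^ n" for x
      unfolding G'_val[OF that] val_def ..
  qed
  have one_less_2: "(1 :: nat) < 2" by simp
  have "lin_indpt_pair (Matrix.row (matrix_form 2 n t G') 0) (Matrix.row (matrix_form 2 n t G') 1)"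
    unfolding lin_indpt_rows_iff[OF t, of 0 2 1, OF pos2 one_less_2]
  proof (intro allI impI)
    fix p q
    assume pq: "\<forall>d. (\<forall>s\<in>{1..n}. d s < 2) \<longrightarrow> p * G' $ word 2 n (d(t := 0)) + q * G' $ word 2 n (d(t := 1)) = 0"
    \<comment> \<open>The assumed relation with arbitrary vectors in the slots other than
      \<open>t\<close>. With rows \<sigma> and \<tau> in them it is the relation between the two
      rows of the new matrix form; multilinearity extends it to all vectors, in particular to all
      rows of \<open>M\<close>, where \<open>indpt\<close> refutes a nontrivial relation.\<close>
    define P where "P v \<longleftrightarrow> p * multilinear_form n G (v(t := r \<sigma>)) + q * multilinear_form n G (v(t := r \<tau>)) = 0"
      for v :: "nat \<Rightarrow> bool \<Rightarrow> complex"
    have "P v" for v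
    proof (rule span_induct_slots[where P = P and n = n and basea = "r \<sigma>" and baseb = "r \<tau>"])
      fix s v a b x y
      assume s: "s \<in> {1..n}" and ab: "P (v(s := a))" "P (v(s := b))"
      show "P (v(s := \<lambda>i. x * a i + y * b i))"
      \<comment> \<open>\<open>P\<close> overwrites slot \<open>t\<close>, so a change in this slot
        does not affect it.\<close>
      proof (cases "s = t")
        case True
        then show ?thesis using ab(1) by (simp add: P_def)
      next
        case False
        have "x * (p * multilinear_form n G (v(t := r \<sigma>, s := a)) + q * multilinear_form n G (v(t := r \<tau>, s := a)))
          + y * (p * multilinear_form n G (v(t := r \<sigma>, s := b)) + q * multilinear_form n G (v(t := r \<tau>, s := b))) = 0"
          using ab by (simp add: P_def fun_upd_twist[OF False])
        then show ?thesis
          by (simp add: P_def fun_upd_twist[OF False] multilinear_form_update[OF s] algebra_simps)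
      qed
    next
      fix v assume v: "\<And>s. s \<in> {1..n} \<Longrightarrow> v s = r \<sigma> \<or> v s = r \<tau>"
      define d where "d s = (if v s = r \<tau> then 1 else 0 :: nat)" for s
      have upd: "multilinear_form n G (v(t := if a = 1 then r \<tau> else r \<sigma>)) = G' $ word 2 n (d(t := a))" if "a < 2" for a :: nat
      proof -
        have "G' $ word 2 n (d(t := a)) = multilinear_form n G (\<lambda>s. if (d(t := a)) s = 1 then r \<tau> else r \<sigma>)"
          by (rule G'_word) (use that in \<open>auto simp: d_def\<close>)
        also have "\<dots> = multilinear_form n G (v(t := if a = 1 then r \<tau> else r \<sigma>))"
        proof (rule multilinear_form_cong)
          show "(if (d(t := a)) s = 1 then r \<tau> else r \<sigma>) = (v(t := if a = 1 then r \<tau> else r \<sigma>)) s"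
            if "s \<in> {1..n}" for s
            using v[OF that] by (cases "s = t") (auto simp: d_def)
        qed
        finally show ?thesis ..
      qed
      show "P v" using pq[rule_format, of d] upd[of 0] upd[of 1] by (simp add: P_def d_def)
    next
      show "\<exists>p q. u = (\<lambda>i. p * r \<sigma> i + q * r \<tau> i)" for u using coord_expansion[of "r \<sigma>" "r \<tau>" u, OF rows_indpt] by blast
    qed
    then show "p = 0 \<and> q = 0" by (intro indpt) (simp add: F_update \<sigma> \<tau> P_def)
  qed
  then have "mat_rank (matrix_form 2 n t G') = 2"
    by (rule mat_rank_two_rows[rotated]) (auto simp: matrix_form_def)
  with sig show ?thesis using t unfolding G'_def by blast
qed

end
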